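(* Let $\alpha$, $\mathcal T$, $\mathcal C$ be as in the context. The forgetful functor $$\Phi\colon\mathbf{Pres}_\infty^{\simeq}\longrightarrow\mathbf{Post}_\infty^{\simeq},\qquad \Phi(X,X_*,P_* )=(X_*,P_* ),$$ is an equivalence of categories which is surjective on objects.
   Context: Let $\alpha$ be a (infinite) regular cardinal. In a triangulated category $\mathcal T$ with coproducts and suspension $\Sigma$, an object $S$ is $\alpha$-small if any morphism $S\to\coprod_{i\in I}X_i$ factors through $\coprod_{i\in I'}X_i$ for some $I'\subset I$ with $\mathrm{card}\,I'<\alpha$. A class $\mathcal S$ of objects generates $\mathcal T$ if an object $X$ is zero if and only if $\mathcal T(S,X)=0$ for all $S\in\mathcal S$. It is perfect if, for every set $\{f_i\colon X_i\to Y_i\}_{i\in I}$ of morphisms such that $\mathcal T(S,f_i)$ is surjective for all $i$ and all $S\in\mathcal S$, the map $\mathcal T(S,\coprod_i f_i)$ is surjective for all $S\in\mathcal S$. $\mathcal T$ is $\alpha$-compactly generated if it has a perfect generating set of $\alpha$-small objects, and well generated if it is so for some regular $\alpha$. $\mathcal T^\alpha$ is the unique maximal full subcategory of $\mathcal T$ formed by $\alpha$-small objects such that any morphism $S\to\coprod_{i\in I}X_i$ with $S\in\mathcal T^\alpha$ factors through a coproduct $\coprod f_i\colon\coprod_i S_i\to\coprod_i X_i$ with all $S_i\in\mathcal T^\alpha$. Standing assumptions: $\mathcal T$ is a non-zero well generated triangulated category and $\mathcal C\subset\mathcal T^\alpha$ is a non-zero essentially small full subcategory of $\mathcal T$ which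 is closed under suspension and desuspension, has coproducts of fewer than $\alpha$ objects (computed in $\mathcal T$), generates $\mathcal T$, and is perfect. $\mathrm{Mod}_\alpha(\mathcal C)$ is the abelian category of functors $\mathcal C^{\mathrm{op}}\to\mathrm{Ab}$ preserving products of fewer than $\alpha$ objects, and $S_\alpha(X)=\mathcal T(-,X)|_{\mathcal C}$. $\mathrm{Add}(\mathcal C)$ is the smallest subcategory of $\mathcal T$ containing $\mathcal C$ and closed under coproducts and retracts; $S_\alpha$ identifies it with the projective objects of $\mathrm{Mod}_\alpha(\mathcal C)$. A degree $+m$ morphism $X\to Y$ is a morphism $X\to\Sigma^mY$; composites of graded morphisms are formed after suspending. A Postnikov system $(X_*,P_* )$ consists of exact triangles $P_n\xrightarrow{f_n}X_{n-1}\xrightarrow{i_n}X_n\xrightarrow{q_n}\Sigma P_n$, $n\ge0$, with $X_{-1}=0$ and $P_n\in\mathrm{Add}(\mathcal C)$, such that $S_\alpha$ maps the sequence $P_0\leftarrow P_1\leftarrow P_2\leftarrow\cdots$, with differentials $q_nf_{n+1}\colon P_{n+1}\to\Sigma P_n$ of degree $+1$, to a sequence of projective objects of $\mathrm{Mod}_\alpha(\mathcal C)$ which is exact at $S_\alpha(P_n)$ for all $n\ge1$. A morphism $(\psi_*,\varphi_* )\colon(X_*,P_* )\to(Y_*,Q_* )$ consists of morphisms $\psi_n\colon X_n\to Y_n$, $\varphi_n\colon P_n\to Q_n$, $n\ge 0$, commuting with all $f_n,i_n,q_n$. Two morphisms $(\psi_*,\varphi_* )$, $(\bar\psi_*,\bar\varphi_*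 )$ are homotopic if $\psi_ni_n^X=\bar\psi_ni_n^X$ for all $n>0$ (equivalently $i_n^Y\psi_{n-1}=i_n^Y\bar\psi_{n-1}$ for all $n>0$). $\mathbf{Post}_\infty^{\simeq}$ is the category of Postnikov systems and homotopy classes of morphisms. A Postnikov resolution $(X,X_*,P_* )$ of an object $X$ consists of exact triangles as in a Postnikov system together with morphisms $p_n\colon X_n\to\Sigma X$ with $p_n=p_{n+1}i_{n+1}$, $n\ge0$, such that $S_\alpha$ maps $X\leftarrow P_0\leftarrow P_1\leftarrow\cdots$, with augmentation $p_0q_0^{-1}$ of degree $0$ ($q_0$ is an isomorphism) and differentials $q_nf_{n+1}$ of degree $+1$, to a projective resolution of $S_\alpha(X)$. A morphism $(h,\psi_*,\varphi_* )$ consists of $h\colon X\to Y$, $\psi_n\colon X_n\to Y_n$, $\varphi_n\colon P_n\to Q_n$ commuting with all $f_n,i_n,q_n,p_n$; two such morphisms are homotopic if $\psi_ni_n^X=\bar\psi_ni_n^X$ for all $n>0$. $\mathbf{Pres}_\infty^{\simeq}$ is the category of Postnikov resolutions of objects of $\mathcal T$ and homotopy classes of morphisms. *)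

theory Defs
  imports "HOL-Algebra.Product_Groups"
begin

unbundle cardinal_syntax

section \<open>Categories, functors, equivalences\<close>

record ('o, 'm) cat =
  Ob :: "'o set"
  Ar :: "'m set"
  Dom :: "'m \<Rightarrow> 'o"
  Cod :: "'m \<Rightarrow> 'o"
  Idn :: "'o \<Rightarrow> 'm"
  Comp :: "'m \<Rightarrow> 'm \<Rightarrow> 'm"  (infixr "\<cdot>\<index>" 70)

definition Hom :: "('o, 'm, 'z) cat_scheme \<Rightarrow> 'o \<Rightarrow> 'o \<Rightarrow> 'm set" where
  "Hom K X Y = {f \<in> Ar K. Dom K f = X \<and> Cod K f = Y}"

locale category =
  fixes K :: "('o, 'm, 'z) cat_scheme" (structure)
  assumes dom_ob: "f \<in> Ar K \<Longrightarrow> Dom K f \<in> Ob K"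
    and cod_ob: "f \<in> Ar K \<Longrightarrow> Cod K f \<in> Ob K"
    and idn_hom: "X \<in> Ob K \<Longrightarrow> Idn K X \<in> Hom K X X"
    and comp_hom: "\<lbrakk>f \<in> Hom K X Y; g \<in> Hom K Y Z\<rbrakk> \<Longrightarrow> g \<cdot> f \<in> Hom K X Z"
    and comp_assoc: "\<lbrakk>f \<in> Hom K W X; g \<in> Hom K X Y; h \<in> Hom K Y Z\<rbrakk> \<Longrightarrow> (h \<cdot> g) \<cdot> f = h \<cdot> (g \<cdot> f)"
    and idn_left: "f \<in> Hom K X Y \<Longrightarrow> Idn K Y \<cdot> f = f"
    and idn_right: "f \<in> Hom K X Y \<Longrightarrow> f \<cdot> Idn K X = f"

definition full_sub :: "('o, 'm, 'z) cat_scheme \<Rightarrow> 'o set \<Rightarrow> ('o, 'm) cat" where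
  "full_sub K S = \<lparr>Ob = S, Ar = {f \<in> Ar K. Dom K f \<in> S \<and> Cod K f \<in> S},
     Dom = Dom K, Cod = Cod K, Idn = Idn K, Comp = Comp K\<rparr>"

definition inverse_ars :: "('o, 'm, 'z) cat_scheme \<Rightarrow> 'm \<Rightarrow> 'm \<Rightarrow> bool" where
  "inverse_ars K f g \<longleftrightarrow> f \<in> Ar K \<and> g \<in> Hom K (Cod K f) (Dom K f) \<and>
     g \<cdot>\<^bsub>K\<^esub> f = Idn K (Dom K f) \<and> f \<cdot>\<^bsub>K\<^esub> g = Idn K (Cod K f)"

definition is_iso :: "('o, 'm, 'z) cat_scheme \<Rightarrow> 'm \<Rightarrow> bool" where
  "is_iso K f \<longleftrightarrow> (\<exists>g. inverse_ars K f g)"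

definition inv_ar :: "('o, 'm, 'z) cat_scheme \<Rightarrow> 'm \<Rightarrow> 'm" where
  "inv_ar K f = (THE g. inverse_ars K f g)"

definition isomorphic :: "('o, 'm, 'z) cat_scheme \<Rightarrow> 'o \<Rightarrow> 'o \<Rightarrow> bool" where
  "isomorphic K X Y \<longleftrightarrow> (\<exists>f \<in> Hom K X Y. is_iso K f)"

definition is_epi :: "('o, 'm, 'z) cat_scheme \<Rightarrow> 'm \<Rightarrow> bool" where
  "is_epi K e \<longleftrightarrow> e \<in> Ar K \<and>
     (\<forall>Z \<in> Ob K. \<forall>u \<in> Hom K (Cod K e) Z. \<forall>v \<in> Hom K (Cod K e) Z.
        u \<cdot>\<^bsub>K\<^esub> e = v \<cdot>\<^bsub>K\<^esub> e \<longrightarrow> u = v)"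

definition projective :: "('o, 'm, 'z) cat_scheme \<Rightarrow> 'o \<Rightarrow> bool" where
  "projective K P \<longleftrightarrow> P \<in> Ob K \<and>
     (\<forall>e f. is_epi K e \<and> f \<in> Hom K P (Cod K e) \<longrightarrow>
        (\<exists>g \<in> Hom K P (Dom K e). e \<cdot>\<^bsub>K\<^esub> g = f))"

definition is_zero_ob :: "('o, 'm, 'z) cat_scheme \<Rightarrow> 'o \<Rightarrow> bool" where
  "is_zero_ob K Z \<longleftrightarrow> Z \<in> Ob K \<and>
     (\<forall>X \<in> Ob K. (\<exists>!f. f \<in> Hom K X Z) \<and> (\<exists>!f. f \<in> Hom K Z X))"

definition zero_ob :: "('o, 'm, 'z) cat_scheme \<Rightarrow> 'o" where
  "zero_ob K = (SOME Z. is_zero_ob K Z)"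

definition is_coproduct ::
  "('o, 'm, 'z) cat_scheme \<Rightarrow> 'i set \<Rightarrow> ('i \<Rightarrow> 'o) \<Rightarrow> 'o \<Rightarrow> ('i \<Rightarrow> 'm) \<Rightarrow> bool" where
  "is_coproduct K I X Q \<iota> \<longleftrightarrow> Q \<in> Ob K \<and> (\<forall>i \<in> I. \<iota> i \<in> Hom K (X i) Q) \<and>
     (\<forall>Y \<in> Ob K. \<forall>g. (\<forall>i \<in> I. g i \<in> Hom K (X i) Y) \<longrightarrow>
        (\<exists>!h. h \<in> Hom K Q Y \<and> (\<forall>i \<in> I. h \<cdot>\<^bsub>K\<^esub> \<iota> i = g i)))"

text \<open>The morphism \<open>F\<close> is the coproduct of the morphisms \<open>f i\<close> with respect to two coproduct cocones.\<close>

definition is_coproduct_ar ::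
  "('o, 'm, 'z) cat_scheme \<Rightarrow> 'i set \<Rightarrow> ('i \<Rightarrow> 'm) \<Rightarrow> 'o \<Rightarrow> ('i \<Rightarrow> 'm) \<Rightarrow> 'o \<Rightarrow> ('i \<Rightarrow> 'm) \<Rightarrow> 'm \<Rightarrow> bool"
where
  "is_coproduct_ar K I f Q \<iota> R \<rho> F \<longleftrightarrow> (\<forall>i \<in> I. f i \<in> Ar K) \<and>
     is_coproduct K I (\<lambda>i. Dom K (f i)) Q \<iota> \<and> is_coproduct K I (\<lambda>i. Cod K (f i)) R \<rho> \<and>
     F \<in> Hom K Q R \<and> (\<forall>i \<in> I. F \<cdot>\<^bsub>K\<^esub> \<iota> i = \<rho> i \<cdot>\<^bsub>K\<^esub> f i)"

locale cat_functor =
  source: category K + target: category L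
  for K :: "('o, 'm, 'z) cat_scheme" and L :: "('p, 'n, 'y) cat_scheme" +
  fixes FO :: "'o \<Rightarrow> 'p" and FA :: "'m \<Rightarrow> 'n"
  assumes ob: "X \<in> Ob K \<Longrightarrow> FO X \<in> Ob L"
    and ar: "f \<in> Hom K X Y \<Longrightarrow> FA f \<in> Hom L (FO X) (FO Y)"
    and idn: "X \<in> Ob K \<Longrightarrow> FA (Idn K X) = Idn L (FO X)"
    and comp: "\<lbrakk>f \<in> Hom K X Y; g \<in> Hom K Y Z\<rbrakk> \<Longrightarrow> FA (g \<cdot>\<^bsub>K\<^esub> f) = FA g \<cdot>\<^bsub>L\<^esub> FA f"

definition natural_iso ::
  "('o, 'm, 'z) cat_scheme \<Rightarrow> ('p, 'n, 'y) cat_scheme \<Rightarrow> ('o \<Rightarrow> 'p) \<Rightarrow> ('m \<Rightarrow> 'n) \<Rightarrow>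
   ('o \<Rightarrow> 'p) \<Rightarrow> ('m \<Rightarrow> 'n) \<Rightarrow> ('o \<Rightarrow> 'n) \<Rightarrow> bool" where
  "natural_iso K L FO FA GO GA \<eta> \<longleftrightarrow>
     (\<forall>X \<in> Ob K. \<eta> X \<in> Hom L (FO X) (GO X) \<and> is_iso L (\<eta> X)) \<and>
     (\<forall>f \<in> Ar K. \<eta> (Cod K f) \<cdot>\<^bsub>L\<^esub> FA f = GA f \<cdot>\<^bsub>L\<^esub> \<eta> (Dom K f))"

definition is_equivalence ::
  "('o, 'm, 'z) cat_scheme \<Rightarrow> ('p, 'n, 'y) cat_scheme \<Rightarrow> ('o \<Rightarrow> 'p) \<Rightarrow> ('m \<Rightarrow> 'n) \<Rightarrow> bool" where
  "is_equivalence K L FO FA \<longleftrightarrow> cat_functor K L FO FA \<and>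
     (\<exists>GO GA \<eta> \<epsilon>. cat_functor L K GO GA \<and>
        natural_iso K K id id (GO \<circ> FO) (GA \<circ> FA) \<eta> \<and>
        natural_iso L L (FO \<circ> GO) (FA \<circ> GA) id id \<epsilon>)"

text \<open>The quotient by a congruence \<open>R\<close> on arrows; its arrows are the \<open>R\<close>-classes.\<close>

definition quotient_cat :: "('o, 'm, 'z) cat_scheme \<Rightarrow> ('m \<times> 'm) set \<Rightarrow> ('o, 'm set) cat" where
  "quotient_cat K R = \<lparr>Ob = Ob K, Ar = Ar K // R,
     Dom = (\<lambda>c. the_elem (Dom K ` c)), Cod = (\<lambda>c. the_elem (Cod K ` c)),
     Idn = (\<lambda>X. R `` {Idn K X}),
     Comp = (\<lambda>d c. R `` {g \<cdot>\<^bsub>K\<^esub> f |g f. g \<in> d \<and> f \<in> c})\<rparr>"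


section \<open>Additive and triangulated categories\<close>

record ('o, 'm) addcat = "('o, 'm) cat" +
  Plus :: "'m \<Rightarrow> 'm \<Rightarrow> 'm"
  Zero :: "'o \<Rightarrow> 'o \<Rightarrow> 'm"

definition hom_group :: "('o, 'm, 'z) addcat_scheme \<Rightarrow> 'o \<Rightarrow> 'o \<Rightarrow> 'm monoid" where
  "hom_group K X Y = \<lparr>carrier = Hom K X Y, mult = Plus K, one = Zero K X Y\<rparr>"

definition neg :: "('o, 'm, 'z) addcat_scheme \<Rightarrow> 'm \<Rightarrow> 'm" where
  "neg K f = inv\<^bsub>hom_group K (Dom K f) (Cod K f)\<^esub> f"

locale additive = category K
  for K :: "('o, 'm, 'z) addcat_scheme" (structure) +
  assumes hom_comm_group: "\<lbrakk>X \<in> Ob K; Y \<in> Ob K\<rbrakk> \<Longrightarrow> comm_group (hom_group K X Y)"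
    and comp_plus_left: "\<lbrakk>f \<in> Hom K X Y; g \<in> Hom K Y Z; h \<in> Hom K Y Z\<rbrakk>
           \<Longrightarrow> Plus K g h \<cdot> f = Plus K (g \<cdot> f) (h \<cdot> f)"
    and comp_plus_right: "\<lbrakk>f \<in> Hom K X Y; g \<in> Hom K X Y; h \<in> Hom K Y Z\<rbrakk>
           \<Longrightarrow> h \<cdot> Plus K f g = Plus K (h \<cdot> f) (h \<cdot> g)"
    and ex_zero_ob: "\<exists>Z. is_zero_ob K Z"
    and ex_binary_coproduct: "\<lbrakk>X \<in> Ob K; Y \<in> Ob K\<rbrakk>
           \<Longrightarrow> \<exists>Q \<iota>. is_coproduct K (UNIV :: bool set) (case_bool X Y) Q \<iota>"

definition is_kernel :: "('o, 'm, 'z) addcat_scheme \<Rightarrow> 'm \<Rightarrow> 'm \<Rightarrow> bool" where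
  "is_kernel K k g \<longleftrightarrow> g \<in> Ar K \<and> k \<in> Ar K \<and> Cod K k = Dom K g \<and>
     g \<cdot>\<^bsub>K\<^esub> k = Zero K (Dom K k) (Cod K g) \<and>
     (\<forall>h \<in> Ar K. Cod K h = Dom K g \<and> g \<cdot>\<^bsub>K\<^esub> h = Zero K (Dom K h) (Cod K g) \<longrightarrow>
        (\<exists>!u. u \<in> Hom K (Dom K h) (Dom K k) \<and> k \<cdot>\<^bsub>K\<^esub> u = h))"

text \<open>Exactness of \<open>f\<close>, \<open>g\<close> at \<open>Cod f = Dom g\<close> in an abelian category: the kernel of \<open>g\<close> is the
  image of \<open>f\<close>, i.e.\ \<open>f\<close> is an epimorphism onto a kernel of \<open>g\<close>.\<close>

definition exact_at :: "('o, 'm, 'z) addcat_scheme \<Rightarrow> 'm \<Rightarrow> 'm \<Rightarrow> bool" where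
  "exact_at K f g \<longleftrightarrow>
     (\<exists>k e. is_kernel K k g \<and> is_epi K e \<and> Cod K e = Dom K k \<and> f = k \<cdot>\<^bsub>K\<^esub> e)"

record ('o, 'm) tricat = "('o, 'm) addcat" +
  SigO :: "'o \<Rightarrow> 'o"
  SigA :: "'m \<Rightarrow> 'm"
  Tri :: "('m \<times> 'm \<times> 'm) set"

definition triangle_shape :: "('o, 'm, 'z) tricat_scheme \<Rightarrow> 'm \<Rightarrow> 'm \<Rightarrow> 'm \<Rightarrow> bool" where
  "triangle_shape T f g h \<longleftrightarrow> f \<in> Ar T \<and> g \<in> Ar T \<and> h \<in> Ar T \<and>
     Cod T f = Dom T g \<and> Cod T g = Dom T h \<and> Cod T h = SigO T (Dom T f)"

text \<open>The suspension is a self-equivalence (fully faithful and essentially surjective), not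
  necessarily an automorphism.  Axioms (TR1)--(TR4) are Verdier's.\<close>

locale triangulated = additive T + suspension: cat_functor T T "SigO T" "SigA T"
  for T :: "('o, 'm, 'z) tricat_scheme" (structure) +
  assumes sus_plus: "\<lbrakk>f \<in> Hom T X Y; g \<in> Hom T X Y\<rbrakk>
           \<Longrightarrow> SigA T (Plus T f g) = Plus T (SigA T f) (SigA T g)"
    and sus_fully_faithful: "\<lbrakk>X \<in> Ob T; Y \<in> Ob T\<rbrakk>
           \<Longrightarrow> bij_betw (SigA T) (Hom T X Y) (Hom T (SigO T X) (SigO T Y))"
    and sus_ess_surj: "Y \<in> Ob T \<Longrightarrow> \<exists>X \<in> Ob T. isomorphic T (SigO T X) Y"
    and tri_shape: "(f, g, h) \<in> Tri T \<Longrightarrow> triangle_shape T f g h"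
    and tri_iso: "\<lbrakk>(f, g, h) \<in> Tri T; triangle_shape T f' g' h';
           a \<in> Hom T (Dom T f) (Dom T f'); b \<in> Hom T (Dom T g) (Dom T g');
           c \<in> Hom T (Dom T h) (Dom T h'); is_iso T a; is_iso T b; is_iso T c;
           b \<cdot> f = f' \<cdot> a; c \<cdot> g = g' \<cdot> b; SigA T a \<cdot> h = h' \<cdot> c\<rbrakk>
           \<Longrightarrow> (f', g', h') \<in> Tri T"
    and TR1_idn: "\<lbrakk>X \<in> Ob T; is_zero_ob T Z\<rbrakk>
           \<Longrightarrow> (Idn T X, Zero T X Z, Zero T Z (SigO T X)) \<in> Tri T"
    and TR1_cone: "f \<in> Ar T \<Longrightarrow> \<exists>g h. (f, g, h) \<in> Tri T"
    and TR2: "triangle_shape T f g h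
           \<Longrightarrow> (f, g, h) \<in> Tri T \<longleftrightarrow> (g, h, neg T (SigA T f)) \<in> Tri T"
    and TR3: "\<lbrakk>(f, g, h) \<in> Tri T; (f', g', h') \<in> Tri T;
           a \<in> Hom T (Dom T f) (Dom T f'); b \<in> Hom T (Dom T g) (Dom T g'); b \<cdot> f = f' \<cdot> a\<rbrakk>
           \<Longrightarrow> \<exists>c \<in> Hom T (Dom T h) (Dom T h'). c \<cdot> g = g' \<cdot> b \<and> SigA T a \<cdot> h = h' \<cdot> c"
    and TR4: "\<lbrakk>(f, f1, f2) \<in> Tri T; (g, g1, g2) \<in> Tri T; Cod T f = Dom T g;
           (g \<cdot> f, h1, h2) \<in> Tri T\<rbrakk>
           \<Longrightarrow> \<exists>u v. (u, v, SigA T f1 \<cdot> g2) \<in> Tri T \<and>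
                 u \<in> Hom T (Cod T f1) (Cod T h1) \<and> v \<in> Hom T (Cod T h1) (Cod T g1) \<and>
                 u \<cdot> f1 = h1 \<cdot> g \<and> h2 \<cdot> u = f2 \<and> v \<cdot> h1 = g1 \<and> g2 \<cdot> v = SigA T f \<cdot> h2"


section \<open>Well generated triangulated categories\<close>

definition regular_cardinal :: "'k rel \<Rightarrow> bool" where
  "regular_cardinal \<alpha> \<longleftrightarrow> Cinfinite \<alpha> \<and> regularCard \<alpha>"

definition uncountable_cardinal :: "'k rel \<Rightarrow> bool" where
  "uncountable_cardinal \<kappa> \<longleftrightarrow> natLeq <o \<kappa>"

text \<open>The objects of \<open>T\<close> form a class, while coproducts are indexed by (small) sets.  The regular
  cardinal \<open>\<kappa>\<close> delimits smallness: a set is small if it has cardinality less than \<open>\<kappa>\<close>, so that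
  \<open>\<kappa>\<close> is the cardinality of the universe.  Only regularity and uncountability of \<open>\<kappa>\<close> will be
  assumed; the classical situation is that of an inaccessible \<open>\<kappa>\<close>.  Every small set is in
  bijection with a set of elements of the type \<open>'k\<close> on which \<open>\<kappa>\<close> lives, hence small index sets
  may be taken from that type.\<close>

definition has_coproducts :: "'k rel \<Rightarrow> ('o, 'm, 'z) cat_scheme \<Rightarrow> bool" where
  "has_coproducts \<kappa> K \<longleftrightarrow> (\<forall>(I :: 'k set) X. |I| <o \<kappa> \<and> (\<forall>i \<in> I. X i \<in> Ob K) \<longrightarrow>
     (\<exists>Q \<iota>. is_coproduct K I X Q \<iota>))"

definition small_ob :: "'k rel \<Rightarrow> 'k rel \<Rightarrow> ('o, 'm, 'z) cat_scheme \<Rightarrow> 'o \<Rightarrow> bool" where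
  "small_ob \<kappa> \<alpha> K S \<longleftrightarrow> S \<in> Ob K \<and>
     (\<forall>(I :: 'k set) X Q \<iota>. |I| <o \<kappa> \<and> is_coproduct K I X Q \<iota> \<longrightarrow>
       (\<forall>s \<in> Hom K S Q. \<exists>I' Q' \<iota>' j t. I' \<subseteq> I \<and> |I'| <o \<alpha> \<and> is_coproduct K I' X Q' \<iota>' \<and>
          j \<in> Hom K Q' Q \<and> (\<forall>i \<in> I'. j \<cdot>\<^bsub>K\<^esub> \<iota>' i = \<iota> i) \<and>
          t \<in> Hom K S Q' \<and> s = j \<cdot>\<^bsub>K\<^esub> t))"

definition generates :: "('o, 'm, 'z) addcat_scheme \<Rightarrow> 'o set \<Rightarrow> bool" where
  "generates K \<S> \<longleftrightarrow> \<S> \<subseteq> Ob K \<and>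
     (\<forall>X \<in> Ob K. is_zero_ob K X \<longleftrightarrow> (\<forall>S \<in> \<S>. Hom K S X = {Zero K S X}))"

definition hom_surj :: "('o, 'm, 'z) cat_scheme \<Rightarrow> 'o \<Rightarrow> 'm \<Rightarrow> bool" where
  "hom_surj K S f \<longleftrightarrow> (\<lambda>s. f \<cdot>\<^bsub>K\<^esub> s) ` Hom K S (Dom K f) = Hom K S (Cod K f)"

definition perfect :: "'k rel \<Rightarrow> ('o, 'm, 'z) cat_scheme \<Rightarrow> 'o set \<Rightarrow> bool" where
  "perfect \<kappa> K \<S> \<longleftrightarrow>
     (\<forall>(I :: 'k set) f Q \<iota> R \<rho> F. |I| <o \<kappa> \<and> is_coproduct_ar K I f Q \<iota> R \<rho> F \<and>
        (\<forall>i \<in> I. \<forall>S \<in> \<S>. hom_surj K S (f i)) \<longrightarrow> (\<forall>S \<in> \<S>. hom_surj K S F))"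

definition compactly_generated :: "'k rel \<Rightarrow> 'k rel \<Rightarrow> ('o, 'm, 'z) addcat_scheme \<Rightarrow> bool" where
  "compactly_generated \<kappa> \<alpha> K \<longleftrightarrow>
     (\<exists>\<S>. |\<S>| <o \<kappa> \<and> generates K \<S> \<and> perfect \<kappa> K \<S> \<and> (\<forall>S \<in> \<S>. small_ob \<kappa> \<alpha> K S))"

definition well_generated :: "'k rel \<Rightarrow> ('o, 'm, 'z) addcat_scheme \<Rightarrow> bool" where
  "well_generated \<kappa> K \<longleftrightarrow>
     (\<exists>\<beta> :: 'k rel. regular_cardinal \<beta> \<and> \<beta> <o \<kappa> \<and> compactly_generated \<kappa> \<beta> K)"

text \<open>The class of \<open>\<alpha>\<close>-compact objects is the largest class with the following property; since the
  property is inherited by unions, it is the union of all classes having it.\<close>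

definition compact_class :: "'k rel \<Rightarrow> 'k rel \<Rightarrow> ('o, 'm, 'z) cat_scheme \<Rightarrow> 'o set \<Rightarrow> bool" where
  "compact_class \<kappa> \<alpha> K \<S> \<longleftrightarrow> (\<forall>S \<in> \<S>. small_ob \<kappa> \<alpha> K S \<and>
     (\<forall>(I :: 'k set) X R \<rho>. |I| <o \<kappa> \<and> is_coproduct K I X R \<rho> \<longrightarrow>
       (\<forall>s \<in> Hom K S R. \<exists>f Q \<iota> F t. (\<forall>i \<in> I. Dom K (f i) \<in> \<S> \<and> Cod K (f i) = X i) \<and>
          is_coproduct_ar K I f Q \<iota> R \<rho> F \<and> t \<in> Hom K S Q \<and> s = F \<cdot>\<^bsub>K\<^esub> t)))"

definition compact_obs :: "'k rel \<Rightarrow> 'k rel \<Rightarrow> ('o, 'm, 'z) cat_scheme \<Rightarrow> 'o set" where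
  "compact_obs \<kappa> \<alpha> K = \<Union> {\<S>. compact_class \<kappa> \<alpha> K \<S>}"

definition ess_small :: "'k rel \<Rightarrow> ('o, 'm, 'z) cat_scheme \<Rightarrow> 'o set \<Rightarrow> bool" where
  "ess_small \<kappa> K C \<longleftrightarrow> (\<exists>R \<subseteq> C. |R| <o \<kappa> \<and> (\<forall>X \<in> C. \<exists>Y \<in> R. isomorphic K X Y))"

text \<open>Full subcategories are not required to be replete, hence closure is up to isomorphism.\<close>

definition closed_under_suspension :: "('o, 'm, 'z) tricat_scheme \<Rightarrow> 'o set \<Rightarrow> bool" where
  "closed_under_suspension T C \<longleftrightarrow> (\<forall>X \<in> C. \<exists>Y \<in> C. isomorphic T Y (SigO T X))"

definition closed_under_desuspension :: "('o, 'm, 'z) tricat_scheme \<Rightarrow> 'o set \<Rightarrow> bool" where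
  "closed_under_desuspension T C \<longleftrightarrow> (\<forall>X \<in> C. \<exists>Y \<in> C. isomorphic T (SigO T Y) X)"

definition closed_under_coproducts :: "'k rel \<Rightarrow> ('o, 'm, 'z) cat_scheme \<Rightarrow> 'o set \<Rightarrow> bool" where
  "closed_under_coproducts \<alpha> K C \<longleftrightarrow>
     (\<forall>(I :: 'k set) X. |I| <o \<alpha> \<and> (\<forall>i \<in> I. X i \<in> C) \<longrightarrow> (\<exists>Q \<in> C. \<exists>\<iota>. is_coproduct K I X Q \<iota>))"

inductive_set Add :: "'k rel \<Rightarrow> ('o, 'm, 'z) cat_scheme \<Rightarrow> 'o set \<Rightarrow> 'o set"
  for \<kappa> :: "'k rel" and K :: "('o, 'm, 'z) cat_scheme" and C :: "'o set" where
  base: "X \<in> C \<Longrightarrow> X \<in> Add \<kappa> K C"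
| coproduct: "\<lbrakk>|I :: 'k set| <o \<kappa>; \<And>i. i \<in> I \<Longrightarrow> X i \<in> Add \<kappa> K C; is_coproduct K I X Q \<iota>\<rbrakk>
    \<Longrightarrow> Q \<in> Add \<kappa> K C"
| retract: "\<lbrakk>Q \<in> Add \<kappa> K C; s \<in> Hom K P Q; r \<in> Hom K Q P; r \<cdot>\<^bsub>K\<^esub> s = Idn K P\<rbrakk>
    \<Longrightarrow> P \<in> Add \<kappa> K C"


section \<open>The abelian category \<open>Mod\<^sub>\<alpha>(C)\<close> and the restricted Yoneda functor\<close>

text \<open>Abelian groups are taken with elements in the type \<open>'m\<close> of morphisms of \<open>T\<close>; this
  contains the values of the representable functors and is closed under the subgroups and (choosing
  representatives) the quotients needed for kernels and cokernels.  Preservation of products says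
  that the canonical homomorphism from \<open>F(\<Coprod> X\<^sub>i)\<close> to the product of the \<open>F(X\<^sub>i)\<close> is an isomorphism;
  additivity of \<open>F\<close> follows.\<close>

record ('o, 'm) presheaf =
  PO :: "'o \<Rightarrow> 'm monoid"
  PA :: "'m \<Rightarrow> 'm \<Rightarrow> 'm"

locale mod_object =
  fixes \<alpha> :: "'k rel" and K :: "('o, 'm, 'z) cat_scheme" (structure)
    and C :: "'o set" and F :: "('o, 'm) presheaf"
  assumes group: "c \<in> C \<Longrightarrow> comm_group (PO F c)"
    and ar: "\<lbrakk>c \<in> C; d \<in> C; u \<in> Hom K c d\<rbrakk> \<Longrightarrow> PA F u \<in> hom (PO F d) (PO F c)"
    and idn: "\<lbrakk>c \<in> C; x \<in> carrier (PO F c)\<rbrakk> \<Longrightarrow> PA F (Idn K c) x = x"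
    and comp: "\<lbrakk>b \<in> C; c \<in> C; d \<in> C; u \<in> Hom K b c; v \<in> Hom K c d; x \<in> carrier (PO F d)\<rbrakk>
           \<Longrightarrow> PA F (v \<cdot> u) x = PA F u (PA F v x)"
    and preserves_products: "\<lbrakk>|I :: 'k set| <o \<alpha>; is_coproduct (full_sub K C) I X Q \<iota>\<rbrakk>
           \<Longrightarrow> (\<lambda>x. \<lambda>i\<in>I. PA F (\<iota> i) x) \<in> iso (PO F Q) (product_group I (\<lambda>i. PO F (X i)))"

definition mod_hom :: "('o, 'm, 'z) cat_scheme \<Rightarrow> 'o set \<Rightarrow>
    ('o, 'm) presheaf \<Rightarrow> ('o, 'm) presheaf \<Rightarrow> ('o \<Rightarrow> 'm \<Rightarrow> 'm) set" where
  "mod_hom K C F G = {\<eta>. \<eta> \<in> extensional C \<and>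
     (\<forall>c \<in> C. \<eta> c \<in> extensional (carrier (PO F c)) \<and> \<eta> c \<in> hom (PO F c) (PO G c)) \<and>
     (\<forall>c \<in> C. \<forall>d \<in> C. \<forall>u \<in> Hom K c d. \<forall>x \<in> carrier (PO F d).
        \<eta> c (PA F u x) = PA G u (\<eta> d x))}"

type_synonym ('o, 'm) presheaf_ar = "('o, 'm) presheaf \<times> ('o, 'm) presheaf \<times> ('o \<Rightarrow> 'm \<Rightarrow> 'm)"

definition ModCat :: "'k rel \<Rightarrow> ('o, 'm, 'z) cat_scheme \<Rightarrow> 'o set \<Rightarrow>
    (('o, 'm) presheaf, ('o, 'm) presheaf_ar) addcat" where
  "ModCat \<alpha> K C = \<lparr>
     Ob = {F. mod_object \<alpha> K C F},
     Ar = {(F, G, \<eta>) |F G \<eta>. mod_object \<alpha> K C F \<and> mod_object \<alpha> K C G \<and> \<eta> \<in> mod_hom K C F G},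
     Dom = (\<lambda>(F, G, \<eta>). F),
     Cod = (\<lambda>(F, G, \<eta>). G),
     Idn = (\<lambda>F. (F, F, \<lambda>c\<in>C. \<lambda>x\<in>carrier (PO F c). x)),
     Comp = (\<lambda>(G', H, \<theta>) (F, G, \<eta>). (F, H, \<lambda>c\<in>C. \<lambda>x\<in>carrier (PO F c). \<theta> c (\<eta> c x))),
     Plus = (\<lambda>(F', G', \<theta>) (F, G, \<eta>).
       (F, G, \<lambda>c\<in>C. \<lambda>x\<in>carrier (PO F c). \<theta> c x \<otimes>\<^bsub>PO G c\<^esub> \<eta> c x)),
     Zero = (\<lambda>F G. (F, G, \<lambda>c\<in>C. \<lambda>x\<in>carrier (PO F c). \<one>\<^bsub>PO G c\<^esub>))\<rparr>"

definition yonO :: "('o, 'm, 'z) addcat_scheme \<Rightarrow> 'o \<Rightarrow> ('o, 'm) presheaf" where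
  "yonO K X = \<lparr>PO = (\<lambda>c. hom_group K c X), PA = (\<lambda>u x. x \<cdot>\<^bsub>K\<^esub> u)\<rparr>"

definition yonA :: "('o, 'm, 'z) addcat_scheme \<Rightarrow> 'o set \<Rightarrow> 'm \<Rightarrow> ('o, 'm) presheaf_ar" where
  "yonA K C f = (yonO K (Dom K f), yonO K (Cod K f), \<lambda>c\<in>C. \<lambda>x\<in>Hom K c (Dom K f). f \<cdot>\<^bsub>K\<^esub> x)"


section \<open>Postnikov systems and Postnikov resolutions\<close>

text \<open>Fields: the objects \<open>X\<^sub>n\<close> and \<open>P\<^sub>n\<close> and the morphisms \<open>f\<^sub>n\<close>, \<open>i\<^sub>n\<close>, \<open>q\<^sub>n\<close>, for \<open>n \<ge> 0\<close>.
  The object \<open>X\<^sub>n\<^sub>-\<^sub>1\<close> is \<open>prevO T A n\<close>; in particular \<open>X\<^sub>-\<^sub>1\<close> is the zero object.\<close>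

record ('o, 'm) postnikov =
  tX :: "nat \<Rightarrow> 'o"
  tP :: "nat \<Rightarrow> 'o"
  tf :: "nat \<Rightarrow> 'm"
  ti :: "nat \<Rightarrow> 'm"
  tq :: "nat \<Rightarrow> 'm"

record ('o, 'm) postnikov_res = "('o, 'm) postnikov" +
  rX :: 'o
  rp :: "nat \<Rightarrow> 'm"

definition prevO :: "('o, 'm, 'z) cat_scheme \<Rightarrow> ('o, 'm, 'y) postnikov_scheme \<Rightarrow> nat \<Rightarrow> 'o" where
  "prevO K A n = (case n of 0 \<Rightarrow> zero_ob K | Suc m \<Rightarrow> tX A m)"

definition prevA :: "('o, 'm, 'z) cat_scheme \<Rightarrow> (nat \<Rightarrow> 'm) \<Rightarrow> nat \<Rightarrow> 'm" where
  "prevA K \<psi> n = (case n of 0 \<Rightarrow> Idn K (zero_ob K) | Suc m \<Rightarrow> \<psi> m)"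

definition differential :: "('o, 'm, 'z) cat_scheme \<Rightarrow> ('o, 'm, 'y) postnikov_scheme \<Rightarrow> nat \<Rightarrow> 'm" where
  "differential K A n = tq A n \<cdot>\<^bsub>K\<^esub> tf A (Suc n)"

text \<open>\<open>differential T A n\<close> is the differential \<open>P\<^sub>n\<^sub>+\<^sub>1 \<rightarrow> \<Sigma> P\<^sub>n\<close> of degree \<open>+1\<close>.  Exactness at \<open>P\<^sub>n\<^sub>+\<^sub>1\<close> of
  the sequence with these differentials concerns \<open>P\<^sub>n\<^sub>+\<^sub>2 \<rightarrow> \<Sigma> P\<^sub>n\<^sub>+\<^sub>1 \<rightarrow> \<Sigma>\<^sup>2 P\<^sub>n\<close>.\<close>

definition postnikov_tower ::
  "'k rel \<Rightarrow> ('o, 'm, 'z) tricat_scheme \<Rightarrow> 'o set \<Rightarrow> ('o, 'm, 'y) postnikov_scheme \<Rightarrow> bool"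
where
  "postnikov_tower \<kappa> T C A \<longleftrightarrow>
     (\<forall>n. tf A n \<in> Hom T (tP A n) (prevO T A n) \<and> ti A n \<in> Hom T (prevO T A n) (tX A n) \<and>
          tq A n \<in> Hom T (tX A n) (SigO T (tP A n)) \<and> (tf A n, ti A n, tq A n) \<in> Tri T \<and>
          tP A n \<in> Add \<kappa> T C)"

definition postnikov_system ::
  "'k rel \<Rightarrow> 'k rel \<Rightarrow> ('o, 'm, 'z) tricat_scheme \<Rightarrow> 'o set \<Rightarrow> ('o, 'm, 'y) postnikov_scheme \<Rightarrow> bool"
where
  "postnikov_system \<kappa> \<alpha> T C A \<longleftrightarrow> postnikov_tower \<kappa> T C A \<and>
     (\<forall>n. projective (ModCat \<alpha> T C) (yonO T (tP A n))) \<and>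
     (\<forall>n. exact_at (ModCat \<alpha> T C)
            (yonA T C (differential T A (Suc n))) (yonA T C (SigA T (differential T A n))))"

text \<open>The degree \<open>0\<close> augmentation, up to suspension: \<open>\<Sigma> P\<^sub>0 \<rightarrow> \<Sigma> X\<close>.\<close>

definition augmentation ::
  "('o, 'm, 'z) cat_scheme \<Rightarrow> ('o, 'm, 'y) postnikov_res_scheme \<Rightarrow> 'm" where
  "augmentation K A = rp A 0 \<cdot>\<^bsub>K\<^esub> inv_ar K (tq A 0)"

definition postnikov_resolution ::
  "'k rel \<Rightarrow> 'k rel \<Rightarrow> ('o, 'm, 'z) tricat_scheme \<Rightarrow> 'o set \<Rightarrow> ('o, 'm, 'y) postnikov_res_scheme \<Rightarrow> bool"
where
  "postnikov_resolution \<kappa> \<alpha> T C A \<longleftrightarrow> postnikov_tower \<kappa> T C A \<and> rX A \<in> Ob T \<and>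
     (\<forall>n. rp A n \<in> Hom T (tX A n) (SigO T (rX A))) \<and>
     (\<forall>n. rp A n = rp A (Suc n) \<cdot>\<^bsub>T\<^esub> ti A (Suc n)) \<and>
     (\<forall>n. projective (ModCat \<alpha> T C) (yonO T (tP A n))) \<and>
     is_epi (ModCat \<alpha> T C) (yonA T C (augmentation T A)) \<and>
     exact_at (ModCat \<alpha> T C) (yonA T C (differential T A 0)) (yonA T C (augmentation T A)) \<and>
     (\<forall>n. exact_at (ModCat \<alpha> T C)
            (yonA T C (differential T A (Suc n))) (yonA T C (SigA T (differential T A n))))"

definition post_hom :: "('o, 'm, 'z) tricat_scheme \<Rightarrow>
    ('o, 'm, 'x) postnikov_scheme \<Rightarrow> ('o, 'm, 'y) postnikov_scheme \<Rightarrow>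
    ((nat \<Rightarrow> 'm) \<times> (nat \<Rightarrow> 'm)) set" where
  "post_hom T A B = {(\<psi>, \<phi>).
     (\<forall>n. \<psi> n \<in> Hom T (tX A n) (tX B n)) \<and> (\<forall>n. \<phi> n \<in> Hom T (tP A n) (tP B n)) \<and>
     (\<forall>n. tf B n \<cdot>\<^bsub>T\<^esub> \<phi> n = prevA T \<psi> n \<cdot>\<^bsub>T\<^esub> tf A n) \<and>
     (\<forall>n. ti B n \<cdot>\<^bsub>T\<^esub> prevA T \<psi> n = \<psi> n \<cdot>\<^bsub>T\<^esub> ti A n) \<and>
     (\<forall>n. tq B n \<cdot>\<^bsub>T\<^esub> \<psi> n = SigA T (\<phi> n) \<cdot>\<^bsub>T\<^esub> tq A n)}"

definition res_hom :: "('o, 'm, 'z) tricat_scheme \<Rightarrow>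
    ('o, 'm) postnikov_res \<Rightarrow> ('o, 'm) postnikov_res \<Rightarrow>
    ('m \<times> (nat \<Rightarrow> 'm) \<times> (nat \<Rightarrow> 'm)) set" where
  "res_hom T A B = {(h, \<psi>, \<phi>). h \<in> Hom T (rX A) (rX B) \<and> (\<psi>, \<phi>) \<in> post_hom T A B \<and>
     (\<forall>n. rp B n \<cdot>\<^bsub>T\<^esub> \<psi> n = SigA T h \<cdot>\<^bsub>T\<^esub> rp A n)}"

type_synonym ('o, 'm) post_ar =
  "('o, 'm) postnikov \<times> ('o, 'm) postnikov \<times> (nat \<Rightarrow> 'm) \<times> (nat \<Rightarrow> 'm)"

type_synonym ('o, 'm) pres_ar =
  "('o, 'm) postnikov_res \<times> ('o, 'm) postnikov_res \<times> 'm \<times> (nat \<Rightarrow> 'm) \<times> (nat \<Rightarrow> 'm)"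

definition Post :: "'k rel \<Rightarrow> 'k rel \<Rightarrow> ('o, 'm, 'z) tricat_scheme \<Rightarrow> 'o set \<Rightarrow>
    (('o, 'm) postnikov, ('o, 'm) post_ar) cat" where
  "Post \<kappa> \<alpha> T C = \<lparr>
     Ob = {A. postnikov_system \<kappa> \<alpha> T C A},
     Ar = {(A, B, m) |A B m. postnikov_system \<kappa> \<alpha> T C A \<and> postnikov_system \<kappa> \<alpha> T C B \<and>
             m \<in> post_hom T A B},
     Dom = (\<lambda>(A, B, m). A),
     Cod = (\<lambda>(A, B, m). B),
     Idn = (\<lambda>A. (A, A, \<lambda>n. Idn T (tX A n), \<lambda>n. Idn T (tP A n))),
     Comp = (\<lambda>(B', D, \<psi>', \<phi>') (A, B, \<psi>, \<phi>). (A, D, \<lambda>n. \<psi>' n \<cdot>\<^bsub>T\<^esub> \<psi> n, \<lambda>n. \<phi>' n \<cdot>\<^bsub>T\<^esub> \<phi> n))\<rparr>"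

definition Pres :: "'k rel \<Rightarrow> 'k rel \<Rightarrow> ('o, 'm, 'z) tricat_scheme \<Rightarrow> 'o set \<Rightarrow>
    (('o, 'm) postnikov_res, ('o, 'm) pres_ar) cat" where
  "Pres \<kappa> \<alpha> T C = \<lparr>
     Ob = {A. postnikov_resolution \<kappa> \<alpha> T C A},
     Ar = {(A, B, m) |A B m. postnikov_resolution \<kappa> \<alpha> T C A \<and> postnikov_resolution \<kappa> \<alpha> T C B \<and>
             m \<in> res_hom T A B},
     Dom = (\<lambda>(A, B, m). A),
     Cod = (\<lambda>(A, B, m). B),
     Idn = (\<lambda>A. (A, A, Idn T (rX A), \<lambda>n. Idn T (tX A n), \<lambda>n. Idn T (tP A n))),
     Comp = (\<lambda>(B', D, h', \<psi>', \<phi>') (A, B, h, \<psi>, \<phi>).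
       (A, D, h' \<cdot>\<^bsub>T\<^esub> h, \<lambda>n. \<psi>' n \<cdot>\<^bsub>T\<^esub> \<psi> n, \<lambda>n. \<phi>' n \<cdot>\<^bsub>T\<^esub> \<phi> n))\<rparr>"

definition post_homotopy :: "'k rel \<Rightarrow> 'k rel \<Rightarrow> ('o, 'm, 'z) tricat_scheme \<Rightarrow> 'o set \<Rightarrow>
    (('o, 'm) post_ar \<times> ('o, 'm) post_ar) set" where
  "post_homotopy \<kappa> \<alpha> T C = {((A, B, \<psi>, \<phi>), (A', B', \<psi>', \<phi>')) |A B \<psi> \<phi> A' B' \<psi>' \<phi>'.
     (A, B, \<psi>, \<phi>) \<in> Ar (Post \<kappa> \<alpha> T C) \<and> (A', B', \<psi>', \<phi>') \<in> Ar (Post \<kappa> \<alpha> T C) \<and>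
     A = A' \<and> B = B' \<and> (\<forall>n > 0. \<psi> n \<cdot>\<^bsub>T\<^esub> ti A n = \<psi>' n \<cdot>\<^bsub>T\<^esub> ti A n)}"

definition pres_homotopy :: "'k rel \<Rightarrow> 'k rel \<Rightarrow> ('o, 'm, 'z) tricat_scheme \<Rightarrow> 'o set \<Rightarrow>
    (('o, 'm) pres_ar \<times> ('o, 'm) pres_ar) set" where
  "pres_homotopy \<kappa> \<alpha> T C = {((A, B, h, \<psi>, \<phi>), (A', B', h', \<psi>', \<phi>')) |A B h \<psi> \<phi> A' B' h' \<psi>' \<phi>'.
     (A, B, h, \<psi>, \<phi>) \<in> Ar (Pres \<kappa> \<alpha> T C) \<and> (A', B', h', \<psi>', \<phi>') \<in> Ar (Pres \<kappa> \<alpha> T C) \<and>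
     A = A' \<and> B = B' \<and> (\<forall>n > 0. \<psi> n \<cdot>\<^bsub>T\<^esub> ti A n = \<psi>' n \<cdot>\<^bsub>T\<^esub> ti A n)}"

definition hPost :: "'k rel \<Rightarrow> 'k rel \<Rightarrow> ('o, 'm, 'z) tricat_scheme \<Rightarrow> 'o set \<Rightarrow>
    (('o, 'm) postnikov, ('o, 'm) post_ar set) cat" where
  "hPost \<kappa> \<alpha> T C = quotient_cat (Post \<kappa> \<alpha> T C) (post_homotopy \<kappa> \<alpha> T C)"

definition hPres :: "'k rel \<Rightarrow> 'k rel \<Rightarrow> ('o, 'm, 'z) tricat_scheme \<Rightarrow> 'o set \<Rightarrow>
    (('o, 'm) postnikov_res, ('o, 'm) pres_ar set) cat" where
  "hPres \<kappa> \<alpha> T C = quotient_cat (Pres \<kappa> \<alpha> T C) (pres_homotopy \<kappa> \<alpha> T C)"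

text \<open>The forgetful functor: on objects it discards the fields \<open>rX\<close> and \<open>rp\<close>, and it sends the
  homotopy class of \<open>(h, \<psi>, \<phi>)\<close> to the homotopy class of \<open>(\<psi>, \<phi>)\<close>.\<close>

definition forgetO :: "('o, 'm) postnikov_res \<Rightarrow> ('o, 'm) postnikov" where
  "forgetO A = \<lparr>tX = tX A, tP = tP A, tf = tf A, ti = ti A, tq = tq A\<rparr>"

definition forgetA :: "'k rel \<Rightarrow> 'k rel \<Rightarrow> ('o, 'm, 'z) tricat_scheme \<Rightarrow> 'o set \<Rightarrow>
    ('o, 'm) pres_ar set \<Rightarrow> ('o, 'm) post_ar set" where
  "forgetA \<kappa> \<alpha> T C c =
     post_homotopy \<kappa> \<alpha> T C `` ((\<lambda>(A, B, h, \<psi>, \<phi>). (forgetO A, forgetO B, \<psi>, \<phi>)) ` c)"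

end

theory Submission
  imports Defs
begin

text \<open>
  A Postnikov system already knows the object that it resolves.  Write \<open>H = T(S, -)\<close> for \<open>S \<in> C\<close>.
  Exactness of the sequence of the \<open>P\<^sub>n\<close> means that the image of \<open>H(X\<^sub>n\<^sub>-\<^sub>1)\<close> in \<open>H(X\<^sub>n)\<close> is, for every
  \<open>n \<ge> 1\<close>, a copy of \<open>H(X\<^sub>0)\<close> modulo the image of \<open>H(P\<^sub>1)\<close>, and that the tower induces isomorphisms
  between these images.  If \<open>L\<close> is the homotopy colimit of the tower, then \<open>H(X\<^sub>0) \<rightarrow> H(L)\<close> is onto and
  its kernel is the image of \<open>H(P\<^sub>1)\<close>.  The suspension is essentially surjective, so \<open>L\<close> is isomorphic
  to some \<open>\<Sigma>X\<close>, and \<open>X\<close> completes the system to a resolution (\<open>resolution_exists\<close>).  Conversely, in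
  any resolution the comparison \<open>L \<rightarrow> \<Sigma>X\<close> is bijective under \<open>H\<close>, so its cone vanishes because \<open>C\<close>
  generates.  Hence \<open>\<Sigma>X\<close> is a weak colimit of the tower (\<open>extend_cocone\<close>), and every morphism of
  towers extends to the resolved objects (\<open>forget_full\<close>).  The forgetful functor is faithful because
  homotopy of morphisms of resolutions is a condition on their components \<open>\<psi>\<close> only.  A full and
  faithful functor that is surjective on objects is an equivalence (\<open>equivalence_of_surjective\<close>).

  The difficulty lies in \<open>H(L)\<close>.  As \<open>S\<close> need not be compact in the classical sense, \<open>H(\<Coprod>X\<^sub>n)\<close> need not be
  the direct sum of the \<open>H(X\<^sub>n)\<close>, and its elements may have no components to compute with.  Perfectness yields
  two substitutes: a coproduct of morphisms that are surjective under \<open>H\<close> is surjective under \<open>H\<close>,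
  and identifications made by the components pass to coproducts (\<open>coproduct_identification\<close>).
  With these, the equation \<open>s = \<xi>\<^sub>0 x + sh s\<close> in \<open>H(\<Coprod>X\<^sub>n)\<close>, where \<open>sh\<close> is the shift along the tower, is
  transported to constant towers, where \<open>1 - sh\<close> is a split monomorphism (\<open>shift_equation\<close>).

  The hypotheses and conclusions speak of \<open>Mod\<^sub>\<alpha>(C)\<close>.  There, epimorphisms and exactness turn out to be
  pointwise notions (\<open>yonA_epi_iff\<close>, \<open>yonA_exactD\<close>, \<open>yonA_exactI\<close>): kernels and cokernels computed
  pointwise preserve products, since products of abelian groups are exact.
\<close>

section \<open>Composition and coproducts\<close>

lemma Hom_iff: "f \<in> Hom K X Y \<longleftrightarrow> f \<in> Ar K \<and> Dom K f = X \<and> Cod K f = Y"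
  by (simp add: Hom_def)

lemma coproduct_ob: "is_coproduct K I X Q \<iota> \<Longrightarrow> Q \<in> Ob K"
  by (simp add: is_coproduct_def)

lemma coproduct_inj: "\<lbrakk>is_coproduct K I X Q \<iota>; i \<in> I\<rbrakk> \<Longrightarrow> \<iota> i \<in> Hom K (X i) Q"
  by (simp add: is_coproduct_def)

lemma coproduct_univ:
  assumes "is_coproduct K I X Q \<iota>" "Y \<in> Ob K" "\<And>i. i \<in> I \<Longrightarrow> g i \<in> Hom K (X i) Y"
  shows "\<exists>!h. h \<in> Hom K Q Y \<and> (\<forall>i\<in>I. h \<cdot>\<^bsub>K\<^esub> \<iota> i = g i)"
proof -
  have "\<forall>Y\<in>Ob K. \<forall>g. (\<forall>i\<in>I. g i \<in> Hom K (X i) Y) \<longrightarrow>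
      (\<exists>!h. h \<in> Hom K Q Y \<and> (\<forall>i\<in>I. h \<cdot>\<^bsub>K\<^esub> \<iota> i = g i))"
    using assms(1) unfolding is_coproduct_def by (elim conjE)
  from this[rule_format, OF assms(2), of g] assms(3) show ?thesis by blast
qed

context category
begin

lemma comp_typed [simp]:
  assumes "f \<in> Ar K" "g \<in> Ar K" "Cod K f = Dom K g"
  shows "g \<cdot> f \<in> Ar K" "Dom K (g \<cdot> f) = Dom K f" "Cod K (g \<cdot> f) = Cod K g"
  using comp_hom[of f "Dom K f" "Cod K f" g "Cod K g"] assms by (simp_all add: Hom_iff)

lemma comp_assoc_typed [simp]:
  "\<lbrakk>f \<in> Ar K; g \<in> Ar K; h \<in> Ar K; Cod K f = Dom K g; Cod K g = Dom K h\<rbrakk>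
    \<Longrightarrow> (h \<cdot> g) \<cdot> f = h \<cdot> (g \<cdot> f)"
  using comp_assoc[of f "Dom K f" "Cod K f" g "Cod K g" h "Cod K h"] by (simp add: Hom_iff)

lemma idn_typed [simp]:
  assumes "X \<in> Ob K"
  shows "Idn K X \<in> Ar K" "Dom K (Idn K X) = X" "Cod K (Idn K X) = X"
  using idn_hom[OF assms] by (simp_all add: Hom_iff)

lemma idn_cancel [simp]:
  "\<lbrakk>f \<in> Ar K; Cod K f = Y\<rbrakk> \<Longrightarrow> Idn K Y \<cdot> f = f"
  "\<lbrakk>f \<in> Ar K; Dom K f = X\<rbrakk> \<Longrightarrow> f \<cdot> Idn K X = f"
  using idn_left[of f "Dom K f" "Cod K f"] idn_right[of f "Dom K f" "Cod K f"]
  by (simp_all add: Hom_iff)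

declare dom_ob [simp] cod_ob [simp]

text \<open>Hom-sets are replaced by equations between domains and codomains, which the simplifier can solve
  by itself.  Composites are kept nested to the right; for an equation \<open>a \<cdot> b = c\<close> to apply inside
  such a composite, it has to be used in the following form.\<close>

lemma comp_reduce:
  "\<lbrakk>a \<cdot> b = c; a \<in> Ar K; b \<in> Ar K; Cod K b = Dom K a; x \<in> Ar K; Cod K x = Dom K b\<rbrakk>
    \<Longrightarrow> a \<cdot> (b \<cdot> x) = c \<cdot> x"
  using comp_assoc_typed[of x b a] by simp

lemma hom_ob: "f \<in> Hom K X Y \<Longrightarrow> X \<in> Ob K" "f \<in> Hom K X Y \<Longrightarrow> Y \<in> Ob K"
  by (auto simp: Hom_iff)

lemma hom_typed:
  assumes "f \<in> Hom K X Y"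
  shows "f \<in> Ar K" "Dom K f = X" "Cod K f = Y" "X \<in> Ob K" "Y \<in> Ob K"
  using assms by (auto simp: Hom_iff)

lemma inverse_ars_unique:
  assumes "inverse_ars K f g" "inverse_ars K f g'"
  shows "g = g'"
proof -
  have "g = g \<cdot> (f \<cdot> g')" using assms by (auto simp: inverse_ars_def Hom_iff)
  also have "\<dots> = (g \<cdot> f) \<cdot> g'"
    using assms by (intro comp_assoc_typed[symmetric]) (auto simp: inverse_ars_def Hom_iff)
  also have "\<dots> = g'" using assms by (auto simp: inverse_ars_def Hom_iff)
  finally show ?thesis .
qed

lemma inv_ar:
  assumes "is_iso K f"
  shows "inverse_ars K f (inv_ar K f)"
  using assms inverse_ars_unique unfolding is_iso_def inv_ar_def by (metis theI)

lemma coproduct_ext: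
  assumes Q: "is_coproduct K I X Q \<iota>" and h: "h \<in> Hom K Q Y" "h' \<in> Hom K Q Y"
    and eq: "\<And>i. i \<in> I \<Longrightarrow> h \<cdot> \<iota> i = h' \<cdot> \<iota> i"
  shows "h = h'"
proof -
  have "\<exists>!k. k \<in> Hom K Q Y \<and> (\<forall>i\<in>I. k \<cdot> \<iota> i = h' \<cdot> \<iota> i)"
    using coproduct_univ[OF Q hom_ob(2)[OF h(2)]] comp_hom[OF coproduct_inj[OF Q] h(2)] .
  then show ?thesis
  proof (rule ex1E)
    fix k assume "\<forall>y. y \<in> Hom K Q Y \<and> (\<forall>i\<in>I. y \<cdot> \<iota> i = h' \<cdot> \<iota> i) \<longrightarrow> y = k"
    from this[rule_format, of h] this[rule_format, of h'] show ?thesis using h eq by simp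
  qed
qed

lemma coproduct_desc:
  assumes "is_coproduct K I X Q \<iota>" "Y \<in> Ob K" "\<And>i. i \<in> I \<Longrightarrow> g i \<in> Hom K (X i) Y"
  obtains h where "h \<in> Hom K Q Y" "\<And>i. i \<in> I \<Longrightarrow> h \<cdot> \<iota> i = g i"
  using coproduct_univ[OF assms] by blast

lemma coproduct_ar_exists:
  assumes Q: "is_coproduct K I X Q \<iota>" and R: "is_coproduct K I Y R \<rho>"
    and f: "\<And>i. i \<in> I \<Longrightarrow> f i \<in> Hom K (X i) (Y i)"
  obtains F where "F \<in> Hom K Q R" "\<And>i. i \<in> I \<Longrightarrow> F \<cdot> \<iota> i = \<rho> i \<cdot> f i"
  using coproduct_desc[OF Q coproduct_ob[OF R], of "\<lambda>i. \<rho> i \<cdot> f i"]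
    comp_hom[OF f coproduct_inj[OF R]] that by blast

end

lemma is_coproduct_reindex:
  assumes e: "bij_betw e J I" and Q: "is_coproduct K I X Q \<iota>"
  shows "is_coproduct K J (\<lambda>j. X (e j)) Q (\<lambda>j. \<iota> (e j))"
  unfolding is_coproduct_def
proof (intro conjI ballI allI impI)
  let ?e = "inv_into J e"
  have inv: "?e i \<in> J" "e (?e i) = i" if "i \<in> I" for i
    using e that by (auto simp: bij_betw_def inv_into_into f_inv_into_f)
  have e_in: "e j \<in> I" "?e (e j) = j" if "j \<in> J" for j
    using e that by (auto simp: bij_betw_def)
  show "Q \<in> Ob K" using Q by (rule coproduct_ob)
  show "\<iota> (e j) \<in> Hom K (X (e j)) Q" if "j \<in> J" for j
    using coproduct_inj[OF Q e_in(1)[OF that]] .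
  fix Y g assume Y: "Y \<in> Ob K" and g: "\<forall>j\<in>J. g j \<in> Hom K (X (e j)) Y"
  have "\<forall>i\<in>I. g (?e i) \<in> Hom K (X i) Y" using g inv by metis
  then have ex1: "\<exists>!h. h \<in> Hom K Q Y \<and> (\<forall>i\<in>I. h \<cdot>\<^bsub>K\<^esub> \<iota> i = g (?e i))"
    using coproduct_univ[OF Q Y, of "\<lambda>i. g (?e i)"] by blast
  have "(\<forall>i\<in>I. h \<cdot>\<^bsub>K\<^esub> \<iota> i = g (?e i)) \<longleftrightarrow> (\<forall>j\<in>J. h \<cdot>\<^bsub>K\<^esub> \<iota> (e j) = g j)" for h
    using inv e_in by metis
  then show "\<exists>!h. h \<in> Hom K Q Y \<and> (\<forall>j\<in>J. h \<cdot>\<^bsub>K\<^esub> \<iota> (e j) = g j)"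
    using ex1 by simp
qed

section \<open>Equivalences\<close>

text \<open>Choose a preimage of every object and lift arrows uniquely.  The chosen preimages make the composite
  on the target the identity, and the unit is the lift of an identity arrow.\<close>

lemma equivalence_of_surjective:
  assumes F: "cat_functor K L FO FA"
    and surj: "FO ` Ob K = Ob L"
    and bij: "\<And>X Y. \<lbrakk>X \<in> Ob K; Y \<in> Ob K\<rbrakk> \<Longrightarrow> bij_betw FA (Hom K X Y) (Hom L (FO X) (FO Y))"
  shows "is_equivalence K L FO FA"
proof -
  interpret F: cat_functor K L FO FA by (fact F)
  define GO where "GO = inv_into (Ob K) FO"
  have GO: "GO Y \<in> Ob K" "FO (GO Y) = Y" if "Y \<in> Ob L" for Y
    using that surj by (auto simp: GO_def inv_into_into f_inv_into_f)
  define lift where "lift X Y = inv_into (Hom K X Y) FA" for X Y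
  have lift: "lift X Y g \<in> Hom K X Y" "FA (lift X Y g) = g"
    if "X \<in> Ob K" "Y \<in> Ob K" "g \<in> Hom L (FO X) (FO Y)" for X Y g
    using bij_betw_imp_surj_on[OF bij[OF that(1,2)]] that(3)
    by (auto simp: lift_def inv_into_into f_inv_into_f)
  have faith: "f = f'"
    if "f \<in> Hom K X Y" "f' \<in> Hom K X Y" "FA f = FA f'" for X Y f f'
    using bij[OF F.source.hom_ob[OF that(1)]] that by (auto simp: bij_betw_def inj_on_def)
  define GA where "GA g = lift (GO (Dom L g)) (GO (Cod L g)) g" for g
  have GA: "GA g \<in> Hom K (GO Y) (GO Y')" "FA (GA g) = g" if "g \<in> Hom L Y Y'" for g Y Y'
    using lift[of "GO Y" "GO Y'" g] GO F.target.hom_ob[OF that] that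
    by (auto simp: GA_def Hom_iff)
  have G: "cat_functor L K GO GA"
  proof
    show "\<And>Y. Y \<in> Ob L \<Longrightarrow> GO Y \<in> Ob K" by (rule GO)
    show "\<And>f X Y. f \<in> Hom L X Y \<Longrightarrow> GA f \<in> Hom K (GO X) (GO Y)" by (rule GA)
    show "GA (Idn L Y) = Idn K (GO Y)" if "Y \<in> Ob L" for Y
      using faith[of "GA (Idn L Y)" "GO Y" "GO Y" "Idn K (GO Y)"] GA[OF F.target.idn_hom[OF that]]
        GO[OF that] F.source.idn_hom F.idn by simp
    show "GA (g \<cdot>\<^bsub>L\<^esub> f) = GA g \<cdot>\<^bsub>K\<^esub> GA f" if "f \<in> Hom L X Y" "g \<in> Hom L Y Z" for f g X Y Z
      using faith[OF GA(1)[OF F.target.comp_hom[OF that]]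
          F.source.comp_hom[OF GA(1)[OF that(1)] GA(1)[OF that(2)]]]
        GA(2)[OF F.target.comp_hom[OF that]] F.comp[OF GA(1)[OF that(1)] GA(1)[OF that(2)]]
        GA(2)[OF that(1)] GA(2)[OF that(2)] by simp
  qed
  define \<eta> where "\<eta> X = lift X (GO (FO X)) (Idn L (FO X))" for X
  define \<theta> where "\<theta> X = lift (GO (FO X)) X (Idn L (FO X))" for X
  have \<eta>: "\<eta> X \<in> Hom K X (GO (FO X))" "FA (\<eta> X) = Idn L (FO X)" if "X \<in> Ob K" for X
    using lift[of X "GO (FO X)" "Idn L (FO X)"] that F.ob[OF that] GO F.target.idn_hom
    by (auto simp: \<eta>_def)
  have \<theta>: "\<theta> X \<in> Hom K (GO (FO X)) X" "FA (\<theta> X) = Idn L (FO X)" if "X \<in> Ob K" for X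
    using lift[of "GO (FO X)" X "Idn L (FO X)"] that F.ob[OF that] GO F.target.idn_hom
    by (auto simp: \<theta>_def)
  have "is_iso K (\<eta> X)" if X: "X \<in> Ob K" for X
  proof -
    note 1 = \<eta>(1)[OF X] and 2 = \<theta>(1)[OF X]
    have "FA (\<theta> X \<cdot>\<^bsub>K\<^esub> \<eta> X) = FA (Idn K X)"
      using F.comp[OF 1 2] \<eta>(2)[OF X] \<theta>(2)[OF X] F.idn[OF X] F.ob[OF X] by simp
    then have a: "\<theta> X \<cdot>\<^bsub>K\<^esub> \<eta> X = Idn K X"
      using faith F.source.comp_hom[OF 1 2] F.source.idn_hom[OF X] by blast
    have "FA (\<eta> X \<cdot>\<^bsub>K\<^esub> \<theta> X) = FA (Idn K (GO (FO X)))"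
      using F.comp[OF 2 1] \<eta>(2)[OF X] \<theta>(2)[OF X] F.idn[of "GO (FO X)"] F.ob[OF X] GO by simp
    then have "\<eta> X \<cdot>\<^bsub>K\<^esub> \<theta> X = Idn K (GO (FO X))"
      using faith F.source.comp_hom[OF 2 1] F.source.idn_hom GO F.ob[OF X] by metis
    then show ?thesis using a 1 2 by (auto simp: is_iso_def inverse_ars_def Hom_iff)
  qed
  moreover have "\<eta> (Cod K f) \<cdot>\<^bsub>K\<^esub> f = GA (FA f) \<cdot>\<^bsub>K\<^esub> \<eta> (Dom K f)" if f: "f \<in> Ar K" for f
  proof -
    have ff: "f \<in> Hom K (Dom K f) (Cod K f)" using f by (simp add: Hom_iff)
    note Ff = F.ar[OF ff]
    note d = F.source.dom_ob[OF f] and c = F.source.cod_ob[OF f]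
    show ?thesis
    proof (rule faith)
      show "\<eta> (Cod K f) \<cdot>\<^bsub>K\<^esub> f \<in> Hom K (Dom K f) (GO (FO (Cod K f)))"
        using F.source.comp_hom[OF ff \<eta>(1)[OF c]] .
      show "GA (FA f) \<cdot>\<^bsub>K\<^esub> \<eta> (Dom K f) \<in> Hom K (Dom K f) (GO (FO (Cod K f)))"
        using F.source.comp_hom[OF \<eta>(1)[OF d] GA(1)[OF Ff]] .
      show "FA (\<eta> (Cod K f) \<cdot>\<^bsub>K\<^esub> f) = FA (GA (FA f) \<cdot>\<^bsub>K\<^esub> \<eta> (Dom K f))"
        using F.comp[OF ff \<eta>(1)[OF c]] F.comp[OF \<eta>(1)[OF d] GA(1)[OF Ff]] GA(2)[OF Ff]
          \<eta>(2)[OF c] \<eta>(2)[OF d] F.target.idn_left[OF Ff] F.target.idn_right[OF Ff] by simp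
    qed
  qed
  ultimately have nat1: "natural_iso K K id id (GO \<circ> FO) (GA \<circ> FA) \<eta>"
    using \<eta>(1) by (auto simp: natural_iso_def)
  have nat2: "natural_iso L L (FO \<circ> GO) (FA \<circ> GA) id id (Idn L)"
    unfolding natural_iso_def
  proof (intro conjI ballI)
    fix Y assume Y: "Y \<in> Ob L"
    show "Idn L Y \<in> Hom L ((FO \<circ> GO) Y) (id Y)" using Y GO F.target.idn_hom by simp
    show "is_iso L (Idn L Y)"
      using Y unfolding is_iso_def inverse_ars_def by (intro exI[of _ "Idn L Y"]) (simp add: Hom_iff)
  next
    fix f assume "f \<in> Ar L"
    then have f: "f \<in> Hom L (Dom L f) (Cod L f)" by (simp add: Hom_iff)
    show "Idn L (Cod L f) \<cdot>\<^bsub>L\<^esub> (FA \<circ> GA) f = id f \<cdot>\<^bsub>L\<^esub> Idn L (Dom L f)"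
      using GA(2)[OF f] F.target.idn_left[OF f] F.target.idn_right[OF f] by simp
  qed
  show ?thesis
    unfolding is_equivalence_def by (intro conjI exI) (rule F, rule G, rule nat1, rule nat2)
qed

section \<open>Quotient categories\<close>

locale congruence = category K for K :: "('o, 'm, 'z) cat_scheme" (structure) +
  fixes R :: "('m \<times> 'm) set"
  assumes equiv: "equiv (Ar K) R"
    and parallel: "(f, f') \<in> R \<Longrightarrow> Dom K f = Dom K f' \<and> Cod K f = Cod K f'"
    and comp_cong: "\<lbrakk>(f, f') \<in> R; (g, g') \<in> R; Cod K f = Dom K g\<rbrakk> \<Longrightarrow> (g \<cdot> f, g' \<cdot> f') \<in> R"
begin

lemma refl_ar: "f \<in> Ar K \<Longrightarrow> (f, f) \<in> R"
  using equiv unfolding equiv_def by (blast dest: refl_onD)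

lemma class_eq_iff: "\<lbrakk>f \<in> Ar K; g \<in> Ar K\<rbrakk> \<Longrightarrow> R `` {f} = R `` {g} \<longleftrightarrow> (f, g) \<in> R"
  by (rule eq_equiv_class_iff[OF equiv])

lemma quotient_dom_cod [simp]:
  assumes "f \<in> Ar K"
  shows "Dom (quotient_cat K R) (R `` {f}) = Dom K f"
    "Cod (quotient_cat K R) (R `` {f}) = Cod K f"
proof -
  have par: "Dom K x = Dom K f" "Cod K x = Cod K f" if "x \<in> R `` {f}" for x
    using parallel[of f x] that by simp_all
  have "f \<in> R `` {f}" using refl_ar[OF assms] by simp
  then have "Dom K ` R `` {f} = {Dom K f}" "Cod K ` R `` {f} = {Cod K f}"
    using par by blast+
  then show "Dom (quotient_cat K R) (R `` {f}) = Dom K f"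
    "Cod (quotient_cat K R) (R `` {f}) = Cod K f"
    by (simp_all add: quotient_cat_def)
qed

lemma quotient_ar: "c \<in> Ar (quotient_cat K R) \<longleftrightarrow> (\<exists>f \<in> Ar K. c = R `` {f})"
  by (auto simp: quotient_cat_def quotient_def)

lemma quotient_hom:
  "c \<in> Hom (quotient_cat K R) X Y \<longleftrightarrow> (\<exists>f \<in> Hom K X Y. c = R `` {f})"
  by (auto simp: Hom_iff quotient_ar)

lemma quotient_comp:
  assumes "f \<in> Ar K" "g \<in> Ar K" "Cod K f = Dom K g"
  shows "R `` {g} \<cdot>\<^bsub>quotient_cat K R\<^esub> R `` {f} = R `` {g \<cdot> f}"
proof -
  have "R `` {g' \<cdot> f' |g' f'. g' \<in> R `` {g} \<and> f' \<in> R `` {f}} = R `` {g \<cdot> f}"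
  proof (intro equalityI subsetI)
    fix x assume "x \<in> R `` {g' \<cdot> f' |g' f'. g' \<in> R `` {g} \<and> f' \<in> R `` {f}}"
    then obtain g' f' where "(g, g') \<in> R" "(f, f') \<in> R" "(g' \<cdot> f', x) \<in> R" by auto
    then show "x \<in> R `` {g \<cdot> f}"
      using comp_cong[of f f' g g'] assms(3) equiv by (auto simp: equiv_def dest: transD)
  next
    fix x assume "x \<in> R `` {g \<cdot> f}"
    then show "x \<in> R `` {g' \<cdot> f' |g' f'. g' \<in> R `` {g} \<and> f' \<in> R `` {f}}"
      using refl_ar assms by blast
  qed
  then show ?thesis by (simp add: quotient_cat_def)
qed

lemma quotient_idn: "Idn (quotient_cat K R) X = R `` {Idn K X}"
  by (simp add: quotient_cat_def)

lemma quotient_ob: "Ob (quotient_cat K R) = Ob K"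
  by (simp add: quotient_cat_def)

lemma quotient_category: "category (quotient_cat K R)"
proof
  let ?Q = "quotient_cat K R"
  show "Dom ?Q c \<in> Ob ?Q" "Cod ?Q c \<in> Ob ?Q" if "c \<in> Ar ?Q" for c
    using that by (auto simp: quotient_ar quotient_ob)
  show "Idn ?Q X \<in> Hom ?Q X X" if "X \<in> Ob ?Q" for X
    using that idn_hom by (auto simp: quotient_hom quotient_ob quotient_idn)
  have rep: "\<exists>f. f \<in> Ar K \<and> Dom K f = X \<and> Cod K f = Y \<and> c = R `` {f}"
    if "c \<in> Hom ?Q X Y" for c X Y
    using that unfolding quotient_hom by (auto simp: Hom_iff)
  show "d \<cdot>\<^bsub>?Q\<^esub> c \<in> Hom ?Q X Z" if "c \<in> Hom ?Q X Y" "d \<in> Hom ?Q Y Z" for c d X Y Z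
  proof -
    from rep[OF that(1)] rep[OF that(2)] obtain f g where "f \<in> Ar K" "Dom K f = X" "Cod K f = Y"
      "c = R `` {f}" "g \<in> Ar K" "Dom K g = Y" "Cod K g = Z" "d = R `` {g}" by blast
    then show ?thesis unfolding quotient_hom
      by (intro bexI[of _ "g \<cdot> f"]) (simp_all add: quotient_comp Hom_iff)
  qed
  show "(e \<cdot>\<^bsub>?Q\<^esub> d) \<cdot>\<^bsub>?Q\<^esub> c = e \<cdot>\<^bsub>?Q\<^esub> (d \<cdot>\<^bsub>?Q\<^esub> c)"
    if "c \<in> Hom ?Q W X" "d \<in> Hom ?Q X Y" "e \<in> Hom ?Q Y Z" for c d e W X Y Z
  proof -
    from rep[OF that(1)] rep[OF that(2)] rep[OF that(3)] obtain f g h where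
      "f \<in> Ar K" "Cod K f = X" "c = R `` {f}" "g \<in> Ar K" "Dom K g = X" "Cod K g = Y"
      "d = R `` {g}" "h \<in> Ar K" "Dom K h = Y" "e = R `` {h}" by blast
    then show ?thesis by (simp add: quotient_comp)
  qed
  show "Idn ?Q Y \<cdot>\<^bsub>?Q\<^esub> c = c" if "c \<in> Hom ?Q X Y" for c X Y
  proof -
    from rep[OF that] obtain f where f: "f \<in> Ar K" "Cod K f = Y" "c = R `` {f}" by blast
    then have "Y \<in> Ob K" by auto
    then show ?thesis using f by (simp add: quotient_comp quotient_idn)
  qed
  show "c \<cdot>\<^bsub>?Q\<^esub> Idn ?Q X = c" if "c \<in> Hom ?Q X Y" for c X Y
  proof -
    from rep[OF that] obtain f where f: "f \<in> Ar K" "Dom K f = X" "c = R `` {f}" by blast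
    then have "X \<in> Ob K" by auto
    then show ?thesis using f by (simp add: quotient_comp quotient_idn)
  qed
qed

end

locale congruence_functor =
  source: congruence K R + target: congruence L S + cat_functor K L FO FA
  for K :: "('o, 'm, 'z) cat_scheme" and R :: "('m \<times> 'm) set"
    and L :: "('p, 'n, 'y) cat_scheme" and S :: "('n \<times> 'n) set"
    and FO :: "'o \<Rightarrow> 'p" and FA :: "'m \<Rightarrow> 'n" +
  assumes preserves: "(f, f') \<in> R \<Longrightarrow> (FA f, FA f') \<in> S"
begin

definition induced :: "'m set \<Rightarrow> 'n set" where
  "induced c = S `` (FA ` c)"

lemma induced_class:
  assumes f: "f \<in> Ar K"
  shows "induced (R `` {f}) = S `` {FA f}"
proof (intro equalityI subsetI)
  fix x assume "x \<in> induced (R `` {f})"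
  then obtain f' where "(f, f') \<in> R" "(FA f', x) \<in> S" by (auto simp: induced_def)
  then have "(FA f, x) \<in> S"
    using preserves[of f f'] target.equiv by (auto simp: equiv_def dest: transD)
  then show "x \<in> S `` {FA f}" by simp
next
  fix x assume "x \<in> S `` {FA f}"
  then show "x \<in> induced (R `` {f})"
    using source.refl_ar[OF f] by (auto simp: induced_def)
qed

lemma FA_typed:
  assumes "f \<in> Ar K"
  shows "FA f \<in> Ar L" "Dom L (FA f) = FO (Dom K f)" "Cod L (FA f) = FO (Cod K f)"
  using ar[of f "Dom K f" "Cod K f"] assms by (simp_all add: Hom_iff)

lemma induced_functor: "cat_functor (quotient_cat K R) (quotient_cat L S) FO induced"
proof (intro cat_functor.intro cat_functor_axioms.intro)
  show "category (quotient_cat K R)" by (rule source.quotient_category)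
  show "category (quotient_cat L S)" by (rule target.quotient_category)
  show "FO X \<in> Ob (quotient_cat L S)" if "X \<in> Ob (quotient_cat K R)" for X
    using ob that by (simp add: source.quotient_ob target.quotient_ob)
  show "induced c \<in> Hom (quotient_cat L S) (FO X) (FO Y)"
    if c: "c \<in> Hom (quotient_cat K R) X Y" for c X Y
  proof -
    obtain f where f: "f \<in> Hom K X Y" "c = R `` {f}" using c by (auto simp: source.quotient_hom)
    have "induced c = S `` {FA f}" using f by (simp add: Hom_iff induced_class)
    then show ?thesis using ar[OF f(1)] by (auto simp: target.quotient_hom)
  qed
  show "induced (Idn (quotient_cat K R) X) = Idn (quotient_cat L S) (FO X)"
    if "X \<in> Ob (quotient_cat K R)" for X
    using that idn[of X] by (simp add: source.quotient_ob source.quotient_idn target.quotient_idn induced_class)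
  show "induced (d \<cdot>\<^bsub>quotient_cat K R\<^esub> c) = induced d \<cdot>\<^bsub>quotient_cat L S\<^esub> induced c"
    if c: "c \<in> Hom (quotient_cat K R) X Y" and d: "d \<in> Hom (quotient_cat K R) Y Z" for c d X Y Z
  proof -
    obtain f where f: "f \<in> Hom K X Y" "c = R `` {f}" using c by (auto simp: source.quotient_hom)
    obtain g where g: "g \<in> Hom K Y Z" "d = R `` {g}" using d by (auto simp: source.quotient_hom)
    have typed: "f \<in> Ar K" "g \<in> Ar K" "Cod K f = Dom K g" using f g by (simp_all add: Hom_iff)
    have "induced (d \<cdot>\<^bsub>quotient_cat K R\<^esub> c) = S `` {FA (g \<cdot>\<^bsub>K\<^esub> f)}"
      using typed by (simp add: f(2) g(2) source.quotient_comp induced_class)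
    also have "\<dots> = induced d \<cdot>\<^bsub>quotient_cat L S\<^esub> induced c"
      using typed comp[OF f(1) g(1)] FA_typed
      by (simp add: f(2) g(2) induced_class target.quotient_comp)
    finally show ?thesis .
  qed
qed

lemma induced_bij:
  assumes full: "\<And>g. g \<in> Hom L (FO X) (FO Y) \<Longrightarrow> \<exists>f \<in> Hom K X Y. FA f = g"
    and reflects: "\<And>f f'. \<lbrakk>f \<in> Hom K X Y; f' \<in> Hom K X Y; (FA f, FA f') \<in> S\<rbrakk> \<Longrightarrow> (f, f') \<in> R"
  shows "bij_betw induced (Hom (quotient_cat K R) X Y) (Hom (quotient_cat L S) (FO X) (FO Y))"
  unfolding bij_betw_def
proof (rule conjI[OF inj_onI])
  fix c d assume c: "c \<in> Hom (quotient_cat K R) X Y" and d: "d \<in> Hom (quotient_cat K R) X Y"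
    and eq: "induced c = induced d"
  obtain f where f: "f \<in> Hom K X Y" "c = R `` {f}" using c by (auto simp: source.quotient_hom)
  obtain g where g: "g \<in> Hom K X Y" "d = R `` {g}" using d by (auto simp: source.quotient_hom)
  have typed: "f \<in> Ar K" "g \<in> Ar K" using f g by (simp_all add: Hom_iff)
  have "S `` {FA f} = S `` {FA g}" using eq typed by (simp add: f(2) g(2) induced_class)
  then have "(FA f, FA g) \<in> S" using target.class_eq_iff FA_typed(1) typed by simp
  then have "(f, g) \<in> R" by (rule reflects[OF f(1) g(1)])
  then show "c = d" using source.class_eq_iff[OF typed] by (simp add: f(2) g(2))
next
  show "induced ` Hom (quotient_cat K R) X Y = Hom (quotient_cat L S) (FO X) (FO Y)"
  proof (intro equalityI subsetI)
    fix e assume "e \<in> induced ` Hom (quotient_cat K R) X Y"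
    then obtain c where c: "c \<in> Hom (quotient_cat K R) X Y" "e = induced c" by blast
    then show "e \<in> Hom (quotient_cat L S) (FO X) (FO Y)"
      using cat_functor.ar[OF induced_functor c(1)] by simp
  next
    fix e assume "e \<in> Hom (quotient_cat L S) (FO X) (FO Y)"
    then obtain g where g: "g \<in> Hom L (FO X) (FO Y)" "e = S `` {g}" by (auto simp: target.quotient_hom)
    obtain f where f: "f \<in> Hom K X Y" "FA f = g" using full[OF g(1)] by blast
    have "induced (R `` {f}) = e" using f g by (simp add: Hom_iff induced_class)
    moreover have "R `` {f} \<in> Hom (quotient_cat K R) X Y" using f by (auto simp: source.quotient_hom)
    ultimately show "e \<in> induced ` Hom (quotient_cat K R) X Y" by blast
  qed
qed

end

section \<open>Additive categories\<close>

lemma hom_group_simps [simp]: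
  "carrier (hom_group K X Y) = Hom K X Y" "mult (hom_group K X Y) = Plus K"
  "one (hom_group K X Y) = Zero K X Y"
  by (simp_all add: hom_group_def)

context additive
begin

abbreviation plus_ar (infixl "\<oplus>\<oplus>" 65) where "plus_ar \<equiv> Plus K"

lemma plus_typed [simp]:
  assumes "f \<in> Ar K" "g \<in> Ar K" "Dom K f = Dom K g" "Cod K f = Cod K g"
  shows "f \<oplus>\<oplus> g \<in> Ar K" "Dom K (f \<oplus>\<oplus> g) = Dom K g" "Cod K (f \<oplus>\<oplus> g) = Cod K g"
proof -
  interpret G: comm_group "hom_group K (Dom K g) (Cod K g)"
    using assms by (intro hom_comm_group) simp_all
  have "f \<oplus>\<oplus> g \<in> Hom K (Dom K g) (Cod K g)"
    using G.m_closed[of f g] assms by (simp add: Hom_iff)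
  then show "f \<oplus>\<oplus> g \<in> Ar K" "Dom K (f \<oplus>\<oplus> g) = Dom K g" "Cod K (f \<oplus>\<oplus> g) = Cod K g"
    by (simp_all add: Hom_iff)
qed

lemma zero_typed [simp]:
  assumes "X \<in> Ob K" "Y \<in> Ob K"
  shows "Zero K X Y \<in> Ar K" "Dom K (Zero K X Y) = X" "Cod K (Zero K X Y) = Y"
proof -
  interpret G: comm_group "hom_group K X Y" using assms by (rule hom_comm_group)
  show "Zero K X Y \<in> Ar K" "Dom K (Zero K X Y) = X" "Cod K (Zero K X Y) = Y"
    using G.one_closed by (simp_all add: Hom_iff)
qed

lemma plus_commute:
  assumes "f \<in> Ar K" "g \<in> Ar K" "Dom K f = Dom K g" "Cod K f = Cod K g"
  shows "f \<oplus>\<oplus> g = g \<oplus>\<oplus> f"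
proof -
  interpret G: comm_group "hom_group K (Dom K g) (Cod K g)"
    using assms by (intro hom_comm_group) simp_all
  show ?thesis using G.m_comm[of f g] assms by (simp add: Hom_iff)
qed

lemma plus_assoc:
  assumes "f \<in> Ar K" "g \<in> Ar K" "h \<in> Ar K" "Dom K f = Dom K h" "Cod K f = Cod K h"
    "Dom K g = Dom K h" "Cod K g = Cod K h"
  shows "f \<oplus>\<oplus> g \<oplus>\<oplus> h = f \<oplus>\<oplus> (g \<oplus>\<oplus> h)"
proof -
  interpret G: comm_group "hom_group K (Dom K h) (Cod K h)"
    using assms by (intro hom_comm_group) simp_all
  show ?thesis using G.m_assoc[of f g h] assms by (simp add: Hom_iff)
qed

lemma plus_zero [simp]:
  assumes "f \<in> Ar K" "Dom K f = X" "Cod K f = Y"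
  shows "f \<oplus>\<oplus> Zero K X Y = f" "Zero K X Y \<oplus>\<oplus> f = f"
proof -
  interpret G: comm_group "hom_group K X Y"
    using assms by (intro hom_comm_group) auto
  show "f \<oplus>\<oplus> Zero K X Y = f" "Zero K X Y \<oplus>\<oplus> f = f"
    using G.r_one[of f] G.l_one[of f] assms by (simp_all add: Hom_iff)
qed

lemma neg_typed [simp]:
  assumes "f \<in> Ar K"
  shows "neg K f \<in> Ar K" "Dom K (neg K f) = Dom K f" "Cod K (neg K f) = Cod K f"
proof -
  interpret G: comm_group "hom_group K (Dom K f) (Cod K f)"
    using assms by (intro hom_comm_group) auto
  have "neg K f \<in> Hom K (Dom K f) (Cod K f)"
    using G.inv_closed[of f] assms by (simp add: Hom_iff neg_def)
  then show "neg K f \<in> Ar K" "Dom K (neg K f) = Dom K f" "Cod K (neg K f) = Cod K f"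
    by (simp_all add: Hom_iff)
qed

lemma plus_neg [simp]:
  assumes "f \<in> Ar K"
  shows "f \<oplus>\<oplus> neg K f = Zero K (Dom K f) (Cod K f)"
    "neg K f \<oplus>\<oplus> f = Zero K (Dom K f) (Cod K f)"
proof -
  interpret G: comm_group "hom_group K (Dom K f) (Cod K f)"
    using assms by (intro hom_comm_group) auto
  show "f \<oplus>\<oplus> neg K f = Zero K (Dom K f) (Cod K f)"
    "neg K f \<oplus>\<oplus> f = Zero K (Dom K f) (Cod K f)"
    using G.r_inv[of f] G.l_inv[of f] assms by (simp_all add: Hom_iff neg_def)
qed

lemma plus_cancel_right:
  assumes "f \<oplus>\<oplus> h = g \<oplus>\<oplus> h" "f \<in> Ar K" "g \<in> Ar K" "h \<in> Ar K" "Dom K f = Dom K h"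
    "Cod K f = Cod K h" "Dom K g = Dom K h" "Cod K g = Cod K h"
  shows "f = g"
proof -
  have "f = f \<oplus>\<oplus> h \<oplus>\<oplus> neg K h" using assms(2-) by (simp add: plus_assoc)
  also have "\<dots> = g" using assms by (simp add: plus_assoc)
  finally show ?thesis .
qed

lemma idempotent_zero:
  assumes "f \<oplus>\<oplus> f = f" "f \<in> Ar K"
  shows "f = Zero K (Dom K f) (Cod K f)"
  using assms by (intro plus_cancel_right[of f f "Zero K (Dom K f) (Cod K f)"]) simp_all

lemma comp_plus [simp]:
  "\<lbrakk>f \<in> Ar K; g \<in> Ar K; h \<in> Ar K; Dom K f = Dom K g; Cod K f = Cod K g; Dom K h = Cod K g\<rbrakk>
    \<Longrightarrow> h \<cdot> (f \<oplus>\<oplus> g) = h \<cdot> f \<oplus>\<oplus> h \<cdot> g"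
  using comp_plus_right[of f "Dom K g" "Cod K g" g h "Cod K h"] by (simp add: Hom_iff)

lemma plus_comp [simp]:
  "\<lbrakk>f \<in> Ar K; g \<in> Ar K; h \<in> Ar K; Dom K f = Dom K g; Cod K f = Cod K g; Cod K h = Dom K g\<rbrakk>
    \<Longrightarrow> (f \<oplus>\<oplus> g) \<cdot> h = f \<cdot> h \<oplus>\<oplus> g \<cdot> h"
  using comp_plus_left[of h "Dom K h" "Dom K g" f "Cod K g" g] by (simp add: Hom_iff)

lemma comp_zero [simp]:
  assumes "g \<in> Ar K" "Dom K g = Y" "X \<in> Ob K"
  shows "g \<cdot> Zero K X Y = Zero K X (Cod K g)"
proof -
  have Y: "Y \<in> Ob K" using assms by auto
  have "g \<cdot> Zero K X Y \<oplus>\<oplus> g \<cdot> Zero K X Y = g \<cdot> Zero K X Y"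
    using assms Y comp_plus[of "Zero K X Y" "Zero K X Y" g] by simp
  from idempotent_zero[OF this] assms Y show ?thesis by simp
qed

lemma zero_comp [simp]:
  assumes "f \<in> Ar K" "Cod K f = Y" "Z \<in> Ob K"
  shows "Zero K Y Z \<cdot> f = Zero K (Dom K f) Z"
proof -
  have Y: "Y \<in> Ob K" using assms by auto
  have "Zero K Y Z \<cdot> f \<oplus>\<oplus> Zero K Y Z \<cdot> f = Zero K Y Z \<cdot> f"
    using assms Y plus_comp[of "Zero K Y Z" "Zero K Y Z" f] by simp
  from idempotent_zero[OF this] assms Y show ?thesis by simp
qed

lemma neg_unique:
  assumes "f \<oplus>\<oplus> g = Zero K (Dom K f) (Cod K f)" "f \<in> Ar K" "g \<in> Ar K"
    "Dom K f = Dom K g" "Cod K f = Cod K g"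
  shows "f = neg K g"
  using assms by (intro plus_cancel_right[of f g "neg K g"]) simp_all

lemma neg_comp [simp]:
  assumes "f \<in> Ar K" "g \<in> Ar K" "Cod K f = Dom K g"
  shows "neg K g \<cdot> f = neg K (g \<cdot> f)"
proof (rule neg_unique)
  have "neg K g \<cdot> f \<oplus>\<oplus> g \<cdot> f = (neg K g \<oplus>\<oplus> g) \<cdot> f"
    using assms by (intro plus_comp[symmetric]) simp_all
  then show "neg K g \<cdot> f \<oplus>\<oplus> g \<cdot> f = Zero K (Dom K (neg K g \<cdot> f)) (Cod K (neg K g \<cdot> f))"
    using assms by (simp del: plus_comp)
qed (use assms in simp_all)

lemma comp_neg [simp]:
  assumes "f \<in> Ar K" "g \<in> Ar K" "Cod K f = Dom K g"
  shows "g \<cdot> neg K f = neg K (g \<cdot> f)"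
proof (rule neg_unique)
  have "g \<cdot> neg K f \<oplus>\<oplus> g \<cdot> f = g \<cdot> (neg K f \<oplus>\<oplus> f)"
    using assms by (intro comp_plus[symmetric]) simp_all
  then show "g \<cdot> neg K f \<oplus>\<oplus> g \<cdot> f = Zero K (Dom K (g \<cdot> neg K f)) (Cod K (g \<cdot> neg K f))"
    using assms by (simp del: comp_plus)
qed (use assms in simp_all)

lemma neg_neg [simp]: "f \<in> Ar K \<Longrightarrow> neg K (neg K f) = f"
  by (rule neg_unique[symmetric]) simp_all

lemma neg_zero [simp]: "\<lbrakk>X \<in> Ob K; Y \<in> Ob K\<rbrakk> \<Longrightarrow> neg K (Zero K X Y) = Zero K X Y"
  by (rule neg_unique[symmetric]) simp_all

lemma minus_zero_iff:
  assumes "f \<in> Ar K" "g \<in> Ar K" "Dom K f = Dom K g" "Cod K f = Cod K g"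
  shows "f \<oplus>\<oplus> neg K g = Zero K (Dom K g) (Cod K g) \<longleftrightarrow> f = g"
proof
  assume "f \<oplus>\<oplus> neg K g = Zero K (Dom K g) (Cod K g)"
  then have "f = neg K (neg K g)" using assms by (intro neg_unique) simp_all
  then show "f = g" using assms by simp
qed (use assms in simp)

lemma zero_ob: "is_zero_ob K (zero_ob K)"
  unfolding zero_ob_def using ex_zero_ob by (rule someI_ex)

lemma zero_ob_ob [simp]: "zero_ob K \<in> Ob K"
  using zero_ob by (simp add: is_zero_ob_def)

lemma zero_ob_cod:
  assumes "is_zero_ob K Z" "f \<in> Ar K" "Cod K f = Z"
  shows "f = Zero K (Dom K f) Z"
proof -
  have "\<exists>!f'. f' \<in> Hom K (Dom K f) Z" "Z \<in> Ob K"
    using assms by (auto simp: is_zero_ob_def)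
  moreover have "f \<in> Hom K (Dom K f) Z" "Zero K (Dom K f) Z \<in> Hom K (Dom K f) Z"
    using assms \<open>Z \<in> Ob K\<close> by (simp_all add: Hom_iff)
  ultimately show ?thesis by blast
qed

lemma zero_ob_dom:
  assumes "is_zero_ob K Z" "f \<in> Ar K" "Dom K f = Z"
  shows "f = Zero K Z (Cod K f)"
proof -
  have "\<exists>!f'. f' \<in> Hom K Z (Cod K f)" "Z \<in> Ob K"
    using assms by (auto simp: is_zero_ob_def)
  moreover have "f \<in> Hom K Z (Cod K f)" "Zero K Z (Cod K f) \<in> Hom K Z (Cod K f)"
    using assms \<open>Z \<in> Ob K\<close> by (simp_all add: Hom_iff)
  ultimately show ?thesis by blast
qed

lemma zero_obI:
  assumes "Z \<in> Ob K" "Idn K Z = Zero K Z Z"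
  shows "is_zero_ob K Z"
proof -
  have "f = Zero K X Z" if "f \<in> Hom K X Z" for f X
    using that assms idn_cancel(1)[of f Z] zero_comp[of f Z Z] by (simp add: Hom_iff)
  moreover have "f = Zero K Z X" if "f \<in> Hom K Z X" for f X
    using that assms idn_cancel(2)[of f Z] comp_zero[of f Z Z] by (simp add: Hom_iff)
  moreover have "Zero K X Z \<in> Hom K X Z" "Zero K Z X \<in> Hom K Z X" if "X \<in> Ob K" for X
    using that assms by (simp_all add: Hom_iff)
  ultimately show ?thesis using assms(1) unfolding is_zero_ob_def by blast
qed

end

section \<open>Exact triangles\<close>

context triangulated
begin

notation plus_ar (infixl "\<oplus>\<oplus>" 65)

lemma sus_ob [simp]: "X \<in> Ob T \<Longrightarrow> SigO T X \<in> Ob T"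
  by (rule suspension.ob)

lemma sus_typed [simp]:
  assumes "f \<in> Ar T"
  shows "SigA T f \<in> Ar T" "Dom T (SigA T f) = SigO T (Dom T f)"
    "Cod T (SigA T f) = SigO T (Cod T f)"
  using suspension.ar[of f "Dom T f" "Cod T f"] assms by (simp_all add: Hom_iff)

lemma sus_comp [simp]:
  "\<lbrakk>f \<in> Ar T; g \<in> Ar T; Cod T f = Dom T g\<rbrakk> \<Longrightarrow> SigA T (g \<cdot> f) = SigA T g \<cdot> SigA T f"
  using suspension.comp[of f "Dom T f" "Dom T g" g "Cod T g"] by (simp add: Hom_iff)

lemma sus_idn [simp]: "X \<in> Ob T \<Longrightarrow> SigA T (Idn T X) = Idn T (SigO T X)"
  by (rule suspension.idn)

lemma sus_zero [simp]:
  assumes "X \<in> Ob T" "Y \<in> Ob T"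
  shows "SigA T (Zero T X Y) = Zero T (SigO T X) (SigO T Y)"
  using assms sus_plus[of "Zero T X Y" X Y "Zero T X Y"]
    idempotent_zero[of "SigA T (Zero T X Y)"] by (simp add: Hom_iff)

lemma sus_faithful:
  assumes "SigA T f = SigA T g" "f \<in> Ar T" "g \<in> Ar T" "Dom T f = Dom T g" "Cod T f = Cod T g"
  shows "f = g"
  using sus_fully_faithful[of "Dom T g" "Cod T g"] assms
  by (auto simp: bij_betw_def inj_on_def Hom_iff)

lemma sus_full:
  assumes "g \<in> Hom T (SigO T X) (SigO T Y)" "X \<in> Ob T" "Y \<in> Ob T"
  obtains f where "f \<in> Hom T X Y" "SigA T f = g"
proof -
  have "g \<in> SigA T ` Hom T X Y"
    using bij_betw_imp_surj_on[OF sus_fully_faithful[OF assms(2,3)]] assms(1) by simp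
  then show thesis using that by (elim imageE) simp
qed

lemma zero_ob_sus:
  assumes "is_zero_ob T Z"
  shows "is_zero_ob T (SigO T Z)"
proof -
  have Z: "Z \<in> Ob T" using assms by (simp add: is_zero_ob_def)
  have "Idn T Z = Zero T Z Z" using zero_ob_cod[OF assms, of "Idn T Z"] Z by simp
  then have "SigA T (Idn T Z) = SigA T (Zero T Z Z)" by simp
  then show ?thesis using Z by (intro zero_obI) simp_all
qed

lemma triangle_typed:
  assumes "(f, g, h) \<in> Tri T"
  shows "f \<in> Ar T" "g \<in> Ar T" "h \<in> Ar T" "Dom T g = Cod T f" "Dom T h = Cod T g"
    "Cod T h = SigO T (Dom T f)"
  using tri_shape[OF assms] by (simp_all add: triangle_shape_def)

lemma rotate:
  assumes "(f, g, h) \<in> Tri T"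
  shows "(g, h, neg T (SigA T f)) \<in> Tri T"
  using TR2[OF tri_shape[OF assms]] assms by simp

text \<open>The morphism of triangles from \<open>(Idn X, 0, 0)\<close> with components \<open>Idn X\<close> and \<open>f\<close> factors \<open>g \<cdot> f\<close>
  through a zero object.\<close>

lemma consecutive_zero:
  assumes t: "(f, g, h) \<in> Tri T"
  shows "g \<cdot> f = Zero T (Dom T f) (Cod T g)"
proof -
  note [simp] = triangle_typed[OF t]
  obtain Z where Z: "is_zero_ob T Z" using ex_zero_ob by blast
  then have [simp]: "Z \<in> Ob T" by (simp add: is_zero_ob_def)
  have "(Idn T (Dom T f), Zero T (Dom T f) Z, Zero T Z (SigO T (Dom T f))) \<in> Tri T"
    using TR1_idn[OF _ Z, of "Dom T f"] by simp
  from TR3[OF this t, of "Idn T (Dom T f)" f] obtain c where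
    "c \<in> Hom T Z (Cod T g)" "c \<cdot> Zero T (Dom T f) Z = g \<cdot> f"
    by (auto simp: Hom_iff)
  then show ?thesis by (simp add: Hom_iff)
qed

lemma consecutive_zero':
  assumes t: "(f, g, h) \<in> Tri T"
  shows "h \<cdot> g = Zero T (Cod T f) (SigO T (Dom T f))"
    "SigA T f \<cdot> h = Zero T (Cod T g) (SigO T (Cod T f))"
proof -
  note [simp] = triangle_typed[OF t]
  show "h \<cdot> g = Zero T (Cod T f) (SigO T (Dom T f))"
    using consecutive_zero[OF rotate[OF t]] by simp
  have "neg T (SigA T f \<cdot> h) = Zero T (Cod T g) (SigO T (Cod T f))"
    using consecutive_zero[OF rotate[OF rotate[OF t]]] by simp
  then have "neg T (neg T (SigA T f \<cdot> h)) = neg T (Zero T (Cod T g) (SigO T (Cod T f)))" by simp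
  then show "SigA T f \<cdot> h = Zero T (Cod T g) (SigO T (Cod T f))" by simp
qed

text \<open>Rotating the triangle on the identity of \<open>S\<close> gives \<open>S \<rightarrow> 0 \<rightarrow> \<Sigma>S\<close>.  The pair \<open>(x, 0)\<close> extends to a
  morphism from it to the rotation of the given triangle, and the third component \<open>\<Sigma>S \<rightarrow> \<Sigma>X\<close>
  desuspends to the lift of \<open>x\<close>.\<close>

lemma hom_exact:
  assumes t: "(f, g, h) \<in> Tri T" and x: "x \<in> Hom T S (Cod T f)"
    and gx: "g \<cdot> x = Zero T S (Cod T g)"
  obtains y where "y \<in> Hom T S (Dom T f)" "f \<cdot> y = x"
proof -
  note [simp] = triangle_typed[OF t]
  have S [simp]: "S \<in> Ob T" and x' [simp]: "x \<in> Ar T" "Dom T x = S" "Cod T x = Cod T f"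
    using x by (auto simp: Hom_iff)
  obtain Z where Z: "is_zero_ob T Z" using ex_zero_ob by blast
  then have [simp]: "Z \<in> Ob T" by (simp add: is_zero_ob_def)
  have t': "(Zero T S Z, Zero T Z (SigO T S), neg T (Idn T (SigO T S))) \<in> Tri T"
    using rotate[OF TR1_idn[OF S Z]] by simp
  have "\<exists>c\<in>Hom T (Dom T (neg T (Idn T (SigO T S)))) (Dom T (neg T (SigA T f))).
    c \<cdot> Zero T Z (SigO T S) = h \<cdot> Zero T Z (Cod T g) \<and>
    SigA T x \<cdot> neg T (Idn T (SigO T S)) = neg T (SigA T f) \<cdot> c"
    using gx by (intro TR3[OF t' rotate[OF t]]) (simp_all add: Hom_iff)
  then obtain c where c: "c \<in> Hom T (SigO T S) (SigO T (Dom T f))"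
    and eq: "SigA T x \<cdot> neg T (Idn T (SigO T S)) = neg T (SigA T f) \<cdot> c"
    by auto
  obtain y where y: "y \<in> Hom T S (Dom T f)" "SigA T y = c" using sus_full[OF c] by auto
  note [simp] = hom_typed[OF y(1)]
  have "neg T (SigA T x) = neg T (SigA T (f \<cdot> y))"
    using eq y(2) by auto
  then have "neg T (neg T (SigA T x)) = neg T (neg T (SigA T (f \<cdot> y)))" by simp
  then have "SigA T x = SigA T (f \<cdot> y)" by (simp del: sus_comp)
  then have "f \<cdot> y = x" by (intro sus_faithful[of "f \<cdot> y" x]) (simp_all del: sus_comp)
  then show thesis using that y(1) by blast
qed

text \<open>The pair \<open>(0, x)\<close> extends to a morphism into the triangle \<open>0 \<rightarrow> V = V \<rightarrow> \<Sigma>0\<close>.\<close>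

lemma cohom_exact:
  assumes t: "(f, g, h) \<in> Tri T" and x: "x \<in> Hom T (Cod T f) V"
    and xf: "x \<cdot> f = Zero T (Dom T f) V"
  obtains z where "z \<in> Hom T (Cod T g) V" "z \<cdot> g = x"
proof -
  note [simp] = triangle_typed[OF t]
  have V [simp]: "V \<in> Ob T" and [simp]: "x \<in> Ar T" "Dom T x = Cod T f" "Cod T x = V"
    using x by (auto simp: Hom_iff)
  obtain Z where Z: "is_zero_ob T Z" using ex_zero_ob by blast
  then have [simp]: "Z \<in> Ob T" by (simp add: is_zero_ob_def)
  note sZ = zero_ob_sus[OF Z]
  have "(Zero T Z V, Idn T V, Zero T V (SigO T Z)) \<in> Tri T"
  proof -
    have "triangle_shape T (Zero T Z V) (Idn T V) (Zero T V (SigO T Z))"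
      by (simp add: triangle_shape_def)
    moreover have "(Idn T V, Zero T V (SigO T Z), neg T (SigA T (Zero T Z V))) \<in> Tri T"
      using TR1_idn[OF V sZ] zero_ob_dom[OF sZ, of "Zero T (SigO T Z) (SigO T V)"] by simp
    ultimately show ?thesis using TR2 by blast
  qed
  from TR3[OF t this, of "Zero T (Dom T f) Z" x] obtain c where
    "c \<in> Hom T (Cod T g) V" "c \<cdot> g = Idn T V \<cdot> x"
    using xf by (auto simp: Hom_iff)
  then show thesis using that by simp
qed

text \<open>The obstruction to extending \<open>g\<close> along \<open>p\<close> is \<open>\<Sigma>g \<cdot> d\<close>, and \<open>d\<close> starts at a zero object.\<close>

lemma extend_along_zero_cone:
  assumes t: "(p, w, d) \<in> Tri T" and W: "is_zero_ob T (Cod T w)"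
    and g: "g \<in> Hom T (Dom T p) V"
  obtains h where "h \<in> Hom T (Cod T p) V" "h \<cdot> p = g"
proof -
  note [simp] = triangle_typed[OF t]
  have [simp]: "g \<in> Ar T" "Dom T g = Dom T p" "Cod T g = V" "V \<in> Ob T"
    using g by (auto simp: Hom_iff)
  have "SigA T g \<cdot> d = Zero T (Cod T w) (SigO T V)"
    using zero_ob_dom[OF W, of "SigA T g \<cdot> d"] by simp
  then obtain z where z: "z \<in> Hom T (SigO T (Cod T p)) (SigO T V)"
      "z \<cdot> neg T (SigA T p) = SigA T g"
    using cohom_exact[OF rotate[OF rotate[OF t]], of "SigA T g" "SigO T V"]
    by (auto simp: Hom_iff)
  note [simp] = hom_typed[OF z(1)]
  obtain h where h: "h \<in> Hom T (Cod T p) V" "SigA T h = neg T z"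
    using sus_full[of "neg T z" "Cod T p" V] by (auto simp: Hom_iff)
  note [simp] = hom_typed[OF h(1)]
  have "SigA T (h \<cdot> p) = SigA T g" using h(2) z(2) by simp
  then have "h \<cdot> p = g" by (intro sus_faithful[of "h \<cdot> p" g]) (simp_all del: sus_comp)
  then show thesis using that h(1) by blast
qed

text \<open>Complete \<open>c\<close> to a triangle, replace the cone by an isomorphic suspension \<open>\<Sigma>F\<close>, and rotate back.\<close>

lemma fiber_exists:
  assumes c: "c \<in> Ar T"
  obtains a b where "(a, c, b) \<in> Tri T"
proof -
  obtain g h where t: "(c, g, h) \<in> Tri T" using TR1_cone[OF c] by blast
  note [simp] = triangle_typed[OF t]
  obtain F k k' where F [simp]: "F \<in> Ob T" and k: "k \<in> Hom T (SigO T F) (Cod T g)"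
    and kk': "inverse_ars T k k'"
    using sus_ess_surj[of "Cod T g"] by (auto simp: isomorphic_def is_iso_def)
  have [simp]: "k \<in> Ar T" "Dom T k = SigO T F" "Cod T k = Cod T g"
    "k' \<in> Ar T" "Dom T k' = Cod T g" "Cod T k' = SigO T F"
    "k' \<cdot> k = Idn T (SigO T F)" "k \<cdot> k' = Idn T (Cod T g)"
    using k kk' by (auto simp: Hom_iff inverse_ars_def)
  obtain a where a: "a \<in> Hom T F (Dom T c)" "SigA T a = neg T (h \<cdot> k)"
    using sus_full[of "neg T (h \<cdot> k)" F "Dom T c"] by (auto simp: Hom_iff)
  note [simp] = hom_typed[OF a(1)]
  have iso: "is_iso T (Idn T X)" if "X \<in> Ob T" for X
    unfolding is_iso_def inverse_ars_def using that by (intro exI[of _ "Idn T X"]) (simp add: Hom_iff)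
  have "is_iso T k'"
    unfolding is_iso_def inverse_ars_def by (intro exI[of _ k]) (simp add: Hom_iff)
  then have "(c, k' \<cdot> g, neg T (SigA T a)) \<in> Tri T"
    using a(2) iso
    by (intro tri_iso[OF t, of _ _ _ "Idn T (Dom T c)" "Idn T (Cod T c)" k'])
      (simp_all add: triangle_shape_def Hom_iff comp_reduce[of k k' "Idn T (Cod T g)"])
  then have "(a, c, k' \<cdot> g) \<in> Tri T"
    by (subst TR2) (simp_all add: triangle_shape_def)
  then show thesis by (rule that)
qed

end

section \<open>Testing morphisms on a perfect generating class\<close>

text \<open>A morphism from \<open>S \<in> C\<close> to a coproduct need not be a finite sum of morphisms to the summands, so
  properties of \<open>T(S, -)\<close> on coproducts cannot be checked on summands directly.  Perfectness does this
  for surjectivity; the lemmas below derive from it what is needed about kernels.\<close>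

locale perfectly_generated = triangulated T
  for T :: "('o, 'm, 'z) tricat_scheme" (structure) +
  fixes \<kappa> :: "'k rel" and C :: "'o set"
  assumes regular: "regular_cardinal \<kappa>" and uncountable: "uncountable_cardinal \<kappa>"
    and coproducts: "has_coproducts \<kappa> T"
    and sus_closed: "closed_under_suspension T C"
    and desus_closed: "closed_under_desuspension T C"
    and generating: "generates T C" and perfect: "perfect \<kappa> T C"
begin

lemma C_ob [simp]: "S \<in> C \<Longrightarrow> S \<in> Ob T"
  using generating by (auto simp: generates_def)

text \<open>Small index sets are sets of elements of \<open>'k\<close>.  Countable coproducts are reached along an injection
  of the natural numbers into that type, whose range is small because \<open>\<kappa>\<close> is uncountable.\<close>

lemma countable_index:
  obtains e :: "nat \<Rightarrow> 'k" where "inj e" "|range e| <o \<kappa>"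
proof -
  have "infinite (Field \<kappa>)"
    using regular by (simp add: regular_cardinal_def cinfinite_def)
  then have "infinite (UNIV :: 'k set)" by (rule infinite_super[OF subset_UNIV])
  from infinite_countable_subset[OF this] obtain e :: "nat \<Rightarrow> 'k" where e: "inj e"
    by (elim exE conjE)
  have "|range e| \<le>o |UNIV :: nat set|" by (rule card_of_image)
  moreover have "|UNIV :: nat set| =o natLeq" by (rule card_of_nat)
  ultimately have "|range e| \<le>o natLeq" by (rule ordLeq_ordIso_trans)
  then have "|range e| <o \<kappa>"
    using uncountable unfolding uncountable_cardinal_def by (rule ordLeq_ordLess_trans)
  then show thesis using that e by blast
qed

lemma countable_coproduct:
  assumes "\<And>n :: nat. X n \<in> Ob T"
  obtains Q \<iota> where "is_coproduct T UNIV X Q \<iota>"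
proof -
  obtain e :: "nat \<Rightarrow> 'k" where e: "inj e" "|range e| <o \<kappa>" by (rule countable_index)
  then obtain Q \<iota> where Q: "is_coproduct T (range e) (\<lambda>i. X (inv_into UNIV e i)) Q \<iota>"
    using coproducts[unfolded has_coproducts_def, rule_format, of "range e" "\<lambda>i. X (inv_into UNIV e i)"] assms
    by auto
  have "bij_betw e UNIV (range e)" using e(1) by (rule inj_on_imp_bij_betw)
  from is_coproduct_reindex[OF this Q] show thesis using that e(1) by simp
qed

lemma coproduct_typed:
  assumes "is_coproduct T UNIV X Q \<iota>"
  shows "\<iota> n \<in> Ar T" "Dom T (\<iota> n) = X n" "Cod T (\<iota> n) = Q" "Q \<in> Ob T" "X n \<in> Ob T"
proof -
  have *: "\<iota> n \<in> Hom T (X n) Q" using coproduct_inj[OF assms] by simp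
  show "\<iota> n \<in> Ar T" "Dom T (\<iota> n) = X n" "Cod T (\<iota> n) = Q" using * by (simp_all add: Hom_iff)
  show "Q \<in> Ob T" "X n \<in> Ob T" using hom_ob[OF *] by simp_all
qed

lemma hom_surjE:
  assumes "hom_surj T S f" "y \<in> Hom T S (Cod T f)"
  obtains x where "x \<in> Hom T S (Dom T f)" "f \<cdot> x = y"
  using assms unfolding hom_surj_def by (metis imageE)

lemma hom_surjI:
  assumes "f \<in> Ar T" "\<And>y. y \<in> Hom T S (Cod T f) \<Longrightarrow> \<exists>x \<in> Hom T S (Dom T f). f \<cdot> x = y"
  shows "hom_surj T S f"
  unfolding hom_surj_def
proof (intro equalityI subsetI)
  fix y assume "y \<in> (\<lambda>x. f \<cdot> x) ` Hom T S (Dom T f)"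
  then show "y \<in> Hom T S (Cod T f)" using assms(1) by (auto simp: Hom_iff)
next
  fix y assume "y \<in> Hom T S (Cod T f)"
  from assms(2)[OF this] show "y \<in> (\<lambda>x. f \<cdot> x) ` Hom T S (Dom T f)" by blast
qed

lemma perfect_countable:
  fixes f :: "nat \<Rightarrow> 'm"
  assumes Q: "is_coproduct T UNIV X Q \<iota>" and R: "is_coproduct T UNIV Y R \<rho>"
    and f: "\<And>n. f n \<in> Hom T (X n) (Y n)"
    and F: "F \<in> Hom T Q R" "\<And>n. F \<cdot> \<iota> n = \<rho> n \<cdot> f n"
    and surj: "\<And>n S. S \<in> C \<Longrightarrow> hom_surj T S (f n)" and S: "S \<in> C"
  shows "hom_surj T S F"
proof -
  obtain e :: "nat \<Rightarrow> 'k" where e: "inj e" "|range e| <o \<kappa>" by (rule countable_index)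
  have bij: "bij_betw (inv_into UNIV e) (range e) UNIV"
    using e(1) by (simp add: bij_betw_inv_into inj_imp_bij_betw_inv)
  note [simp] = hom_typed[OF f]
  have "is_coproduct_ar T (range e) (\<lambda>i. f (inv_into UNIV e i)) Q (\<lambda>i. \<iota> (inv_into UNIV e i)) R (\<lambda>i. \<rho> (inv_into UNIV e i)) F"
    unfolding is_coproduct_ar_def
    using is_coproduct_reindex[OF bij Q] is_coproduct_reindex[OF bij R] F by simp
  then show ?thesis
    using perfect[unfolded perfect_def, rule_format, of "range e" "\<lambda>i. f (inv_into UNIV e i)"] e(2) surj S
    by blast
qed

text \<open>The objects \<open>Cod (c n)\<close> map to the cone of \<open>A\<close> by (TR3), and so does their coproduct, compatibly
  with \<open>G\<close>.  What vanishes in that coproduct vanishes in the cone, hence comes from \<open>QF\<close>.\<close>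

lemma coproduct_exact:
  fixes a b c :: "nat \<Rightarrow> 'm"
  assumes t: "\<And>n. (a n, c n, b n) \<in> Tri T"
    and F: "is_coproduct T UNIV (\<lambda>n. Dom T (a n)) QF \<phi>"
    and B: "is_coproduct T UNIV (\<lambda>n. Cod T (a n)) QB \<beta>"
    and D: "is_coproduct T UNIV (\<lambda>n. Cod T (c n)) QD \<delta>"
    and A: "A \<in> Hom T QF QB" "\<And>n. A \<cdot> \<phi> n = \<beta> n \<cdot> a n"
    and G: "G \<in> Hom T QB QD" "\<And>n. G \<cdot> \<beta> n = \<delta> n \<cdot> c n"
    and y: "y \<in> Hom T S QB" and Gy: "G \<cdot> y = Zero T S QD"
  obtains z where "z \<in> Hom T S QF" "A \<cdot> z = y"
proof -
  note [simp] = triangle_typed[OF t] coproduct_typed[OF F] coproduct_typed[OF B] coproduct_typed[OF D]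
  note [simp] = hom_typed[OF A(1)] hom_typed[OF G(1)] hom_typed[OF y]
  have [simp]: "S \<in> Ob T" using hom_ob[OF y] by simp
  obtain g h where t': "(A, g, h) \<in> Tri T" using TR1_cone[of A] by auto
  note [simp] = triangle_typed[OF t']
  have "\<exists>k \<in> Hom T (Dom T (b n)) (Dom T h). k \<cdot> c n = g \<cdot> \<beta> n \<and>
      SigA T (\<phi> n) \<cdot> b n = h \<cdot> k" for n
    using A(2) by (intro TR3[OF t t']) (simp_all add: Hom_iff)
  then have "\<forall>n. \<exists>k. k \<in> Hom T (Cod T (c n)) (Cod T g) \<and> k \<cdot> c n = g \<cdot> \<beta> n"
    by auto
  from choice[OF this] obtain k where k: "\<And>n. k n \<in> Hom T (Cod T (c n)) (Cod T g)"
    and kc: "\<And>n. k n \<cdot> c n = g \<cdot> \<beta> n" by blast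
  obtain K where K: "K \<in> Hom T QD (Cod T g)" and K\<delta>: "\<And>n. K \<cdot> \<delta> n = k n"
    using coproduct_desc[OF D, of "Cod T g" k] k by auto
  have [simp]: "K \<in> Ar T" "Dom T K = QD" "Cod T K = Cod T g"
    "\<And>n. k n \<in> Ar T" "\<And>n. Dom T (k n) = Cod T (c n)" "\<And>n. Cod T (k n) = Cod T g"
    using K k by (simp_all add: Hom_iff)
  have KG: "K \<cdot> G = g"
    by (rule coproduct_ext[OF B])
      (simp_all add: Hom_iff G(2) kc comp_reduce[OF K\<delta>])
  have "g \<cdot> y = K \<cdot> (G \<cdot> y)" by (simp add: comp_reduce[OF KG])
  then have "g \<cdot> y = Zero T S (Cod T g)" using Gy by simp
  then show thesis using hom_exact[OF t', of y S] y that by auto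
qed

lemma fibers_exist:
  fixes c :: "nat \<Rightarrow> 'm"
  assumes "\<And>n. c n \<in> Ar T"
  obtains a b where "\<And>n. (a n, c n, b n) \<in> Tri T"
proof -
  have "\<forall>n. \<exists>ab. (fst ab, c n, snd ab) \<in> Tri T"
  proof
    fix n
    obtain a b where "(a, c n, b) \<in> Tri T" using fiber_exists[OF assms] .
    then show "\<exists>ab. (fst ab, c n, snd ab) \<in> Tri T" by (intro exI[of _ "(a, b)"]) simp
  qed
  from choice[OF this] obtain ab where "\<forall>n. (fst (ab n), c n, snd (ab n)) \<in> Tri T" by (elim exE)
  then show thesis using that[of "\<lambda>n. fst (ab n)" "\<lambda>n. snd (ab n)"] by simp
qed

text \<open>The fibre of a morphism that vanishes on \<open>C\<close> is surjective on \<open>C\<close>.  By perfectness, so is the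
  coproduct of the fibres, and \<open>W\<close> vanishes on it.\<close>

lemma coproduct_of_zero:
  fixes w :: "nat \<Rightarrow> 'm"
  assumes F: "is_coproduct T UNIV X Q \<iota>" and E: "is_coproduct T UNIV Y R \<rho>"
    and w: "\<And>n. w n \<in> Hom T (X n) (Y n)"
    and W: "W \<in> Hom T Q R" "\<And>n. W \<cdot> \<iota> n = \<rho> n \<cdot> w n"
    and zero: "\<And>n S x. \<lbrakk>S \<in> C; x \<in> Hom T S (X n)\<rbrakk> \<Longrightarrow> w n \<cdot> x = Zero T S (Y n)"
    and S: "S \<in> C" and x: "x \<in> Hom T S Q"
  shows "W \<cdot> x = Zero T S R"
proof -
  note [simp] = coproduct_typed[OF F] coproduct_typed[OF E]
  note [simp] = hom_typed[OF w]
  note [simp] = hom_typed[OF W(1)] hom_typed[OF x]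
  obtain a b where t: "\<And>n. (a n, w n, b n) \<in> Tri T"
    using fibers_exist[of w] by auto
  have [simp]: "a n \<in> Ar T" "Cod T (a n) = X n" for n
    using triangle_typed[OF t[of n]] by simp_all
  obtain QG \<gamma> where G: "is_coproduct T UNIV (\<lambda>n. Dom T (a n)) QG \<gamma>"
    using countable_coproduct[of "\<lambda>n. Dom T (a n)"] by auto
  note [simp] = coproduct_typed[OF G]
  obtain A where A: "A \<in> Hom T QG Q" and A\<gamma>: "\<And>n. A \<cdot> \<gamma> n = \<iota> n \<cdot> a n"
    using coproduct_ar_exists[OF G F, of a] by (auto simp: Hom_iff)
  note [simp] = hom_typed[OF A]
  have "hom_surj T S' (a n)" if S': "S' \<in> C" for S' n
  proof (rule hom_surjI)
    fix y assume y: "y \<in> Hom T S' (Cod T (a n))"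
    then have "w n \<cdot> y = Zero T S' (Y n)" using zero[OF S'] by simp
    then show "\<exists>x\<in>Hom T S' (Dom T (a n)). a n \<cdot> x = y"
      using hom_exact[OF t y] by (metis \<open>\<And>n. Cod T (w n) = Y n\<close>)
  qed simp
  then have "hom_surj T S A"
    using A\<gamma> by (intro perfect_countable[OF G F _ A _ _ S, of a]) (simp_all add: Hom_iff)
  then obtain z where z: "z \<in> Hom T S QG" "A \<cdot> z = x"
    using x by (elim hom_surjE) auto
  note [simp] = hom_typed[OF z(1)]
  have WA: "W \<cdot> A = Zero T QG R"
  proof (rule coproduct_ext[OF G])
    fix n
    have "w n \<cdot> a n = Zero T (Dom T (a n)) (Y n)" using consecutive_zero[OF t[of n]] by simp
    then show "(W \<cdot> A) \<cdot> \<gamma> n = Zero T QG R \<cdot> \<gamma> n"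
      by (simp add: A\<gamma> comp_reduce[OF W(2)])
  qed (simp_all add: Hom_iff)
  have "W \<cdot> x = W \<cdot> (A \<cdot> z)" using z by simp
  also have "\<dots> = Zero T S R" using S by (simp add: comp_reduce[OF WA])
  finally show ?thesis .
qed

text \<open>The difference of \<open>y\<close> and \<open>y'\<close> comes from the coproduct of the fibres \<open>a n\<close> of the \<open>c n\<close>.  The
  hypothesis says that \<open>d n \<cdot> a n\<close> vanishes on \<open>C\<close>, so the coproduct of these composites does.\<close>

lemma coproduct_identification:
  fixes c d :: "nat \<Rightarrow> 'm"
  assumes B: "is_coproduct T UNIV X QB \<beta>" and D: "is_coproduct T UNIV Y QD \<delta>"
    and E: "is_coproduct T UNIV Z QE \<epsilon>"
    and c: "\<And>n. c n \<in> Hom T (X n) (Y n)" and d: "\<And>n. d n \<in> Hom T (X n) (Z n)"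
    and G: "G \<in> Hom T QB QD" "\<And>n. G \<cdot> \<beta> n = \<delta> n \<cdot> c n"
    and H: "H \<in> Hom T QB QE" "\<And>n. H \<cdot> \<beta> n = \<epsilon> n \<cdot> d n"
    and ker: "\<And>n S x. \<lbrakk>S \<in> C; x \<in> Hom T S (X n); c n \<cdot> x = Zero T S (Y n)\<rbrakk>
      \<Longrightarrow> d n \<cdot> x = Zero T S (Z n)"
    and S: "S \<in> C" and y: "y \<in> Hom T S QB" "y' \<in> Hom T S QB" "G \<cdot> y = G \<cdot> y'"
  shows "H \<cdot> y = H \<cdot> y'"
proof -
  note [simp] = coproduct_typed[OF B] coproduct_typed[OF D] coproduct_typed[OF E]
  note [simp] = hom_typed[OF c] hom_typed[OF d]
  note [simp] = hom_typed[OF G(1)] hom_typed[OF H(1)] hom_typed[OF y(1)] hom_typed[OF y(2)]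
  obtain a b where t: "\<And>n. (a n, c n, b n) \<in> Tri T"
    using fibers_exist[of c] by auto
  have [simp]: "a n \<in> Ar T" "Cod T (a n) = X n" for n
    using triangle_typed[OF t[of n]] by simp_all
  obtain QF \<phi> where F: "is_coproduct T UNIV (\<lambda>n. Dom T (a n)) QF \<phi>"
    using countable_coproduct[of "\<lambda>n. Dom T (a n)"] by auto
  note [simp] = coproduct_typed[OF F]
  obtain A where A: "A \<in> Hom T QF QB" and A\<phi>: "\<And>n. A \<cdot> \<phi> n = \<beta> n \<cdot> a n"
    using coproduct_ar_exists[OF F B, of a] by (auto simp: Hom_iff)
  note [simp] = hom_typed[OF A]
  have "G \<cdot> (y \<oplus>\<oplus> neg T y') = Zero T S QD" using y(3) by simp
  then obtain z where z: "z \<in> Hom T S QF" "A \<cdot> z = y \<oplus>\<oplus> neg T y'"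
    using coproduct_exact[OF t F _ _ A A\<phi> G, of "y \<oplus>\<oplus> neg T y'" S] B D by (auto simp: Hom_iff)
  note [simp] = hom_typed[OF z(1)]
  have "(H \<cdot> A) \<cdot> z = Zero T S QE"
  proof (rule coproduct_of_zero[OF F E _ _ _ _ S z(1), of "\<lambda>n. d n \<cdot> a n"])
    show "(H \<cdot> A) \<cdot> \<phi> n = \<epsilon> n \<cdot> d n \<cdot> a n" for n
      by (simp add: A\<phi> comp_reduce[OF H(2)])
    show "(d n \<cdot> a n) \<cdot> x = Zero T S' (Z n)" if S': "S' \<in> C" and x: "x \<in> Hom T S' (Dom T (a n))" for n S' x
    proof -
      note [simp] = hom_typed[OF x]
      have "c n \<cdot> a n = Zero T (Dom T (a n)) (Y n)" using consecutive_zero[OF t[of n]] by simp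
      then have "c n \<cdot> (a n \<cdot> x) = Zero T S' (Y n)" using S' by (simp add: comp_reduce)
      then show ?thesis using ker[OF S', of "a n \<cdot> x" n] by (simp add: Hom_iff)
    qed
  qed (simp_all add: Hom_iff)
  then have "H \<cdot> (y \<oplus>\<oplus> neg T y') = Zero T S QE" using z(2) by simp
  then have "H \<cdot> y \<oplus>\<oplus> neg T (H \<cdot> y') = Zero T S QE" by simp
  then show ?thesis using minus_zero_iff[of "H \<cdot> y" "H \<cdot> y'"] by simp
qed

text \<open>This says that \<open>S\<^sub>\<alpha>(u)\<close> is a monomorphism.\<close>

definition C_mono :: "'m \<Rightarrow> bool" where
  "C_mono u \<longleftrightarrow> (\<forall>S \<in> C. \<forall>x \<in> Hom T S (Dom T u). u \<cdot> x = Zero T S (Cod T u) \<longrightarrow> x = Zero T S (Dom T u))"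

lemma C_monoD:
  "\<lbrakk>C_mono u; S \<in> C; x \<in> Hom T S (Dom T u); u \<cdot> x = Zero T S (Cod T u)\<rbrakk> \<Longrightarrow> x = Zero T S (Dom T u)"
  unfolding C_mono_def by blast

lemma desuspend:
  assumes "S \<in> C"
  obtains S' k k' where "S' \<in> C" "k \<in> Hom T (SigO T S') S" "k' \<in> Hom T S (SigO T S')"
    "k \<cdot> k' = Idn T S"
proof -
  obtain S' where "S' \<in> C" "isomorphic T (SigO T S') S"
    using desus_closed[unfolded closed_under_desuspension_def, THEN bspec, OF assms] by (elim bexE)
  then show thesis
    using that unfolding isomorphic_def is_iso_def inverse_ars_def by (auto simp: Hom_iff)
qed

lemma suspend:
  assumes "S \<in> C"
  obtains S' k k' where "S' \<in> C" "k \<in> Hom T S' (SigO T S)" "k' \<in> Hom T (SigO T S) S'"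
    "k \<cdot> k' = Idn T (SigO T S)"
proof -
  obtain S' where S': "S' \<in> C" "isomorphic T S' (SigO T S)"
    using sus_closed[unfolded closed_under_suspension_def, THEN bspec, OF assms] by (elim bexE)
  then obtain k k' where "k \<in> Hom T S' (SigO T S)" "inverse_ars T k k'"
    unfolding isomorphic_def is_iso_def by blast
  then show thesis
    using that[of S' k k'] S'(1) unfolding inverse_ars_def Hom_iff by simp
qed

lemma C_mono_sus:
  assumes u: "u \<in> Ar T" and mono: "C_mono u"
  shows "C_mono (SigA T u)"
  unfolding C_mono_def
proof (intro ballI impI)
  fix S x assume S: "S \<in> C" and x: "x \<in> Hom T S (Dom T (SigA T u))"
    and ux: "SigA T u \<cdot> x = Zero T S (Cod T (SigA T u))"
  note [simp] = u
  note [simp] = hom_typed[OF x]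
  obtain S' k k' where S' [simp]: "S' \<in> C" and k: "k \<in> Hom T (SigO T S') S" "k' \<in> Hom T S (SigO T S')"
    and kk': "k \<cdot> k' = Idn T S" by (rule desuspend[OF S])
  note [simp] = hom_typed[OF k(1)] hom_typed[OF k(2)]
  obtain x' where x': "x' \<in> Hom T S' (Dom T u)" "SigA T x' = x \<cdot> k"
    using sus_full[of "x \<cdot> k" S' "Dom T u"] by (auto simp: Hom_iff)
  note [simp] = hom_typed[OF x'(1)]
  have "SigA T (u \<cdot> x') = SigA T (Zero T S' (Cod T u))"
    using x'(2) comp_reduce[OF ux, of k] by simp
  then have "u \<cdot> x' = Zero T S' (Cod T u)"
    by (intro sus_faithful[of "u \<cdot> x'" "Zero T S' (Cod T u)"]) (simp_all del: sus_comp)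
  then have "x' = Zero T S' (Dom T u)" using C_monoD[OF mono S' x'(1)] by blast
  then have xk: "x \<cdot> k = Zero T (SigO T S') (SigO T (Dom T u))" using x'(2) by simp
  have "x = x \<cdot> (k \<cdot> k')" using kk' by simp
  also have "\<dots> = Zero T S (SigO T (Dom T u))" by (simp add: comp_reduce[OF xk])
  finally show "x = Zero T S (Dom T (SigA T u))" by simp
qed

text \<open>In the long exact sequence, \<open>T(S, Cod w)\<close> lies between the cokernel of \<open>T(S, p)\<close> and the kernel of
  \<open>T(S, \<Sigma>p)\<close>; the latter is trivial by closure under desuspension.\<close>

lemma zero_cone:
  assumes t: "(p, w, d) \<in> Tri T" and surj: "\<And>S. S \<in> C \<Longrightarrow> hom_surj T S p" and mono: "C_mono p"
  shows "is_zero_ob T (Cod T w)"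
proof -
  note [simp] = triangle_typed[OF t]
  have "Hom T S (Cod T w) = {Zero T S (Cod T w)}" if S: "S \<in> C" for S
  proof -
    have "s = Zero T S (Cod T w)" if s: "s \<in> Hom T S (Cod T w)" for s
    proof -
      note [simp] = hom_typed[OF s]
      have "SigA T p \<cdot> (d \<cdot> s) = Zero T S (SigO T (Cod T p))"
        by (simp add: comp_reduce[OF consecutive_zero'(2)[OF t]])
      then have "d \<cdot> s = Zero T S (SigO T (Dom T p))"
        using C_monoD[OF C_mono_sus[OF _ mono] S, of "d \<cdot> s"] by (simp add: Hom_iff)
      then obtain t' where t': "t' \<in> Hom T S (Cod T p)" "w \<cdot> t' = s"
        using hom_exact[OF rotate[OF t], of s S] s by auto
      obtain t'' where t'': "t'' \<in> Hom T S (Dom T p)" "p \<cdot> t'' = t'"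
        using hom_surjE[OF surj[OF S] t'(1)] .
      then have "s = w \<cdot> (p \<cdot> t'')" using t' by simp
      also have "\<dots> = Zero T S (Cod T w)"
        using t''(1) by (simp add: Hom_iff comp_reduce[OF consecutive_zero[OF t]])
      finally show ?thesis .
    qed
    moreover have "Zero T S (Cod T w) \<in> Hom T S (Cod T w)" using S by (simp add: Hom_iff)
    ultimately show ?thesis by blast
  qed
  then show ?thesis using generating unfolding generates_def by simp
qed

end

section \<open>Homotopy colimits of towers with stable images\<close>

text \<open>Here \<open>f n\<close> is a relation killed by \<open>i n\<close>.  By the last two assumptions, every \<open>i (Suc n)\<close> restricts,
  on \<open>C\<close>, to an isomorphism from the image of \<open>i n\<close> onto the image of \<open>i (Suc n)\<close>: the first one and
  \<open>i \<cdot> f = 0\<close> give surjectivity, the second one gives injectivity.\<close>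

locale stable_tower = perfectly_generated T \<kappa> C
  for T :: "('o, 'm, 'z) tricat_scheme" (structure) and \<kappa> :: "'k rel" and C :: "'o set" +
  fixes X P :: "nat \<Rightarrow> 'o" and i f :: "nat \<Rightarrow> 'm"
  assumes i_hom: "i n \<in> Hom T (X n) (X (Suc n))"
    and f_hom: "f n \<in> Hom T (P n) (X n)"
    and i_f: "i n \<cdot> f n = Zero T (P n) (X (Suc n))"
    and split: "\<lbrakk>S \<in> C; x \<in> Hom T S (X (Suc n))\<rbrakk>
      \<Longrightarrow> \<exists>z \<in> Hom T S (X n). \<exists>y \<in> Hom T S (P (Suc n)). x = i n \<cdot> z \<oplus>\<oplus> f (Suc n) \<cdot> y"
    and stable: "\<lbrakk>S \<in> C; z \<in> Hom T S (X n);
        i (Suc n) \<cdot> (i n \<cdot> z) = Zero T S (X (Suc (Suc n)))\<rbrakk>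
      \<Longrightarrow> i n \<cdot> z = Zero T S (X (Suc n))"
begin

lemma i_typed [simp]: "i n \<in> Ar T" "Dom T (i n) = X n" "Cod T (i n) = X (Suc n)"
  using i_hom by (simp_all add: Hom_iff)

lemma f_typed [simp]: "f n \<in> Ar T" "Dom T (f n) = P n" "Cod T (f n) = X n"
  using f_hom by (simp_all add: Hom_iff)

lemma X_ob [simp]: "X n \<in> Ob T" and P_ob [simp]: "P n \<in> Ob T"
  using hom_ob[OF f_hom[of n]] by simp_all

primrec c :: "nat \<Rightarrow> 'm" where
  "c 0 = Idn T (X 0)"
| "c (Suc n) = i n \<cdot> c n"

lemma c_typed [simp]: "c n \<in> Ar T" "Dom T (c n) = X 0" "Cod T (c n) = X n"
  by (induction n) simp_all

text \<open>In \<open>x = i x' + f y\<close> the element \<open>x'\<close> can be split again; its \<open>f\<close>-part is killed by \<open>i\<close>.\<close>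

lemma split_from_start:
  assumes S: "S \<in> C" and x: "x \<in> Hom T S (X n)"
  shows "\<exists>z \<in> Hom T S (X 0). \<exists>y \<in> Hom T S (P n). x = c n \<cdot> z \<oplus>\<oplus> f n \<cdot> y"
  using x
proof (induction n arbitrary: x)
  case 0
  have [simp]: "S \<in> Ob T" using S by simp
  show ?case
    using 0 by (intro bexI[of _ x] bexI[of _ "Zero T S (P 0)"]) (simp_all add: Hom_iff)
next
  case (Suc n)
  obtain x' y where x': "x' \<in> Hom T S (X n)" and y: "y \<in> Hom T S (P (Suc n))"
    and x: "x = i n \<cdot> x' \<oplus>\<oplus> f (Suc n) \<cdot> y"
    using split[OF S Suc.prems] by (elim bexE)
  obtain z y' where z: "z \<in> Hom T S (X 0)" and y': "y' \<in> Hom T S (P n)"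
    and x'': "x' = c n \<cdot> z \<oplus>\<oplus> f n \<cdot> y'"
    using Suc.IH[OF x'] by (elim bexE)
  note [simp] = hom_typed[OF z] hom_typed[OF y']
  have "i n \<cdot> x' = c (Suc n) \<cdot> z"
    by (simp add: x'' comp_reduce[OF i_f])
  then have "x = c (Suc n) \<cdot> z \<oplus>\<oplus> f (Suc n) \<cdot> y" using x by simp
  then show ?case using z y by (intro bexI[of _ z] bexI[of _ y]) simp_all
qed

lemma kernel_at_start:
  assumes S: "S \<in> C" and x: "x \<in> Hom T S (X 0)" and zero: "c n \<cdot> x = Zero T S (X n)"
  shows "i 0 \<cdot> x = Zero T S (X 1)"
proof (cases n)
  note [simp] = hom_typed[OF x]
  case 0
  then have "x = Zero T S (X 0)" using zero by simp
  then show ?thesis by simp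
next
  note [simp] = hom_typed[OF x]
  have *: "c (Suc m) \<cdot> x = Zero T S (X (Suc m)) \<Longrightarrow> i 0 \<cdot> x = Zero T S (X 1)" for m
  proof (induction m)
    case 0
    then show ?case by simp
  next
    case (Suc m)
    have "i m \<cdot> (c m \<cdot> x) = Zero T S (X (Suc m))"
      by (rule stable[OF S]) (use Suc.prems in \<open>simp_all add: Hom_iff\<close>)
    then show ?case using Suc.IH by simp
  qed
  case (Suc m)
  then show ?thesis using * zero by simp
qed

end

text \<open>
  The homotopy colimit of the tower is the cone of \<open>1 - sh\<close> on the coproduct \<open>QX\<close> of the \<open>X n\<close>.  The
  coproducts \<open>Q0\<close> and \<open>Q1\<close> belong to the constant towers with values \<open>X 0\<close> and \<open>X 1\<close>, for which the
  shifts are \<open>sh0\<close> and \<open>sh1\<close>; they are related to \<open>QX\<close> by the maps of towers \<open>v\<close> and \<open>I\<close>.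
\<close>

locale telescope = stable_tower T \<kappa> C X P i f
  for T :: "('o, 'm, 'z) tricat_scheme" (structure) and \<kappa> :: "'k rel" and C :: "'o set"
    and X P :: "nat \<Rightarrow> 'o" and i f :: "nat \<Rightarrow> 'm" +
  fixes QX Q0 Q1 :: 'o and \<xi> \<eta> \<theta> :: "nat \<Rightarrow> 'm" and sh sh0 sh1 v I :: 'm
  assumes QX: "is_coproduct T UNIV X QX \<xi>"
    and Q0: "is_coproduct T UNIV (\<lambda>_. X 0) Q0 \<eta>"
    and Q1: "is_coproduct T UNIV (\<lambda>_. X 1) Q1 \<theta>"
    and sh_hom: "sh \<in> Hom T QX QX" and sh: "sh \<cdot> \<xi> n = \<xi> (Suc n) \<cdot> i n"
    and sh0_hom: "sh0 \<in> Hom T Q0 Q0" and sh0: "sh0 \<cdot> \<eta> n = \<eta> (Suc n)"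
    and sh1_hom: "sh1 \<in> Hom T Q1 Q1" and sh1: "sh1 \<cdot> \<theta> n = \<theta> (Suc n)"
    and v_hom: "v \<in> Hom T Q0 QX" and v: "v \<cdot> \<eta> n = \<xi> n \<cdot> c n"
    and I_hom: "I \<in> Hom T Q0 Q1" and I: "I \<cdot> \<eta> n = \<theta> n \<cdot> i 0"
begin

lemmas coproducts_typed [simp] = coproduct_typed[OF QX] coproduct_typed[OF Q0] coproduct_typed[OF Q1]

lemma maps_typed [simp]:
  "sh \<in> Ar T" "Dom T sh = QX" "Cod T sh = QX"
  "sh0 \<in> Ar T" "Dom T sh0 = Q0" "Cod T sh0 = Q0"
  "sh1 \<in> Ar T" "Dom T sh1 = Q1" "Cod T sh1 = Q1"
  "v \<in> Ar T" "Dom T v = Q0" "Cod T v = QX"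
  "I \<in> Ar T" "Dom T I = Q0" "Cod T I = Q1"
  using sh_hom sh0_hom sh1_hom v_hom I_hom by (simp_all add: Hom_iff)

lemmas reduce = sh sh0 sh1 v I comp_reduce[OF sh] comp_reduce[OF sh0] comp_reduce[OF sh1]
  comp_reduce[OF v] comp_reduce[OF I]

lemma sh_v: "sh \<cdot> v = v \<cdot> sh0"
  by (rule coproduct_ext[OF Q0, of _ QX]) (simp_all add: Hom_iff reduce)

lemma I_sh0: "I \<cdot> sh0 = sh1 \<cdot> I"
  by (rule coproduct_ext[OF Q0, of _ Q1]) (simp_all add: Hom_iff reduce)

text \<open>Since \<open>(c n, f n)\<close> maps \<open>X 0 \<oplus> P n\<close> onto \<open>X n\<close> on \<open>C\<close>, perfectness lifts \<open>s\<close> to the coproduct of these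
  sums.  The shift applies \<open>i n\<close>, which kills \<open>f n\<close>, so only the summands \<open>X 0\<close> survive.\<close>

lemma shift_image:
  assumes S: "S \<in> C" and s: "s \<in> Hom T S QX"
  obtains t where "t \<in> Hom T S Q0" "sh \<cdot> s = v \<cdot> (sh0 \<cdot> t)"
proof -
  note [simp] = hom_typed[OF s]
  let ?sum = "\<lambda>n. (case_bool (X 0) (P n) :: bool \<Rightarrow> 'o)"
  have "\<forall>n. \<exists>B. is_coproduct T UNIV (?sum n) (fst B) (snd B)"
    using ex_binary_coproduct[OF X_ob P_ob] by simp
  from choice[OF this] obtain B
    where B: "\<And>n. is_coproduct T UNIV (?sum n) (fst (B n)) (snd (B n))" by blast
  define b where "b n = fst (B n)" for n
  define l where "l n = snd (B n) True" for n
  define r where "r n = snd (B n) False" for n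
  have l [simp]: "l n \<in> Ar T" "Dom T (l n) = X 0" "Cod T (l n) = b n"
    and r [simp]: "r n \<in> Ar T" "Dom T (r n) = P n" "Cod T (r n) = b n"
    and b_ob [simp]: "b n \<in> Ob T" for n
    using coproduct_inj[OF B[of n], of True] coproduct_inj[OF B[of n], of False] coproduct_ob[OF B[of n]]
    by (simp_all add: Hom_iff l_def r_def b_def)
  have desc: "\<exists>h. h \<in> Hom T (b n) Y \<and> h \<cdot> l n = p \<and> h \<cdot> r n = q"
    if p: "p \<in> Hom T (X 0) Y" and q: "q \<in> Hom T (P n) Y" for n Y p q
  proof -
    have pq: "case_bool p q j \<in> Hom T (case_bool (X 0) (P n) j) Y" for j
      using p q by (cases j) simp_all
    show ?thesis
    proof (rule coproduct_desc[OF B[of n] hom_ob(2)[OF p] pq])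
      fix h assume "h \<in> Hom T (fst (B n)) Y" "\<And>j. j \<in> UNIV \<Longrightarrow> h \<cdot> snd (B n) j = case_bool p q j"
      then show ?thesis by (intro exI[of _ h]) (simp add: l_def r_def b_def)
    qed
  qed
  have ext: "h = h'" if "h \<in> Hom T (b n) Y" "h' \<in> Hom T (b n) Y"
    "h \<cdot> l n = h' \<cdot> l n" "h \<cdot> r n = h' \<cdot> r n" for n Y h h'
  proof (rule coproduct_ext[OF B[of n]])
    show "h \<cdot> snd (B n) j = h' \<cdot> snd (B n) j" for j
      using that(3,4) by (cases j) (simp_all add: l_def r_def)
  qed (use that(1,2) in \<open>simp_all add: b_def\<close>)
  have "\<forall>n. \<exists>u. u \<in> Hom T (b n) (X n) \<and> u \<cdot> l n = c n \<and> u \<cdot> r n = f n"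
    by (intro allI desc) (simp_all add: Hom_iff)
  from choice[OF this] obtain u where u: "\<And>n. u n \<in> Hom T (b n) (X n)"
    and ul: "\<And>n. u n \<cdot> l n = c n" and ur: "\<And>n. u n \<cdot> r n = f n" by blast
  have "\<forall>n. \<exists>\<pi>. \<pi> \<in> Hom T (b n) (X 0) \<and> \<pi> \<cdot> l n = Idn T (X 0) \<and> \<pi> \<cdot> r n = Zero T (P n) (X 0)"
    by (intro allI desc) (simp_all add: Hom_iff)
  from choice[OF this] obtain \<pi> where \<pi>: "\<And>n. \<pi> n \<in> Hom T (b n) (X 0)"
    and \<pi>l: "\<And>n. \<pi> n \<cdot> l n = Idn T (X 0)" and \<pi>r: "\<And>n. \<pi> n \<cdot> r n = Zero T (P n) (X 0)" by blast
  note [simp] = hom_typed[OF u] hom_typed[OF \<pi>]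
  \<comment> \<open>Both sides are determined by the two injections; on \<open>P n\<close> they vanish.\<close>
  have iu: "i n \<cdot> u n = c (Suc n) \<cdot> \<pi> n" for n
    by (rule ext[of _ n "X (Suc n)"]) (simp_all add: Hom_iff ul ur \<pi>l \<pi>r i_f)
  obtain QB \<beta> where QB: "is_coproduct T UNIV b QB \<beta>"
    using countable_coproduct[of b] by auto
  note [simp] = coproduct_typed[OF QB]
  obtain U where U: "U \<in> Hom T QB QX" and U\<beta>: "\<And>n. U \<cdot> \<beta> n = \<xi> n \<cdot> u n"
    using coproduct_ar_exists[OF QB QX, of u] u by auto
  obtain proj where proj: "proj \<in> Hom T QB Q0" and proj_\<beta>: "\<And>n. proj \<cdot> \<beta> n = \<eta> n \<cdot> \<pi> n"
    using coproduct_ar_exists[OF QB Q0, of \<pi>] \<pi> by auto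
  note [simp] = hom_typed[OF U] hom_typed[OF proj]
  have "hom_surj T S' (u n)" if S': "S' \<in> C" for S' n
  proof (rule hom_surjI)
    fix x assume "x \<in> Hom T S' (Cod T (u n))"
    then obtain z y where z: "z \<in> Hom T S' (X 0)" and y: "y \<in> Hom T S' (P n)"
      and x: "x = c n \<cdot> z \<oplus>\<oplus> f n \<cdot> y"
      using split_from_start[OF S', of x n] by auto
    have "u n \<cdot> (l n \<cdot> z \<oplus>\<oplus> r n \<cdot> y) = x" "l n \<cdot> z \<oplus>\<oplus> r n \<cdot> y \<in> Hom T S' (b n)"
      using z y by (simp_all add: Hom_iff x comp_reduce[OF ul] comp_reduce[OF ur])
    then show "\<exists>x'\<in>Hom T S' (Dom T (u n)). u n \<cdot> x' = x"
      by (intro bexI[of _ "l n \<cdot> z \<oplus>\<oplus> r n \<cdot> y"]) simp_all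
  qed simp
  then have "hom_surj T S U" by (intro perfect_countable[OF QB QX u U U\<beta> _ S])
  then obtain t where t: "t \<in> Hom T S QB" "U \<cdot> t = s"
    using s by (elim hom_surjE) auto
  note [simp] = hom_typed[OF t(1)]
  have shU: "sh \<cdot> U = v \<cdot> (sh0 \<cdot> proj)"
    by (rule coproduct_ext[OF QB, of _ QX])
      (simp_all add: Hom_iff U\<beta> proj_\<beta> reduce iu)
  have "sh \<cdot> s = v \<cdot> (sh0 \<cdot> (proj \<cdot> t))"
    unfolding t(2)[symmetric] by (simp add: comp_reduce[OF shU])
  moreover have "proj \<cdot> t \<in> Hom T S Q0" by (simp add: Hom_iff)
  ultimately show thesis using that by blast
qed

text \<open>The equation says that \<open>(1 - sh) s = \<xi> 0 x\<close>.  Apply \<open>sh\<close> and write \<open>sh s = v y\<close> to get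
  \<open>v y = v (\<eta> 1 x + sh0 y)\<close>.  On \<open>C\<close>, the \<open>c n\<close> identify no more than \<open>i 0\<close> does, so \<open>v\<close> may be replaced
  by \<open>I\<close>, and the equation lives in the constant tower \<open>X 1\<close>.  There the codiagonal gives the first
  claim.  If \<open>x = 0\<close>, a retraction of \<open>1 - sh1\<close> gives \<open>I y = 0\<close>, and \<open>s = sh s\<close> factors through \<open>I y\<close>.\<close>

lemma shift_equation:
  assumes S: "S \<in> C" and x: "x \<in> Hom T S (X 0)" and s: "s \<in> Hom T S QX"
    and eq: "s = \<xi> 0 \<cdot> x \<oplus>\<oplus> sh \<cdot> s"
  shows "i 0 \<cdot> x = Zero T S (X 1)"
    and "x = Zero T S (X 0) \<Longrightarrow> s = Zero T S QX"
proof -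
  note [simp] = hom_typed[OF x] hom_typed[OF s]
  obtain t where t: "t \<in> Hom T S Q0" and sh_s: "sh \<cdot> s = v \<cdot> (sh0 \<cdot> t)"
    by (rule shift_image[OF S s])
  note [simp] = hom_typed[OF t]
  define y where "y = sh0 \<cdot> t"
  have [simp]: "y \<in> Ar T" "Dom T y = S" "Cod T y = Q0" by (simp_all add: y_def)
  have sh_s': "sh \<cdot> s = v \<cdot> y" using sh_s by (simp add: y_def)
  have "v \<cdot> y = sh \<cdot> (\<xi> 0 \<cdot> x \<oplus>\<oplus> sh \<cdot> s)" using eq sh_s' by simp
  also have "\<dots> = \<xi> 1 \<cdot> i 0 \<cdot> x \<oplus>\<oplus> sh \<cdot> (v \<cdot> y)"
    unfolding sh_s' by (simp add: reduce)
  also have "\<dots> = v \<cdot> (\<eta> 1 \<cdot> x \<oplus>\<oplus> sh0 \<cdot> y)"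
    by (simp add: reduce comp_reduce[OF sh_v])
  finally have "I \<cdot> y = I \<cdot> (\<eta> 1 \<cdot> x \<oplus>\<oplus> sh0 \<cdot> y)"
    using kernel_at_start
    by (intro coproduct_identification[OF Q0 QX Q1, of c "\<lambda>_. i 0" v I S])
      (simp_all add: Hom_iff v I S)
  then have Iy: "I \<cdot> y = \<theta> 1 \<cdot> i 0 \<cdot> x \<oplus>\<oplus> sh1 \<cdot> I \<cdot> y"
    by (simp add: reduce comp_reduce[OF I_sh0])
  obtain codiag where codiag: "codiag \<in> Hom T Q1 (X 1)" and codiag_\<theta>: "\<And>n. codiag \<cdot> \<theta> n = Idn T (X 1)"
    using coproduct_desc[OF Q1, of "X 1" "\<lambda>_. Idn T (X 1)"] by (auto simp: Hom_iff)
  note [simp] = hom_typed[OF codiag]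
  have codiag_sh: "codiag \<cdot> sh1 = codiag"
    by (rule coproduct_ext[OF Q1, of _ "X 1"]) (simp_all add: Hom_iff reduce codiag_\<theta>)
  have "codiag \<cdot> I \<cdot> y = codiag \<cdot> (\<theta> 1 \<cdot> i 0 \<cdot> x \<oplus>\<oplus> sh1 \<cdot> I \<cdot> y)" using Iy by simp
  then have "Zero T S (X 1) \<oplus>\<oplus> codiag \<cdot> I \<cdot> y = i 0 \<cdot> x \<oplus>\<oplus> codiag \<cdot> I \<cdot> y"
    by (simp add: comp_reduce[OF codiag_\<theta>] comp_reduce[OF codiag_sh])
  then show "i 0 \<cdot> x = Zero T S (X 1)"
    by (intro plus_cancel_right[of "i 0 \<cdot> x" "codiag \<cdot> I \<cdot> y" "Zero T S (X 1)"]) simp_all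
  assume x0: "x = Zero T S (X 0)"
  \<comment> \<open>As \<open>w n = \<theta> 0 + \<dots> + \<theta> (n - 1)\<close>, the map \<open>r\<close> satisfies \<open>r \<cdot> sh1 - r = 1\<close>: it is, up to
    sign, a retraction of \<open>1 - sh1\<close>.\<close>
  define w where "w = rec_nat (Zero T (X 1) Q1) (\<lambda>n e. e \<oplus>\<oplus> \<theta> n)"
  have w: "w 0 = Zero T (X 1) Q1" "w (Suc n) = w n \<oplus>\<oplus> \<theta> n" for n by (simp_all add: w_def)
  have w_typed [simp]: "w n \<in> Ar T" "Dom T (w n) = X 1" "Cod T (w n) = Q1" for n
    by (induction n) (simp_all add: w)
  obtain r where r: "r \<in> Hom T Q1 Q1" and r\<theta>: "\<And>n. r \<cdot> \<theta> n = w n"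
    using coproduct_desc[OF Q1, of Q1 w] by (auto simp: Hom_iff)
  note [simp] = hom_typed[OF r]
  have rsh: "r \<cdot> sh1 = r \<oplus>\<oplus> Idn T Q1"
    by (rule coproduct_ext[OF Q1, of _ Q1]) (simp_all add: Hom_iff reduce r\<theta> w)
  have Iy': "I \<cdot> y = sh1 \<cdot> I \<cdot> y" using Iy x0 by simp
  then have "r \<cdot> I \<cdot> y = r \<cdot> sh1 \<cdot> I \<cdot> y" by simp
  also have "\<dots> = I \<cdot> y \<oplus>\<oplus> r \<cdot> I \<cdot> y" by (simp add: comp_reduce[OF rsh] plus_commute)
  finally have "I \<cdot> y = Zero T S Q1"
    by (intro plus_cancel_right[of "I \<cdot> y" "r \<cdot> I \<cdot> y" "Zero T S Q1"]) simp_all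
  then have Ish: "I \<cdot> sh0 \<cdot> t = Zero T S Q1" by (simp add: y_def)
  \<comment> \<open>For \<open>n > 0\<close>, \<open>c' n\<close> is the composite \<open>X 1 \<rightarrow> X n\<close>.  The image of \<open>sh0\<close> avoids the summand of
    index \<open>0\<close>, where zero is chosen.\<close>
  define c' where "c' = rec_nat (Zero T (X 1) (X 0)) (\<lambda>n e. if n = 0 then Idn T (X 1) else i n \<cdot> e)"
  have c'_typed [simp]: "c' n \<in> Ar T" "Dom T (c' n) = X 1" "Cod T (c' n) = X n" for n
    by (induction n) (simp_all add: c'_def)
  have c'_Suc: "c' (Suc 0) = Idn T (X 1)" "c' (Suc (Suc n)) = i (Suc n) \<cdot> c' (Suc n)" for n
    by (simp_all add: c'_def)
  have c': "c' (Suc n) \<cdot> i 0 = c (Suc n)" for n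
    by (induction n) (simp_all add: c'_Suc)
  obtain v' where v': "v' \<in> Hom T Q1 QX" and v'\<theta>: "\<And>n. v' \<cdot> \<theta> n = \<xi> n \<cdot> c' n"
    using coproduct_ar_exists[OF Q1 QX, of c'] by (auto simp: Hom_iff)
  note [simp] = hom_typed[OF v']
  have v'I: "v' \<cdot> I \<cdot> sh0 = v \<cdot> sh0"
    by (rule coproduct_ext[OF Q0, of _ QX])
      (simp_all add: Hom_iff reduce comp_reduce[OF v'\<theta>] c' del: c.simps)
  have "s = v \<cdot> sh0 \<cdot> t" using eq x0 sh_s by simp
  also have "\<dots> = (v' \<cdot> I \<cdot> sh0) \<cdot> t" unfolding v'I by simp
  also have "\<dots> = v' \<cdot> I \<cdot> sh0 \<cdot> t" by simp
  also have "\<dots> = Zero T S QX" by (simp add: Ish)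
  finally show "s = Zero T S QX" .
qed

end

context stable_tower
begin

text \<open>The object \<open>H\<close> is the cone of \<open>1 - sh\<close>.  By \<open>shift_equation\<close>, \<open>1 - sh\<close> is injective on \<open>C\<close>; therefore
  every morphism \<open>S \<rightarrow> H\<close> lifts to the coproduct of the \<open>X n\<close>, where it may be shifted and, by
  \<open>shift_image\<close>, moved to \<open>X 0\<close>.\<close>

lemma homotopy_colimit:
  obtains H j where "H \<in> Ob T" "\<And>n. j n \<in> Hom T (X n) H" "\<And>n. j (Suc n) \<cdot> i n = j n"
    "\<And>S. S \<in> C \<Longrightarrow> hom_surj T S (j 0)"
    "\<forall>S\<in>C. \<forall>x\<in>Hom T S (X 0). j 0 \<cdot> x = Zero T S H \<longrightarrow> i 0 \<cdot> x = Zero T S (X 1)"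
    "\<forall>V u. (\<forall>n. u n \<in> Hom T (X n) V) \<longrightarrow> (\<forall>n. u (Suc n) \<cdot> i n = u n) \<longrightarrow>
      (\<exists>k \<in> Hom T H V. \<forall>n. k \<cdot> j n = u n)"
proof -
  obtain QX \<xi> where QX: "is_coproduct T UNIV X QX \<xi>"
    using countable_coproduct[of X] by auto
  obtain Q0 \<eta> where Q0: "is_coproduct T (UNIV :: nat set) (\<lambda>_. X 0) Q0 \<eta>"
    using countable_coproduct[of "\<lambda>_. X 0"] by auto
  obtain Q1 \<theta> where Q1: "is_coproduct T (UNIV :: nat set) (\<lambda>_. X 1) Q1 \<theta>"
    using countable_coproduct[of "\<lambda>_. X 1"] by auto
  note [simp] = coproduct_typed[OF QX] coproduct_typed[OF Q0] coproduct_typed[OF Q1]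
  obtain sh where sh: "sh \<in> Hom T QX QX" "\<And>n. sh \<cdot> \<xi> n = \<xi> (Suc n) \<cdot> i n"
    using coproduct_desc[OF QX, of QX "\<lambda>n. \<xi> (Suc n) \<cdot> i n"] by (auto simp: Hom_iff)
  obtain sh0 where sh0: "sh0 \<in> Hom T Q0 Q0" "\<And>n. sh0 \<cdot> \<eta> n = \<eta> (Suc n)"
    using coproduct_desc[OF Q0, of Q0 "\<lambda>n. \<eta> (Suc n)"] by (auto simp: Hom_iff)
  obtain sh1 where sh1: "sh1 \<in> Hom T Q1 Q1" "\<And>n. sh1 \<cdot> \<theta> n = \<theta> (Suc n)"
    using coproduct_desc[OF Q1, of Q1 "\<lambda>n. \<theta> (Suc n)"] by (auto simp: Hom_iff)
  obtain v where v: "v \<in> Hom T Q0 QX" "\<And>n. v \<cdot> \<eta> n = \<xi> n \<cdot> c n"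
    using coproduct_desc[OF Q0, of QX "\<lambda>n. \<xi> n \<cdot> c n"] by (auto simp: Hom_iff)
  obtain I where I: "I \<in> Hom T Q0 Q1" "\<And>n. I \<cdot> \<eta> n = \<theta> n \<cdot> i 0"
    using coproduct_desc[OF Q0, of Q1 "\<lambda>n. \<theta> n \<cdot> i 0"] by (auto simp: Hom_iff)
  interpret telescope T \<kappa> C X P i f QX Q0 Q1 \<xi> \<eta> \<theta> sh sh0 sh1 v I
    by (unfold_locales) (fact QX Q0 Q1 sh sh0 sh1 v I)+
  define \<Phi> where "\<Phi> = Idn T QX \<oplus>\<oplus> neg T sh"
  have [simp]: "\<Phi> \<in> Ar T" "Dom T \<Phi> = QX" "Cod T \<Phi> = QX" by (simp_all add: \<Phi>_def)
  have \<Phi>_plus: "s = \<Phi> \<cdot> s \<oplus>\<oplus> sh \<cdot> s" if "s \<in> Hom T S QX" for s S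
  proof -
    have [simp]: "s \<in> Ar T" "Dom T s = S" "Cod T s = QX" using that by (simp_all add: Hom_iff)
    show ?thesis by (simp add: \<Phi>_def plus_assoc)
  qed
  obtain g h where t: "(\<Phi>, g, h) \<in> Tri T" using TR1_cone[of \<Phi>] by auto
  note [simp] = triangle_typed[OF t]
  let ?H = "Cod T g"
  define j where "j n = g \<cdot> \<xi> n" for n
  have [simp]: "j n \<in> Ar T" "Dom T (j n) = X n" "Cod T (j n) = ?H" for n by (simp_all add: j_def)
  have "g \<oplus>\<oplus> neg T (g \<cdot> sh) = Zero T QX ?H"
    using consecutive_zero[OF t] by (simp add: \<Phi>_def)
  then have g_sh: "g \<cdot> sh = g" using minus_zero_iff[of g "g \<cdot> sh"] by simp
  have j_i: "j (Suc n) \<cdot> i n = j n" for n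
  proof -
    have "g \<cdot> (sh \<cdot> \<xi> n) = g \<cdot> \<xi> n" by (simp add: comp_reduce[OF g_sh] del: sh)
    then show ?thesis by (simp add: j_def sh)
  qed
  have j_c: "j n \<cdot> c n = j 0" for n
    by (induction n) (simp_all add: comp_reduce[OF j_i])
  have mono: "C_mono \<Phi>"
    unfolding C_mono_def
  proof (intro ballI impI)
    fix S s assume S: "S \<in> C" and "s \<in> Hom T S (Dom T \<Phi>)" and zero: "\<Phi> \<cdot> s = Zero T S (Cod T \<Phi>)"
    then have s: "s \<in> Hom T S QX" by simp
    note [simp] = hom_typed[OF s]
    have "s = \<xi> 0 \<cdot> Zero T S (X 0) \<oplus>\<oplus> sh \<cdot> s" using \<Phi>_plus[OF s] zero by simp
    then have "s = Zero T S QX" by (intro shift_equation(2)[OF S _ s]) (simp_all add: Hom_iff)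
    then show "s = Zero T S (Dom T \<Phi>)" by simp
  qed
  have surj: "hom_surj T S (j 0)" if S: "S \<in> C" for S
  proof (rule hom_surjI)
    fix y assume "y \<in> Hom T S (Cod T (j 0))"
    then have y: "y \<in> Hom T S ?H" by simp
    note [simp] = hom_typed[OF y]
    have "SigA T \<Phi> \<cdot> (h \<cdot> y) = Zero T S (SigO T QX)"
      by (simp add: comp_reduce[OF consecutive_zero'(2)[OF t]])
    then have "h \<cdot> y = Zero T S (SigO T QX)"
      using C_monoD[OF C_mono_sus[OF _ mono] S, of "h \<cdot> y"] by (simp add: Hom_iff)
    then obtain s where s: "s \<in> Hom T S QX" "g \<cdot> s = y"
      using hom_exact[OF rotate[OF t], of y S] y by auto
    note [simp] = hom_typed[OF s(1)]
    obtain t' where t': "t' \<in> Hom T S Q0" "sh \<cdot> s = v \<cdot> (sh0 \<cdot> t')"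
      by (rule shift_image[OF S s(1)])
    note [simp] = hom_typed[OF t'(1)]
    obtain codiag where codiag: "codiag \<in> Hom T Q0 (X 0)" "\<And>n. codiag \<cdot> \<eta> n = Idn T (X 0)"
      using coproduct_desc[OF Q0, of "X 0" "\<lambda>_. Idn T (X 0)"] by (auto simp: Hom_iff)
    note [simp] = hom_typed[OF codiag(1)]
    have gv: "g \<cdot> v = j 0 \<cdot> codiag"
    proof (rule coproduct_ext[OF Q0, of _ ?H])
      fix n
      have "g \<cdot> \<xi> n \<cdot> c n = j 0" using j_c[of n] by (simp add: j_def)
      then show "(g \<cdot> v) \<cdot> \<eta> n = (j 0 \<cdot> codiag) \<cdot> \<eta> n" by (simp add: v codiag(2))
    qed (simp_all add: Hom_iff)
    have "y = g \<cdot> (sh \<cdot> s)" using s(2) by (simp add: comp_reduce[OF g_sh])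
    also have "\<dots> = j 0 \<cdot> (codiag \<cdot> (sh0 \<cdot> t'))" by (simp add: t'(2) comp_reduce[OF gv])
    finally show "\<exists>x\<in>Hom T S (Dom T (j 0)). j 0 \<cdot> x = y"
      by (intro bexI[of _ "codiag \<cdot> (sh0 \<cdot> t')"]) (simp_all add: Hom_iff)
  qed simp
  have ker: "i 0 \<cdot> x = Zero T S (X 1)"
    if S: "S \<in> C" and x: "x \<in> Hom T S (X 0)" and zero: "j 0 \<cdot> x = Zero T S ?H" for S x
  proof -
    note [simp] = hom_typed[OF x]
    have "g \<cdot> (\<xi> 0 \<cdot> x) = Zero T S ?H" using zero by (simp add: j_def)
    then obtain s where s: "s \<in> Hom T S QX" "\<Phi> \<cdot> s = \<xi> 0 \<cdot> x"
      using hom_exact[OF t, of "\<xi> 0 \<cdot> x" S] by (auto simp: Hom_iff)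
    then show ?thesis using shift_equation(1)[OF S x s(1)] \<Phi>_plus[OF s(1)] by simp
  qed
  have univ: "\<exists>k \<in> Hom T ?H V. \<forall>n. k \<cdot> j n = u n"
    if u: "\<And>n. u n \<in> Hom T (X n) V" and u_i: "\<And>n. u (Suc n) \<cdot> i n = u n" for V u
  proof -
    note [simp] = hom_typed[OF u]
    obtain U where U: "U \<in> Hom T QX V" "\<And>n. U \<cdot> \<xi> n = u n"
      using coproduct_desc[OF QX, of V u] u by auto
    note [simp] = hom_typed[OF U(1)]
    have "U \<cdot> sh = U"
      by (rule coproduct_ext[OF QX, of _ V])
        (simp_all add: Hom_iff sh U(2) comp_reduce[OF U(2)] u_i)
    then have "U \<cdot> \<Phi> = Zero T QX V" by (simp add: \<Phi>_def)
    then obtain k where k: "k \<in> Hom T ?H V" "k \<cdot> g = U"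
      using cohom_exact[OF t, of U V] U(1) by auto
    note [simp] = hom_typed[OF k(1)]
    have "k \<cdot> j n = u n" for n by (simp add: j_def comp_reduce[OF k(2)] U(2))
    then show ?thesis using k(1) by (intro bexI[of _ k]) simp_all
  qed
  show thesis
  proof (rule that)
    show "?H \<in> Ob T" by simp
    show "j n \<in> Hom T (X n) ?H" for n by (simp add: Hom_iff)
    show "\<forall>S\<in>C. \<forall>x\<in>Hom T S (X 0). j 0 \<cdot> x = Zero T S ?H \<longrightarrow> i 0 \<cdot> x = Zero T S (X 1)"
      by (intro ballI impI) (rule ker)
    show "\<forall>V u. (\<forall>n. u n \<in> Hom T (X n) V) \<longrightarrow> (\<forall>n. u (Suc n) \<cdot> i n = u n) \<longrightarrow>
        (\<exists>k \<in> Hom T ?H V. \<forall>n. k \<cdot> j n = u n)"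
      by (intro allI impI univ) simp_all
  qed (fact j_i surj)+
qed

text \<open>The hypotheses on \<open>p\<close> say that \<open>Y\<close> and the homotopy colimit \<open>H\<close> agree on \<open>C\<close>: both are quotients
  of \<open>T(S, X 0)\<close> by the kernel of \<open>i 0\<close>.  So the comparison \<open>H \<rightarrow> Y\<close> has a zero cone, and cocones,
  which extend over \<open>H\<close>, extend over \<open>Y\<close>.\<close>

lemma extend_cocone:
  assumes p: "\<And>n. p n \<in> Hom T (X n) Y" "\<And>n. p (Suc n) \<cdot> i n = p n"
    and surj: "\<And>S. S \<in> C \<Longrightarrow> hom_surj T S (p 0)"
    and ker: "\<And>S x. \<lbrakk>S \<in> C; x \<in> Hom T S (X 0); p 0 \<cdot> x = Zero T S Y\<rbrakk> \<Longrightarrow> i 0 \<cdot> x = Zero T S (X 1)"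
    and u: "\<And>n. u n \<in> Hom T (X n) V" "\<And>n. u (Suc n) \<cdot> i n = u n"
  obtains k where "k \<in> Hom T Y V" "\<And>n. k \<cdot> p n = u n"
proof -
  note [simp] = hom_typed[OF p(1)]
  show thesis
  proof (rule homotopy_colimit)
    fix H j
    assume H [simp]: "H \<in> Ob T" and j: "\<And>n. j n \<in> Hom T (X n) H" and j_i: "\<And>n. j (Suc n) \<cdot> i n = j n"
    and j_surj: "\<And>S. S \<in> C \<Longrightarrow> hom_surj T S (j 0)"
    and "\<forall>S\<in>C. \<forall>x\<in>Hom T S (X 0). j 0 \<cdot> x = Zero T S H \<longrightarrow> i 0 \<cdot> x = Zero T S (X 1)"
    and univ: "\<forall>V u. (\<forall>n. u n \<in> Hom T (X n) V) \<longrightarrow> (\<forall>n. u (Suc n) \<cdot> i n = u n) \<longrightarrow>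
      (\<exists>k \<in> Hom T H V. \<forall>n. k \<cdot> j n = u n)"
  note [simp] = hom_typed[OF j]
  obtain q where q: "q \<in> Hom T H Y" "\<And>n. q \<cdot> j n = p n"
    using univ[rule_format, of p Y] p by blast
  obtain u' where u': "u' \<in> Hom T H V" "\<And>n. u' \<cdot> j n = u n"
    using univ[rule_format, of u V] u by blast
  note [simp] = hom_typed[OF q(1)]
  have q_surj: "hom_surj T S q" if S: "S \<in> C" for S
  proof (rule hom_surjI)
    fix y assume "y \<in> Hom T S (Cod T q)"
    then obtain x where x: "x \<in> Hom T S (X 0)" "p 0 \<cdot> x = y"
      using hom_surjE[OF surj[OF S], of y] by auto
    have "q \<cdot> (j 0 \<cdot> x) = y" using x by (simp add: Hom_iff comp_reduce[OF q(2)])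
    then show "\<exists>x\<in>Hom T S (Dom T q). q \<cdot> x = y"
      using x(1) by (intro bexI[of _ "j 0 \<cdot> x"]) (simp_all add: Hom_iff)
  qed simp
  have q_mono: "C_mono q"
    unfolding C_mono_def
  proof (intro ballI impI)
    fix S y assume S: "S \<in> C" and y: "y \<in> Hom T S (Dom T q)" and zero: "q \<cdot> y = Zero T S (Cod T q)"
    obtain x where x: "x \<in> Hom T S (X 0)" "j 0 \<cdot> x = y"
      using hom_surjE[OF j_surj[OF S], of y] y by auto
    note [simp] = hom_typed[OF x(1)]
    have "p 0 \<cdot> x = Zero T S Y" using zero x(2) by (simp add: comp_reduce[OF q(2), symmetric])
    from ker[OF S x(1) this] have "j 1 \<cdot> (i 0 \<cdot> x) = Zero T S H" by simp
    then have "j 0 \<cdot> x = Zero T S H" by (simp add: comp_reduce[OF j_i])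
    then show "y = Zero T S (Dom T q)" using x(2) by simp
  qed
  obtain w d where t: "(q, w, d) \<in> Tri T" using TR1_cone[of q] by auto
  obtain k where k: "k \<in> Hom T Y V" "k \<cdot> q = u'"
    using extend_along_zero_cone[OF t zero_cone[OF t q_surj q_mono], of u' V] u'(1) by auto
  have "k \<cdot> p n = u n" for n
    using k by (simp add: Hom_iff q(2)[symmetric] comp_reduce[OF k(2)] u'(2))
  then show thesis using that k(1) by blast
  qed
qed

end

section \<open>Exact Postnikov towers\<close>

lemma (in triangulated) postnikov_tower_typed:
  assumes "postnikov_tower \<kappa> T C A"
  shows "tf A n \<in> Ar T" "Dom T (tf A n) = tP A n" "Cod T (tf A n) = prevO T A n"
    "ti A n \<in> Ar T" "Dom T (ti A n) = prevO T A n" "Cod T (ti A n) = tX A n"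
    "tq A n \<in> Ar T" "Dom T (tq A n) = tX A n" "Cod T (tq A n) = SigO T (tP A n)"
  using assms by (simp_all add: postnikov_tower_def Hom_iff)

locale exact_tower = perfectly_generated T \<kappa> C
  for T :: "('o, 'm, 'z) tricat_scheme" (structure) and \<kappa> :: "'k rel" and C :: "'o set" +
  fixes A :: "('o, 'm, 'y) postnikov_scheme"
  assumes tower: "postnikov_tower \<kappa> T C A"
    and exact: "\<lbrakk>S \<in> C; z \<in> Hom T S (SigO T (tP A (Suc n)));
        SigA T (differential T A n) \<cdot> z = Zero T S (SigO T (SigO T (tP A n)))\<rbrakk>
      \<Longrightarrow> \<exists>y \<in> Hom T S (tP A (Suc (Suc n))). differential T A (Suc n) \<cdot> y = z"
begin

lemma prevO_simps [simp]: "prevO T A 0 = zero_ob T" "prevO T A (Suc n) = tX A n"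
  by (simp_all add: prevO_def)

lemma triangle: "(tf A n, ti A n, tq A n) \<in> Tri T"
  using tower by (simp add: postnikov_tower_def)

lemmas tower_typed [simp] = postnikov_tower_typed[OF tower]

lemma tower_ob [simp]: "tP A n \<in> Ob T" "tX A n \<in> Ob T"
  using dom_ob[OF tower_typed(1)[of n]] dom_ob[OF tower_typed(7)[of n]] by simp_all

lemma ti_tf: "ti A (Suc n) \<cdot> tf A (Suc n) = Zero T (tP A (Suc n)) (tX A (Suc n))"
  using consecutive_zero[OF triangle[of "Suc n"]] by simp

lemma tq_ti: "tq A (Suc n) \<cdot> ti A (Suc n) = Zero T (tX A n) (SigO T (tP A (Suc n)))"
  using consecutive_zero'(1)[OF triangle[of "Suc n"]] by simp

lemma stf_tq: "SigA T (tf A (Suc n)) \<cdot> tq A (Suc n) = Zero T (tX A (Suc n)) (SigO T (tX A n))"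
  using consecutive_zero'(2)[OF triangle[of "Suc n"]] by simp

text \<open>For the splitting, \<open>q x\<close> is a cycle, hence a boundary \<open>q (f y)\<close>, and \<open>x - f y\<close> comes from the
  previous stage.  For stability, \<open>i (i z) = 0\<close> gives \<open>i z = f y\<close>, where \<open>y\<close> is a cycle because
  \<open>q \<cdot> i = 0\<close>; after a suspension \<open>y\<close> is a boundary \<open>q (f w)\<close>, and \<open>\<Sigma>f \<cdot> q = 0\<close>.\<close>

sublocale stable_tower T \<kappa> C "tX A" "\<lambda>n. tP A (Suc n)" "\<lambda>n. ti A (Suc n)" "\<lambda>n. tf A (Suc n)"
proof
  show "ti A (Suc n) \<in> Hom T (tX A n) (tX A (Suc n))" for n by (simp add: Hom_iff)
  show "tf A (Suc n) \<in> Hom T (tP A (Suc n)) (tX A n)" for n by (simp add: Hom_iff)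
  show "ti A (Suc n) \<cdot> tf A (Suc n) = Zero T (tP A (Suc n)) (tX A (Suc n))" for n by (rule ti_tf)
  show "\<exists>z\<in>Hom T S (tX A n). \<exists>y\<in>Hom T S (tP A (Suc (Suc n))).
      x = ti A (Suc n) \<cdot> z \<oplus>\<oplus> tf A (Suc (Suc n)) \<cdot> y"
    if S: "S \<in> C" and x: "x \<in> Hom T S (tX A (Suc n))" for S x n
  proof -
    note [simp] = hom_typed[OF x]
    have "SigA T (differential T A n) \<cdot> (tq A (Suc n) \<cdot> x) = Zero T S (SigO T (SigO T (tP A n)))"
      by (simp add: differential_def comp_reduce[OF stf_tq])
    then obtain y where y: "y \<in> Hom T S (tP A (Suc (Suc n)))"
      "differential T A (Suc n) \<cdot> y = tq A (Suc n) \<cdot> x"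
      using exact[OF S, of "tq A (Suc n) \<cdot> x" n] by (auto simp: Hom_iff)
    note [simp] = hom_typed[OF y(1)]
    let ?fy = "tf A (Suc (Suc n)) \<cdot> y"
    have "tq A (Suc n) \<cdot> ?fy = tq A (Suc n) \<cdot> x" using y(2) by (simp add: differential_def)
    then have "tq A (Suc n) \<cdot> (x \<oplus>\<oplus> neg T ?fy) = Zero T S (SigO T (tP A (Suc n)))" by simp
    then obtain z where z: "z \<in> Hom T S (tX A n)" "ti A (Suc n) \<cdot> z = x \<oplus>\<oplus> neg T ?fy"
      using hom_exact[OF rotate[OF triangle[of "Suc n"]], of "x \<oplus>\<oplus> neg T ?fy" S]
      by (auto simp: Hom_iff)
    have "x = ti A (Suc n) \<cdot> z \<oplus>\<oplus> ?fy" unfolding z(2) by (simp add: plus_assoc)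
    then show ?thesis using y(1) z(1) by blast
  qed
  show "ti A (Suc n) \<cdot> z = Zero T S (tX A (Suc n))"
    if S: "S \<in> C" and z: "z \<in> Hom T S (tX A n)"
      and zero: "ti A (Suc (Suc n)) \<cdot> (ti A (Suc n) \<cdot> z) = Zero T S (tX A (Suc (Suc n)))" for S z n
  proof -
    note [simp] = hom_typed[OF z]
    obtain y where y: "y \<in> Hom T S (tP A (Suc (Suc n)))" "tf A (Suc (Suc n)) \<cdot> y = ti A (Suc n) \<cdot> z"
      using hom_exact[OF triangle[of "Suc (Suc n)"], of "ti A (Suc n) \<cdot> z" S] zero
      by (auto simp: Hom_iff)
    note [simp] = hom_typed[OF y(1)]
    have dy: "differential T A (Suc n) \<cdot> y = Zero T S (SigO T (tP A (Suc n)))"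
      by (simp add: differential_def y(2) comp_reduce[OF tq_ti])
    \<comment> \<open>Exactness is known for elements of \<open>\<Sigma>P\<close>, so \<open>y\<close> is suspended, and \<open>\<Sigma>S\<close> replaced by an isomorphic
      object of \<open>C\<close>.\<close>
    obtain S' k k' where S' [simp]: "S' \<in> C" and k: "k \<in> Hom T S' (SigO T S)" "k' \<in> Hom T (SigO T S) S'"
      and kk': "k \<cdot> k' = Idn T (SigO T S)" by (rule suspend[OF S])
    note [simp] = hom_typed[OF k(1)] hom_typed[OF k(2)]
    have d [simp]: "differential T A (Suc n) \<in> Ar T"
      "Dom T (differential T A (Suc n)) = tP A (Suc (Suc n))"
      "Cod T (differential T A (Suc n)) = SigO T (tP A (Suc n))"
      by (simp_all add: differential_def)
    have "SigA T (differential T A (Suc n)) \<cdot> SigA T y = SigA T (Zero T S (SigO T (tP A (Suc n))))"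
      using dy by (simp add: sus_comp[symmetric] del: sus_comp)
    then have "SigA T (differential T A (Suc n)) \<cdot> (SigA T y \<cdot> k) = Zero T S' (SigO T (SigO T (tP A (Suc n))))"
      by (simp add: comp_reduce)
    then obtain w where w: "w \<in> Hom T S' (tP A (Suc (Suc (Suc n))))"
      "differential T A (Suc (Suc n)) \<cdot> w = SigA T y \<cdot> k"
      using exact[OF S', of "SigA T y \<cdot> k" "Suc n"] by (auto simp: Hom_iff)
    note [simp] = hom_typed[OF w(1)]
    let ?fy = "tf A (Suc (Suc n)) \<cdot> y"
    have fyk: "SigA T ?fy \<cdot> k = Zero T S' (SigO T (tX A (Suc n)))"
      by (simp add: w(2)[symmetric] differential_def comp_reduce[OF stf_tq])
    have "SigA T ?fy = SigA T ?fy \<cdot> (k \<cdot> k')" by (simp add: kk' del: sus_comp)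
    also have "\<dots> = SigA T (Zero T S (tX A (Suc n)))"
      by (simp add: comp_reduce[OF fyk] del: sus_comp)
    finally have "?fy = Zero T S (tX A (Suc n))"
      by (intro sus_faithful[of ?fy "Zero T S (tX A (Suc n))"]) (simp_all del: sus_comp)
    then show ?thesis using y(2) by simp
  qed
qed

text \<open>The stage before \<open>X 0\<close> is a zero object.\<close>

lemma tq_0_iso: "inverse_ars T (tq A 0) (inv_ar T (tq A 0))"
proof -
  note t = triangle[of 0]
  have "neg T (SigA T (tf A 0)) = Zero T (SigO T (tP A 0)) (SigO T (zero_ob T))"
    using zero_ob_cod[OF zero_ob_sus[OF zero_ob], of "neg T (SigA T (tf A 0))"] by simp
  then obtain y where y: "y \<in> Hom T (SigO T (tP A 0)) (tX A 0)" "tq A 0 \<cdot> y = Idn T (SigO T (tP A 0))"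
    using hom_exact[OF rotate[OF rotate[OF t]], of "Idn T (SigO T (tP A 0))" "SigO T (tP A 0)"]
    by (auto simp: Hom_iff)
  note [simp] = hom_typed[OF y(1)]
  have "tq A 0 \<cdot> (y \<cdot> tq A 0 \<oplus>\<oplus> neg T (Idn T (tX A 0))) = Zero T (tX A 0) (SigO T (tP A 0))"
    by (simp add: comp_reduce[OF y(2)])
  then obtain z where z: "z \<in> Hom T (tX A 0) (zero_ob T)"
    "ti A 0 \<cdot> z = y \<cdot> tq A 0 \<oplus>\<oplus> neg T (Idn T (tX A 0))"
    using hom_exact[OF rotate[OF t], of "y \<cdot> tq A 0 \<oplus>\<oplus> neg T (Idn T (tX A 0))" "tX A 0"]
    by (auto simp: Hom_iff)
  have "z = Zero T (tX A 0) (zero_ob T)"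
    using zero_ob_cod[OF zero_ob, of z] z(1) by (simp add: Hom_iff)
  then have "y \<cdot> tq A 0 \<oplus>\<oplus> neg T (Idn T (tX A 0)) = Zero T (tX A 0) (tX A 0)"
    using z(2) by simp
  then have "y \<cdot> tq A 0 = Idn T (tX A 0)"
    using minus_zero_iff[of "y \<cdot> tq A 0" "Idn T (tX A 0)"] by simp
  then have "inverse_ars T (tq A 0) y" using y by (simp add: inverse_ars_def Hom_iff)
  then have "is_iso T (tq A 0)" unfolding is_iso_def by blast
  then show ?thesis by (rule inv_ar)
qed

end

section \<open>Product preserving presheaves\<close>

lemma full_sub_coproduct_typed:
  assumes "is_coproduct (full_sub K C) I X Q \<iota>"
  shows "Q \<in> C" and "i \<in> I \<Longrightarrow> X i \<in> C" and "i \<in> I \<Longrightarrow> \<iota> i \<in> Hom K (X i) Q"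
proof -
  show "Q \<in> C" using coproduct_ob[OF assms] by (simp add: full_sub_def)
  assume "i \<in> I"
  from coproduct_inj[OF assms this] show "X i \<in> C" "\<iota> i \<in> Hom K (X i) Q"
    by (auto simp: full_sub_def Hom_iff)
qed

lemma mod_objectI:
  fixes \<alpha> :: "'k rel"
  assumes group: "\<And>c. c \<in> C \<Longrightarrow> comm_group (PO F c)"
    and ar: "\<And>c d u. \<lbrakk>c \<in> C; d \<in> C; u \<in> Hom K c d\<rbrakk> \<Longrightarrow> PA F u \<in> hom (PO F d) (PO F c)"
    and idn: "\<And>c x. \<lbrakk>c \<in> C; x \<in> carrier (PO F c)\<rbrakk> \<Longrightarrow> PA F (Idn K c) x = x"
    and comp: "\<And>b c d u v x. \<lbrakk>b \<in> C; c \<in> C; d \<in> C; u \<in> Hom K b c; v \<in> Hom K c d;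
        x \<in> carrier (PO F d)\<rbrakk> \<Longrightarrow> PA F (v \<cdot>\<^bsub>K\<^esub> u) x = PA F u (PA F v x)"
    and inj: "\<And>(I :: 'k set) X Q \<iota> x y. \<lbrakk>|I| <o \<alpha>; is_coproduct (full_sub K C) I X Q \<iota>;
        x \<in> carrier (PO F Q); y \<in> carrier (PO F Q);
        \<And>i. i \<in> I \<Longrightarrow> PA F (\<iota> i) x = PA F (\<iota> i) y\<rbrakk> \<Longrightarrow> x = y"
    and surj: "\<And>(I :: 'k set) X Q \<iota> r. \<lbrakk>|I| <o \<alpha>; is_coproduct (full_sub K C) I X Q \<iota>;
        \<And>i. i \<in> I \<Longrightarrow> r i \<in> carrier (PO F (X i))\<rbrakk>
      \<Longrightarrow> \<exists>x \<in> carrier (PO F Q). \<forall>i \<in> I. PA F (\<iota> i) x = r i"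
  shows "mod_object \<alpha> K C F"
proof (rule mod_object.intro)
  fix I :: "'k set" and X Q \<iota>
  assume small: "|I| <o \<alpha>" and Q: "is_coproduct (full_sub K C) I X Q \<iota>"
  note typed = full_sub_coproduct_typed[OF Q]
  let ?p = "\<lambda>x. \<lambda>i\<in>I. PA F (\<iota> i) x"
  have h: "PA F (\<iota> i) \<in> hom (PO F Q) (PO F (X i))" if "i \<in> I" for i
    by (rule ar[OF typed(2)[OF that] typed(1) typed(3)[OF that]])
  have c: "?p x \<in> carrier (product_group I (\<lambda>i. PO F (X i)))" if "x \<in> carrier (PO F Q)" for x
    using hom_in_carrier[OF h that] by simp
  have "?p \<in> hom (PO F Q) (product_group I (\<lambda>i. PO F (X i)))"
  proof (rule homI)
    fix x y assume xy: "x \<in> carrier (PO F Q)" "y \<in> carrier (PO F Q)"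
    show "?p (x \<otimes>\<^bsub>PO F Q\<^esub> y) = ?p x \<otimes>\<^bsub>product_group I (\<lambda>i. PO F (X i))\<^esub> ?p y"
      using hom_mult[OF h xy] by (auto intro!: restrict_ext)
  qed (rule c)
  moreover have "inj_on ?p (carrier (PO F Q))"
  proof (rule inj_onI)
    fix x y assume xy: "x \<in> carrier (PO F Q)" "y \<in> carrier (PO F Q)" and eq: "?p x = ?p y"
    have "PA F (\<iota> i) x = PA F (\<iota> i) y" if "i \<in> I" for i
      using fun_cong[OF eq, of i] that by simp
    then show "x = y" by (rule inj[OF small Q xy])
  qed
  moreover have "carrier (product_group I (\<lambda>i. PO F (X i))) \<subseteq> ?p ` carrier (PO F Q)"
  proof
    fix r assume r: "r \<in> carrier (product_group I (\<lambda>i. PO F (X i)))"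
    then have ri: "r i \<in> carrier (PO F (X i))" if "i \<in> I" for i
      using that by (auto simp: PiE_iff)
    have "\<exists>x \<in> carrier (PO F Q). \<forall>i \<in> I. PA F (\<iota> i) x = r i"
      by (rule surj[OF small Q]) (rule ri)
    then obtain x where x: "x \<in> carrier (PO F Q)"
      and eq: "\<forall>i\<in>I. PA F (\<iota> i) x = r i" by (elim bexE) simp
    have "?p x = r" using eq r by (auto simp: PiE_iff extensional_def)
    then show "r \<in> ?p ` carrier (PO F Q)" using x by (rule image_eqI[OF sym])
  qed
  ultimately show "?p \<in> iso (PO F Q) (product_group I (\<lambda>i. PO F (X i)))"
    using c unfolding iso_def bij_betw_def by blast
qed (fact group ar idn comp)+

context mod_object
begin

lemma PA_carrier:
  "\<lbrakk>c \<in> C; d \<in> C; u \<in> Hom K c d; x \<in> carrier (PO F d)\<rbrakk> \<Longrightarrow> PA F u x \<in> carrier (PO F c)"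
  by (rule hom_in_carrier[OF ar])

lemma PA_mult:
  "\<lbrakk>c \<in> C; d \<in> C; u \<in> Hom K c d; x \<in> carrier (PO F d); y \<in> carrier (PO F d)\<rbrakk>
    \<Longrightarrow> PA F u (x \<otimes>\<^bsub>PO F d\<^esub> y) = PA F u x \<otimes>\<^bsub>PO F c\<^esub> PA F u y"
  by (rule hom_mult[OF ar])

lemma PA_hom: "\<lbrakk>c \<in> C; d \<in> C; u \<in> Hom K c d\<rbrakk> \<Longrightarrow> group_hom (PO F d) (PO F c) (PA F u)"
  using group ar by (simp add: group_hom_def group_hom_axioms_def comm_group_def)

lemma product_inj:
  assumes small: "|I :: 'k set| <o \<alpha>" and Q: "is_coproduct (full_sub K C) I X Q \<iota>"
    and xy: "x \<in> carrier (PO F Q)" "y \<in> carrier (PO F Q)"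
    and eq: "\<And>i. i \<in> I \<Longrightarrow> PA F (\<iota> i) x = PA F (\<iota> i) y"
  shows "x = y"
proof -
  have "inj_on (\<lambda>x. \<lambda>i\<in>I. PA F (\<iota> i) x) (carrier (PO F Q))"
    using preserves_products[OF small Q] by (simp add: iso_def bij_betw_def)
  moreover have "(\<lambda>i\<in>I. PA F (\<iota> i) x) = (\<lambda>i\<in>I. PA F (\<iota> i) y)" using eq by (rule restrict_ext)
  ultimately show ?thesis using xy by (rule inj_onD)
qed

lemma product_surj:
  assumes small: "|I :: 'k set| <o \<alpha>" and Q: "is_coproduct (full_sub K C) I X Q \<iota>"
    and r: "\<And>i. i \<in> I \<Longrightarrow> r i \<in> carrier (PO F (X i))"
  obtains x where "x \<in> carrier (PO F Q)" "\<And>i. i \<in> I \<Longrightarrow> PA F (\<iota> i) x = r i"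
proof -
  have "(\<lambda>x. \<lambda>i\<in>I. PA F (\<iota> i) x) ` carrier (PO F Q) = (\<Pi>\<^sub>E i\<in>I. carrier (PO F (X i)))"
    using preserves_products[OF small Q] by (simp add: iso_def bij_betw_def)
  moreover have "restrict r I \<in> (\<Pi>\<^sub>E i\<in>I. carrier (PO F (X i)))" using r by simp
  ultimately obtain x where x: "x \<in> carrier (PO F Q)" and eq: "restrict r I = (\<lambda>i\<in>I. PA F (\<iota> i) x)"
    by (metis (no_types, lifting) imageE)
  have "PA F (\<iota> i) x = r i" if "i \<in> I" for i using fun_cong[OF eq, of i] that by simp
  then show thesis using that x by blast
qed

end

text \<open>A subfunctor whose membership can be tested on the components of a coproduct.  This condition is what
  makes both the subfunctor and the quotient by it preserve products.\<close>

locale sub_object = mod_object \<alpha> K C F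
  for \<alpha> :: "'k rel" and K :: "('o, 'm, 'z) cat_scheme" (structure) and C :: "'o set"
    and F :: "('o, 'm) presheaf" +
  fixes N :: "'o \<Rightarrow> 'm set"
  assumes sub: "c \<in> C \<Longrightarrow> subgroup (N c) (PO F c)"
    and closed: "\<lbrakk>c \<in> C; d \<in> C; u \<in> Hom K c d; x \<in> N d\<rbrakk> \<Longrightarrow> PA F u x \<in> N c"
    and glue: "\<lbrakk>|I :: 'k set| <o \<alpha>; is_coproduct (full_sub K C) I X Q \<iota>; x \<in> carrier (PO F Q);
        \<And>i. i \<in> I \<Longrightarrow> PA F (\<iota> i) x \<in> N (X i)\<rbrakk> \<Longrightarrow> x \<in> N Q"
begin

lemma N_carrier: "\<lbrakk>c \<in> C; x \<in> N c\<rbrakk> \<Longrightarrow> x \<in> carrier (PO F c)"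
  using subgroup.mem_carrier[OF sub] .

definition subO :: "('o, 'm) presheaf" where
  "subO = \<lparr>PO = (\<lambda>c. (PO F c)\<lparr>carrier := N c\<rparr>), PA = PA F\<rparr>"

lemma subO_simps [simp]:
  "carrier (PO subO c) = N c" "mult (PO subO c) = mult (PO F c)" "one (PO subO c) = one (PO F c)"
  "PA subO = PA F"
  by (simp_all add: subO_def)

lemma mod_object_subO: "mod_object \<alpha> K C subO"
proof (rule mod_objectI)
  fix c assume c: "c \<in> C"
  interpret G: comm_group "PO F c" using c by (rule group)
  have "Group.group (PO subO c)"
    using subgroup.subgroup_is_group[OF sub[OF c] G.is_group] by (simp add: subO_def)
  then show "comm_group (PO subO c)"
    by (rule group.group_comm_groupI) (use G.m_comm N_carrier[OF c] in simp)
next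
  fix c d u assume cd: "c \<in> C" "d \<in> C" "u \<in> Hom K c d"
  show "PA subO u \<in> hom (PO subO d) (PO subO c)"
    by (rule homI) (use closed[OF cd] PA_mult[OF cd] N_carrier[OF cd(2)] in simp_all)
next
  fix c x assume "c \<in> C" "x \<in> carrier (PO subO c)"
  then show "PA subO (Idn K c) x = x" using idn N_carrier by simp
next
  fix b c d u v x assume "b \<in> C" "c \<in> C" "d \<in> C" "u \<in> Hom K b c" "v \<in> Hom K c d" "x \<in> carrier (PO subO d)"
  then show "PA subO (v \<cdot> u) x = PA subO u (PA subO v x)" using comp[of b c d u v x] N_carrier by simp
next
  fix I :: "'k set" and X Q \<iota> x y
  assume I: "|I| <o \<alpha>" and Q: "is_coproduct (full_sub K C) I X Q \<iota>"
    and xy: "x \<in> carrier (PO subO Q)" "y \<in> carrier (PO subO Q)"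
    and eq: "\<And>i. i \<in> I \<Longrightarrow> PA subO (\<iota> i) x = PA subO (\<iota> i) y"
  have "Q \<in> C" by (rule full_sub_coproduct_typed(1)[OF Q])
  then show "x = y" using product_inj[OF I Q, of x y] xy eq N_carrier by simp
next
  fix I :: "'k set" and X Q \<iota> r
  assume I: "|I| <o \<alpha>" and Q: "is_coproduct (full_sub K C) I X Q \<iota>"
    and r: "\<And>i. i \<in> I \<Longrightarrow> r i \<in> carrier (PO subO (X i))"
  note typed = full_sub_coproduct_typed[OF Q]
  have r': "r i \<in> carrier (PO F (X i))" if "i \<in> I" for i
    using N_carrier[OF typed(2)[OF that]] r[OF that] by simp
  obtain x where x: "x \<in> carrier (PO F Q)" and eq: "\<And>i. i \<in> I \<Longrightarrow> PA F (\<iota> i) x = r i"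
    using product_surj[OF I Q r'] by blast
  have "x \<in> N Q" using r eq by (intro glue[OF I Q x]) simp
  then show "\<exists>x\<in>carrier (PO subO Q). \<forall>i\<in>I. PA subO (\<iota> i) x = r i"
    using eq by (intro bexI[of _ x]) simp_all
qed

text \<open>The values of a presheaf are groups of elements of type \<open>'m\<close>, so a quotient group is carried by
  chosen representatives of its cosets.\<close>

definition rep :: "'o \<Rightarrow> 'm \<Rightarrow> 'm" where
  "rep c x = (SOME y. y \<in> carrier (PO F c) \<and> y \<otimes>\<^bsub>PO F c\<^esub> inv\<^bsub>PO F c\<^esub> x \<in> N c)"

context
  fixes c assumes c: "c \<in> C"
begin

interpretation G: comm_group "PO F c" using c by (rule group)
interpretation N: subgroup "N c" "PO F c" using c by (rule sub)

abbreviation congruent_mod_N (infix "\<asymp>" 50) where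
  "x \<asymp> y \<equiv> x \<otimes>\<^bsub>PO F c\<^esub> inv\<^bsub>PO F c\<^esub> y \<in> N c"

lemma rep_props:
  assumes x: "x \<in> carrier (PO F c)"
  shows "rep c x \<in> carrier (PO F c)" "rep c x \<asymp> x"
proof -
  have "\<exists>y. y \<in> carrier (PO F c) \<and> y \<asymp> x"
    using x by (intro exI[of _ x]) simp
  from someI_ex[OF this] show "rep c x \<in> carrier (PO F c)"
    "rep c x \<asymp> x"
    by (simp_all add: rep_def)
qed

lemma diff_sym:
  assumes "x \<in> carrier (PO F c)" "y \<in> carrier (PO F c)" "x \<asymp> y"
  shows "y \<asymp> x"
  using N.m_inv_closed[OF assms(3)] assms(1,2) by (simp add: G.inv_mult G.m_comm)

lemma diff_trans:
  assumes xyz: "x \<in> carrier (PO F c)" "y \<in> carrier (PO F c)" "z \<in> carrier (PO F c)"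
    and "x \<asymp> y" "y \<asymp> z"
  shows "x \<asymp> z"
proof -
  have "(x \<otimes>\<^bsub>PO F c\<^esub> inv\<^bsub>PO F c\<^esub> y) \<otimes>\<^bsub>PO F c\<^esub> (y \<otimes>\<^bsub>PO F c\<^esub> inv\<^bsub>PO F c\<^esub> z)
      = x \<otimes>\<^bsub>PO F c\<^esub> inv\<^bsub>PO F c\<^esub> z"
    using xyz by (simp add: G.m_assoc G.inv_solve_left')
  then show ?thesis using N.m_closed[OF assms(4,5)] by simp
qed

lemma rep_eq_iff:
  assumes x: "x \<in> carrier (PO F c)" and y: "y \<in> carrier (PO F c)"
  shows "rep c x = rep c y \<longleftrightarrow> x \<asymp> y"
proof
  assume "rep c x = rep c y"
  then have "rep c x \<asymp> y" using rep_props(2)[OF y] by simp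
  then show "x \<asymp> y"
    by (rule diff_trans[OF x rep_props(1)[OF x] y diff_sym[OF rep_props(1)[OF x] x rep_props(2)[OF x]]])
next
  assume xy: "x \<asymp> y"
  have "w \<asymp> x \<longleftrightarrow> w \<asymp> y"
    if w: "w \<in> carrier (PO F c)" for w
    using diff_trans[OF w x y _ xy] diff_trans[OF w y x _ diff_sym[OF x y xy]] by blast
  then have "(\<lambda>w. w \<in> carrier (PO F c) \<and> w \<asymp> x) =
      (\<lambda>w. w \<in> carrier (PO F c) \<and> w \<asymp> y)" by blast
  then show "rep c x = rep c y" by (simp add: rep_def)
qed

lemma rep_rep: "x \<in> carrier (PO F c) \<Longrightarrow> rep c (rep c x) = rep c x"
  using rep_eq_iff[OF rep_props(1)] rep_props(2) by simp

lemma rep_mult: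
  assumes x: "x \<in> carrier (PO F c)" and y: "y \<in> carrier (PO F c)"
  shows "rep c (rep c x \<otimes>\<^bsub>PO F c\<^esub> y) = rep c (x \<otimes>\<^bsub>PO F c\<^esub> y)"
proof -
  have "y \<otimes>\<^bsub>PO F c\<^esub> (inv\<^bsub>PO F c\<^esub> y \<otimes>\<^bsub>PO F c\<^esub> inv\<^bsub>PO F c\<^esub> x) = inv\<^bsub>PO F c\<^esub> x"
    using x y by (simp flip: G.m_assoc)
  then have "(rep c x \<otimes>\<^bsub>PO F c\<^esub> y) \<otimes>\<^bsub>PO F c\<^esub> inv\<^bsub>PO F c\<^esub> (x \<otimes>\<^bsub>PO F c\<^esub> y)
      = rep c x \<otimes>\<^bsub>PO F c\<^esub> inv\<^bsub>PO F c\<^esub> x"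
    using x y rep_props(1)[OF x] by (simp add: G.inv_mult_group G.m_assoc)
  then show ?thesis
    using rep_eq_iff[of "rep c x \<otimes>\<^bsub>PO F c\<^esub> y" "x \<otimes>\<^bsub>PO F c\<^esub> y"] x y rep_props[OF x] by simp
qed

lemma rep_mult':
  assumes x: "x \<in> carrier (PO F c)" and y: "y \<in> carrier (PO F c)"
  shows "rep c (x \<otimes>\<^bsub>PO F c\<^esub> rep c y) = rep c (x \<otimes>\<^bsub>PO F c\<^esub> y)"
  using rep_mult[OF y x] x y rep_props(1)[OF y] by (simp add: G.m_comm)

lemma rep_one_iff:
  assumes x: "x \<in> carrier (PO F c)"
  shows "rep c x = rep c \<one>\<^bsub>PO F c\<^esub> \<longleftrightarrow> x \<in> N c"
  using rep_eq_iff[OF x G.one_closed] x by simp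

end

definition quotO :: "('o, 'm) presheaf" where
  "quotO = \<lparr>PO = (\<lambda>c. \<lparr>carrier = rep c ` carrier (PO F c),
      mult = (\<lambda>x y. rep c (x \<otimes>\<^bsub>PO F c\<^esub> y)), one = rep c \<one>\<^bsub>PO F c\<^esub>\<rparr>),
    PA = (\<lambda>u x. rep (Dom K u) (PA F u x))\<rparr>"

lemma quotO_simps [simp]:
  "carrier (PO quotO c) = rep c ` carrier (PO F c)"
  "mult (PO quotO c) = (\<lambda>x y. rep c (x \<otimes>\<^bsub>PO F c\<^esub> y))"
  "one (PO quotO c) = rep c \<one>\<^bsub>PO F c\<^esub>"
  "PA quotO = (\<lambda>u x. rep (Dom K u) (PA F u x))"
  by (simp_all add: quotO_def)

lemma quotO_group:
  assumes c: "c \<in> C"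
  shows "comm_group (PO quotO c)"
proof -
  interpret G: comm_group "PO F c" using c by (rule group)
  note [simp] = rep_props(1)[OF c] rep_mult[OF c] rep_mult'[OF c] rep_rep[OF c]
  show ?thesis
  proof (rule comm_groupI)
    fix x assume "x \<in> carrier (PO quotO c)"
    then obtain x' where x': "x' \<in> carrier (PO F c)" "x = rep c x'" by auto
    then have "rep c (inv\<^bsub>PO F c\<^esub> x') \<in> carrier (PO quotO c)"
      "rep c (inv\<^bsub>PO F c\<^esub> x') \<otimes>\<^bsub>PO quotO c\<^esub> x = \<one>\<^bsub>PO quotO c\<^esub>"
      by simp_all
    then show "\<exists>y\<in>carrier (PO quotO c). y \<otimes>\<^bsub>PO quotO c\<^esub> x = \<one>\<^bsub>PO quotO c\<^esub>" by blast
  next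
    fix x y assume "x \<in> carrier (PO quotO c)" "y \<in> carrier (PO quotO c)"
    then obtain x' y' where "x' \<in> carrier (PO F c)" "x = rep c x'" "y' \<in> carrier (PO F c)" "y = rep c y'"
      by auto
    then show "x \<otimes>\<^bsub>PO quotO c\<^esub> y = y \<otimes>\<^bsub>PO quotO c\<^esub> x"
      by (simp add: G.m_comm)
  qed (auto simp: G.m_assoc)
qed

lemma quotO_PA:
  assumes c: "c \<in> C" and d: "d \<in> C" and u: "u \<in> Hom K c d" and x: "x \<in> carrier (PO F d)"
  shows "PA quotO u (rep d x) = rep c (PA F u x)"
proof -
  interpret h: group_hom "PO F d" "PO F c" "PA F u" by (rule PA_hom[OF c d u])
  have "PA F u (rep d x \<otimes>\<^bsub>PO F d\<^esub> inv\<^bsub>PO F d\<^esub> x) \<in> N c"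
    by (rule closed[OF c d u rep_props(2)[OF d x]])
  then have "PA F u (rep d x) \<otimes>\<^bsub>PO F c\<^esub> inv\<^bsub>PO F c\<^esub> (PA F u x) \<in> N c"
    using x rep_props(1)[OF d x] by simp
  then show ?thesis
    using rep_eq_iff[OF c PA_carrier[OF c d u rep_props(1)[OF d x]] PA_carrier[OF c d u x]] u
    by (simp add: Hom_iff)
qed

lemma mod_object_quotO:
  assumes K: "category K" and C: "C \<subseteq> Ob K"
  shows "mod_object \<alpha> K C quotO"
proof (rule mod_objectI)
  show "comm_group (PO quotO c)" if "c \<in> C" for c using that by (rule quotO_group)
next
  fix c d u assume cd: "c \<in> C" "d \<in> C" "u \<in> Hom K c d"
  interpret G: comm_group "PO F d" using cd(2) by (rule group)
  show "PA quotO u \<in> hom (PO quotO d) (PO quotO c)"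
  proof (rule homI)
    fix x assume "x \<in> carrier (PO quotO d)"
    then obtain x' where x': "x' \<in> carrier (PO F d)" "x = rep d x'" by auto
    then show "PA quotO u x \<in> carrier (PO quotO c)"
      using quotO_PA[OF cd x'(1)] PA_carrier[OF cd x'(1)] by (simp del: quotO_simps(4))
  next
    fix x y assume "x \<in> carrier (PO quotO d)" "y \<in> carrier (PO quotO d)"
    then obtain x' y' where x': "x' \<in> carrier (PO F d)" "x = rep d x'"
      and y': "y' \<in> carrier (PO F d)" "y = rep d y'" by auto
    have "x \<otimes>\<^bsub>PO quotO d\<^esub> y = rep d (x' \<otimes>\<^bsub>PO F d\<^esub> y')"
      using x' y' by (simp add: rep_mult[OF cd(2)] rep_mult'[OF cd(2)] rep_props(1)[OF cd(2)])
    then have "PA quotO u (x \<otimes>\<^bsub>PO quotO d\<^esub> y) = rep c (PA F u (x' \<otimes>\<^bsub>PO F d\<^esub> y'))"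
      using quotO_PA[OF cd, of "x' \<otimes>\<^bsub>PO F d\<^esub> y'"] x' y' by (simp del: quotO_simps)
    also have "\<dots> = rep c (PA F u x') \<otimes>\<^bsub>PO quotO c\<^esub> rep c (PA F u y')"
      using PA_mult[OF cd x'(1) y'(1)] PA_carrier[OF cd x'(1)] PA_carrier[OF cd y'(1)]
      by (simp add: rep_mult[OF cd(1)] rep_mult'[OF cd(1)] rep_props(1)[OF cd(1)])
    finally show "PA quotO u (x \<otimes>\<^bsub>PO quotO d\<^esub> y) = PA quotO u x \<otimes>\<^bsub>PO quotO c\<^esub> PA quotO u y"
      using quotO_PA[OF cd x'(1)] quotO_PA[OF cd y'(1)] x'(2) y'(2) by (simp del: quotO_simps)
  qed
next
  fix c x assume c: "c \<in> C" and "x \<in> carrier (PO quotO c)"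
  then obtain x' where x': "x' \<in> carrier (PO F c)" "x = rep c x'" by auto
  have "Idn K c \<in> Hom K c c" using category.idn_hom[OF K] c C by blast
  from quotO_PA[OF c c this x'(1)] show "PA quotO (Idn K c) x = x"
    using idn[OF c x'(1)] x'(2) by (simp del: quotO_simps)
next
  fix b c d u v x
  assume bcd: "b \<in> C" "c \<in> C" "d \<in> C" and u: "u \<in> Hom K b c" and v: "v \<in> Hom K c d"
    and "x \<in> carrier (PO quotO d)"
  then obtain x' where x': "x' \<in> carrier (PO F d)" "x = rep d x'" by auto
  have vu: "v \<cdot> u \<in> Hom K b d" by (rule category.comp_hom[OF K u v])
  show "PA quotO (v \<cdot> u) x = PA quotO u (PA quotO v x)"
    using quotO_PA[OF bcd(1,3) vu x'(1)] quotO_PA[OF bcd(2,3) v x'(1)]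
      quotO_PA[OF bcd(1,2) u PA_carrier[OF bcd(2,3) v x'(1)]] comp[OF bcd u v x'(1)] x'(2)
    by (simp del: quotO_simps)
next
  fix I :: "'k set" and X Q \<iota> x y
  assume I: "|I| <o \<alpha>" and coprod: "is_coproduct (full_sub K C) I X Q \<iota>"
    and "x \<in> carrier (PO quotO Q)" "y \<in> carrier (PO quotO Q)"
    and eq: "\<And>i. i \<in> I \<Longrightarrow> PA quotO (\<iota> i) x = PA quotO (\<iota> i) y"
  then obtain x' y' where x': "x' \<in> carrier (PO F Q)" "x = rep Q x'"
    and y': "y' \<in> carrier (PO F Q)" "y = rep Q y'" by auto
  note typed = full_sub_coproduct_typed[OF coprod]
  interpret G: comm_group "PO F Q" using typed(1) by (rule group)
  have "x' \<otimes>\<^bsub>PO F Q\<^esub> inv\<^bsub>PO F Q\<^esub> y' \<in> N Q"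
  proof (rule glue[OF I coprod])
    fix i assume i: "i \<in> I"
    note h = typed(2)[OF i] typed(1) typed(3)[OF i]
    interpret h: group_hom "PO F Q" "PO F (X i)" "PA F (\<iota> i)" by (rule PA_hom[OF h])
    have "rep (X i) (PA F (\<iota> i) x') = rep (X i) (PA F (\<iota> i) y')"
      using eq[OF i] quotO_PA[OF h x'(1)] quotO_PA[OF h y'(1)] x'(2) y'(2) by (simp del: quotO_simps)
    then have "PA F (\<iota> i) x' \<otimes>\<^bsub>PO F (X i)\<^esub> inv\<^bsub>PO F (X i)\<^esub> (PA F (\<iota> i) y') \<in> N (X i)"
      using rep_eq_iff[OF h(1) PA_carrier[OF h x'(1)] PA_carrier[OF h y'(1)]] by simp
    then show "PA F (\<iota> i) (x' \<otimes>\<^bsub>PO F Q\<^esub> inv\<^bsub>PO F Q\<^esub> y') \<in> N (X i)" using x' y' by simp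
  qed (use x' y' in simp)
  then show "x = y" using rep_eq_iff[OF typed(1) x'(1) y'(1)] x' y' by simp
next
  fix I :: "'k set" and X Q \<iota> r
  assume I: "|I| <o \<alpha>" and coprod: "is_coproduct (full_sub K C) I X Q \<iota>"
    and r: "\<And>i. i \<in> I \<Longrightarrow> r i \<in> carrier (PO quotO (X i))"
  note typed = full_sub_coproduct_typed[OF coprod]
  have r': "r i \<in> carrier (PO F (X i))" "rep (X i) (r i) = r i" if "i \<in> I" for i
    using r[OF that] rep_props(1)[OF typed(2)[OF that]] rep_rep[OF typed(2)[OF that]] by auto
  obtain x where x: "x \<in> carrier (PO F Q)" and eq: "\<And>i. i \<in> I \<Longrightarrow> PA F (\<iota> i) x = r i"
    using product_surj[OF I coprod r'(1)] by blast
  have "PA quotO (\<iota> i) (rep Q x) = r i" if "i \<in> I" for i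
    using quotO_PA[OF typed(2)[OF that] typed(1) typed(3)[OF that] x] eq[OF that] r'(2)[OF that] by simp
  then show "\<exists>x\<in>carrier (PO quotO Q). \<forall>i\<in>I. PA quotO (\<iota> i) x = r i"
    using x by (intro bexI[of _ "rep Q x"]) (simp_all del: quotO_simps(4))
qed

end

section \<open>Epimorphisms and exactness in the module category\<close>

lemma ModCat_simps [simp]:
  "Ob (ModCat \<alpha> K C) = {F. mod_object \<alpha> K C F}"
  "(F, G, \<eta>) \<in> Ar (ModCat \<alpha> K C) \<longleftrightarrow>
    mod_object \<alpha> K C F \<and> mod_object \<alpha> K C G \<and> \<eta> \<in> mod_hom K C F G"
  "Dom (ModCat \<alpha> K C) (F, G, \<eta>) = F" "Cod (ModCat \<alpha> K C) (F, G, \<eta>) = G"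
  "(G', H, \<theta>) \<cdot>\<^bsub>ModCat \<alpha> K C\<^esub> (F, G, \<eta>) = (F, H, \<lambda>c\<in>C. \<lambda>x\<in>carrier (PO F c). \<theta> c (\<eta> c x))"
  "Zero (ModCat \<alpha> K C) F G = (F, G, \<lambda>c\<in>C. \<lambda>x\<in>carrier (PO F c). \<one>\<^bsub>PO G c\<^esub>)"
  by (simp_all add: ModCat_def)

lemma is_epiD:
  assumes "is_epi K e" "Z \<in> Ob K" "u \<in> Hom K (Cod K e) Z" "v \<in> Hom K (Cod K e) Z"
    "u \<cdot>\<^bsub>K\<^esub> e = v \<cdot>\<^bsub>K\<^esub> e"
  shows "u = v"
proof -
  have "\<forall>Z \<in> Ob K. \<forall>u \<in> Hom K (Cod K e) Z. \<forall>v \<in> Hom K (Cod K e) Z.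
      u \<cdot>\<^bsub>K\<^esub> e = v \<cdot>\<^bsub>K\<^esub> e \<longrightarrow> u = v"
    using assms(1) unfolding is_epi_def by (elim conjE)
  from this[rule_format, OF assms(2-5)] show ?thesis .
qed

lemma mod_homD:
  assumes "\<eta> \<in> mod_hom K C F G" "c \<in> C"
  shows "\<eta> c \<in> hom (PO F c) (PO G c)"
    "\<lbrakk>d \<in> C; u \<in> Hom K c d; x \<in> carrier (PO F d)\<rbrakk> \<Longrightarrow> \<eta> c (PA F u x) = PA G u (\<eta> d x)"
    "x \<in> carrier (PO F c) \<Longrightarrow> \<eta> c x \<in> carrier (PO G c)"
  using assms by (auto simp: mod_hom_def intro: hom_in_carrier)

lemma mod_homI:
  assumes F: "mod_object \<alpha> K C F"
    and h: "\<And>c. c \<in> C \<Longrightarrow> h c \<in> hom (PO F c) (PO G c)"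
    and nat: "\<And>c d u x. \<lbrakk>c \<in> C; d \<in> C; u \<in> Hom K c d; x \<in> carrier (PO F d)\<rbrakk>
      \<Longrightarrow> h c (PA F u x) = PA G u (h d x)"
  shows "(\<lambda>c\<in>C. \<lambda>x\<in>carrier (PO F c). h c x) \<in> mod_hom K C F G"
proof -
  interpret F: mod_object \<alpha> K C F by (fact F)
  have "restrict (h c) (carrier (PO F c)) \<in> hom (PO F c) (PO G c)" if c: "c \<in> C" for c
  proof (rule homI)
    interpret G: comm_group "PO F c" using c by (rule F.group)
    fix x y assume "x \<in> carrier (PO F c)" "y \<in> carrier (PO F c)"
    then show "restrict (h c) (carrier (PO F c)) (x \<otimes>\<^bsub>PO F c\<^esub> y) =
        restrict (h c) (carrier (PO F c)) x \<otimes>\<^bsub>PO G c\<^esub> restrict (h c) (carrier (PO F c)) y"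
      using hom_mult[OF h[OF c]] by simp
  qed (use hom_in_carrier[OF h[OF c]] in simp)
  moreover have "PA F u x \<in> carrier (PO F c)" if "c \<in> C" "d \<in> C" "u \<in> Hom K c d" "x \<in> carrier (PO F d)" for c d u x
    using F.PA_carrier[OF that] .
  ultimately show ?thesis using nat unfolding mod_hom_def by simp
qed

lemma mod_hom_ext:
  assumes "\<eta> \<in> mod_hom K C F G" "\<eta>' \<in> mod_hom K C F G"
    "\<And>c x. \<lbrakk>c \<in> C; x \<in> carrier (PO F c)\<rbrakk> \<Longrightarrow> \<eta> c x = \<eta>' c x"
  shows "\<eta> = \<eta>'"
proof (rule extensionalityI[of _ C])
  fix c assume c: "c \<in> C"
  show "\<eta> c = \<eta>' c"
    by (rule extensionalityI[of _ "carrier (PO F c)"]) (use assms c in \<open>auto simp: mod_hom_def\<close>)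
qed (use assms in \<open>auto simp: mod_hom_def\<close>)

locale mod_arrow = F: mod_object \<alpha> K C F + G: mod_object \<alpha> K C G
  for \<alpha> :: "'k rel" and K :: "('o, 'm, 'z) cat_scheme" (structure) and C :: "'o set"
    and F G :: "('o, 'm) presheaf" +
  fixes \<eta> :: "'o \<Rightarrow> 'm \<Rightarrow> 'm"
  assumes \<eta>: "\<eta> \<in> mod_hom K C F G"
begin

lemma hom: "c \<in> C \<Longrightarrow> group_hom (PO F c) (PO G c) (\<eta> c)"
  using F.group G.group mod_homD(1)[OF \<eta>]
  by (simp add: group_hom_def group_hom_axioms_def comm_group_def)

lemma natural:
  "\<lbrakk>c \<in> C; d \<in> C; u \<in> Hom K c d; x \<in> carrier (PO F d)\<rbrakk> \<Longrightarrow> \<eta> c (PA F u x) = PA G u (\<eta> d x)"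
  by (rule mod_homD(2)[OF \<eta>])

text \<open>Preimages of the components of \<open>y\<close> are the components of a preimage, as \<open>F\<close> preserves products.\<close>

lemma image_sub_object: "sub_object \<alpha> K C G (\<lambda>c. \<eta> c ` carrier (PO F c))"
proof (intro sub_object.intro sub_object_axioms.intro)
  show "mod_object \<alpha> K C G" by (rule G.mod_object_axioms)
  show "subgroup (\<eta> c ` carrier (PO F c)) (PO G c)" if "c \<in> C" for c
    by (rule group_hom.img_is_subgroup[OF hom[OF that]])
  show "PA G u y \<in> \<eta> c ` carrier (PO F c)"
    if cd: "c \<in> C" "d \<in> C" "u \<in> Hom K c d" and y: "y \<in> \<eta> d ` carrier (PO F d)" for c d u y
  proof -
    obtain x where x: "x \<in> carrier (PO F d)" "y = \<eta> d x" using y by blast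
    then have "PA G u y = \<eta> c (PA F u x)" using natural[OF cd x(1)] by simp
    then show ?thesis using F.PA_carrier[OF cd x(1)] by blast
  qed
  show "y \<in> \<eta> Q ` carrier (PO F Q)"
    if small: "|I :: 'k set| <o \<alpha>" and Q: "is_coproduct (full_sub K C) I X Q \<iota>"
      and y: "y \<in> carrier (PO G Q)"
      and comps: "\<And>i. i \<in> I \<Longrightarrow> PA G (\<iota> i) y \<in> \<eta> (X i) ` carrier (PO F (X i))" for I X Q \<iota> y
  proof -
    note typed = full_sub_coproduct_typed[OF Q]
    define r where "r i = (SOME x. x \<in> carrier (PO F (X i)) \<and> PA G (\<iota> i) y = \<eta> (X i) x)" for i
    have r: "r i \<in> carrier (PO F (X i))" "PA G (\<iota> i) y = \<eta> (X i) (r i)" if "i \<in> I" for i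
    proof -
      have "\<exists>x. x \<in> carrier (PO F (X i)) \<and> PA G (\<iota> i) y = \<eta> (X i) x"
        using comps[OF that] by blast
      from someI_ex[OF this] show "r i \<in> carrier (PO F (X i))" "PA G (\<iota> i) y = \<eta> (X i) (r i)"
        by (simp_all add: r_def)
    qed
    obtain x where x: "x \<in> carrier (PO F Q)" and eq: "\<And>i. i \<in> I \<Longrightarrow> PA F (\<iota> i) x = r i"
      using F.product_surj[OF small Q r(1)] by blast
    have "\<eta> Q x = y"
    proof (rule G.product_inj[OF small Q mod_homD(3)[OF \<eta> typed(1) x] y])
      fix i assume i: "i \<in> I"
      show "PA G (\<iota> i) (\<eta> Q x) = PA G (\<iota> i) y"
        using natural[OF typed(2)[OF i] typed(1) typed(3)[OF i] x] eq[OF i] r(2)[OF i] by simp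
    qed
    then show ?thesis using x by blast
  qed
qed

lemma kernel_sub_object:
  "sub_object \<alpha> K C F (\<lambda>c. {x \<in> carrier (PO F c). \<eta> c x = \<one>\<^bsub>PO G c\<^esub>})"
proof (intro sub_object.intro sub_object_axioms.intro)
  show "mod_object \<alpha> K C F" by (rule F.mod_object_axioms)
  show "subgroup {x \<in> carrier (PO F c). \<eta> c x = \<one>\<^bsub>PO G c\<^esub>} (PO F c)" if "c \<in> C" for c
    using group_hom.subgroup_kernel[OF hom[OF that]] by (simp add: kernel_def)
  have PA_one: "PA G u \<one>\<^bsub>PO G d\<^esub> = \<one>\<^bsub>PO G c\<^esub>" if "c \<in> C" "d \<in> C" "u \<in> Hom K c d" for c d u
    by (rule group_hom.hom_one[OF G.PA_hom[OF that]])
  show "PA F u x \<in> {x \<in> carrier (PO F c). \<eta> c x = \<one>\<^bsub>PO G c\<^esub>}"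
    if cd: "c \<in> C" "d \<in> C" "u \<in> Hom K c d" and x: "x \<in> {x \<in> carrier (PO F d). \<eta> d x = \<one>\<^bsub>PO G d\<^esub>}"
    for c d u x
    using natural[OF cd, of x] F.PA_carrier[OF cd, of x] PA_one[OF cd] x by simp
  show "x \<in> {x \<in> carrier (PO F Q). \<eta> Q x = \<one>\<^bsub>PO G Q\<^esub>}"
    if small: "|I :: 'k set| <o \<alpha>" and Q: "is_coproduct (full_sub K C) I X Q \<iota>"
      and x: "x \<in> carrier (PO F Q)"
      and comps: "\<And>i. i \<in> I \<Longrightarrow> PA F (\<iota> i) x \<in> {x \<in> carrier (PO F (X i)). \<eta> (X i) x = \<one>\<^bsub>PO G (X i)\<^esub>}"
    for I X Q \<iota> x
  proof -
    note typed = full_sub_coproduct_typed[OF Q]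
    interpret GQ: comm_group "PO G Q" using typed(1) by (rule G.group)
    have "\<eta> Q x = \<one>\<^bsub>PO G Q\<^esub>"
    proof (rule G.product_inj[OF small Q mod_homD(3)[OF \<eta> typed(1) x] GQ.one_closed])
      fix i assume i: "i \<in> I"
      show "PA G (\<iota> i) (\<eta> Q x) = PA G (\<iota> i) \<one>\<^bsub>PO G Q\<^esub>"
        using natural[OF typed(2)[OF i] typed(1) typed(3)[OF i] x] comps[OF i]
          PA_one[OF typed(2)[OF i] typed(1) typed(3)[OF i]] by simp
    qed
    then show ?thesis using x by simp
  qed
qed

abbreviation "M \<equiv> ModCat \<alpha> K C"

text \<open>The projection to the quotient by the image and the zero morphism agree after composition with the
  epimorphism, so the quotient is trivial.\<close>

lemma epi_surj:
  assumes K: "category K" and C: "C \<subseteq> Ob K" and epi: "is_epi M (F, G, \<eta>)"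
    and c: "c \<in> C" and y: "y \<in> carrier (PO G c)"
  shows "y \<in> \<eta> c ` carrier (PO F c)"
proof -
  interpret N: sub_object \<alpha> K C G "\<lambda>c. \<eta> c ` carrier (PO F c)" by (rule image_sub_object)
  have Q: "mod_object \<alpha> K C N.quotO" by (rule N.mod_object_quotO[OF K C])
  let ?\<pi> = "\<lambda>c\<in>C. \<lambda>x\<in>carrier (PO G c). N.rep c x"
  let ?z = "\<lambda>c\<in>C. \<lambda>x\<in>carrier (PO G c). N.rep c \<one>\<^bsub>PO G c\<^esub>"
  have \<pi>: "?\<pi> \<in> mod_hom K C G N.quotO"
  proof (rule mod_homI[OF G.mod_object_axioms])
    fix c assume c: "c \<in> C"
    show "N.rep c \<in> hom (PO G c) (PO N.quotO c)"
      by (rule homI) (simp_all add: N.rep_mult[OF c] N.rep_mult'[OF c] N.rep_props(1)[OF c])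
  next
    fix c d u x assume "c \<in> C" "d \<in> C" "u \<in> Hom K c d" "x \<in> carrier (PO G d)"
    then show "N.rep c (PA G u x) = PA N.quotO u (N.rep d x)"
      by (rule N.quotO_PA[symmetric])
  qed
  have one: "\<one>\<^bsub>PO G c\<^esub> \<in> carrier (PO G c)" if "c \<in> C" for c
  proof -
    interpret H: comm_group "PO G c" using that by (rule G.group)
    show ?thesis by simp
  qed
  have z: "?z \<in> mod_hom K C G N.quotO"
  proof (rule mod_homI[OF G.mod_object_axioms])
    fix c assume c: "c \<in> C"
    interpret H: comm_group "PO G c" using c by (rule G.group)
    show "(\<lambda>x. N.rep c \<one>\<^bsub>PO G c\<^esub>) \<in> hom (PO G c) (PO N.quotO c)"
      by (rule homI) (simp_all add: N.rep_rep[OF c] N.rep_mult[OF c] N.rep_mult'[OF c] N.rep_props(1)[OF c])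
  next
    fix c d u x assume cd: "c \<in> C" "d \<in> C" "u \<in> Hom K c d"
    show "N.rep c \<one>\<^bsub>PO G c\<^esub> = PA N.quotO u (N.rep d \<one>\<^bsub>PO G d\<^esub>)"
      using N.quotO_PA[OF cd one[OF cd(2)]] group_hom.hom_one[OF G.PA_hom[OF cd]] by (simp del: N.quotO_simps)
  qed
  have "N.rep c (\<eta> c x) = N.rep c \<one>\<^bsub>PO G c\<^esub>" if "c \<in> C" "x \<in> carrier (PO F c)" for c x
    using N.rep_one_iff[OF that(1) mod_homD(3)[OF \<eta> that]] that by blast
  then have comp_eq: "(G, N.quotO, ?\<pi>) \<cdot>\<^bsub>M\<^esub> (F, G, \<eta>) =
      (G, N.quotO, ?z) \<cdot>\<^bsub>M\<^esub> (F, G, \<eta>)"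
    using mod_homD(3)[OF \<eta>] by (auto intro!: restrict_ext)
  have homs: "(G, N.quotO, ?\<pi>) \<in> Hom M G N.quotO"
    "(G, N.quotO, ?z) \<in> Hom M G N.quotO"
    using \<pi> z Q G.mod_object_axioms by (simp_all add: Hom_iff)
  have "(G, N.quotO, ?\<pi>) = (G, N.quotO, ?z)"
    by (rule is_epiD[OF epi _ _ _ comp_eq])
      (use Q homs in \<open>simp_all only: ModCat_simps(1,4) mem_Collect_eq\<close>)
  then have "?\<pi> c y = ?z c y" by simp
  then show ?thesis using N.rep_one_iff[OF c y] c y by simp
qed

lemma surj_epi:
  assumes surj: "\<And>c y. \<lbrakk>c \<in> C; y \<in> carrier (PO G c)\<rbrakk> \<Longrightarrow> y \<in> \<eta> c ` carrier (PO F c)"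
  shows "is_epi M (F, G, \<eta>)"
  unfolding is_epi_def ModCat_simps(4)
proof (intro conjI ballI impI)
  show "(F, G, \<eta>) \<in> Ar M"
    using \<eta> F.mod_object_axioms G.mod_object_axioms by simp
  fix Z u v assume u: "u \<in> Hom M G Z" and v: "v \<in> Hom M G Z"
    and eq: "u \<cdot>\<^bsub>M\<^esub> (F, G, \<eta>) = v \<cdot>\<^bsub>M\<^esub> (F, G, \<eta>)"
  obtain \<upsilon> where u': "u = (G, Z, \<upsilon>)" "\<upsilon> \<in> mod_hom K C G Z"
    using u by (cases u) (auto simp: Hom_iff)
  obtain \<nu> where v': "v = (G, Z, \<nu>)" "\<nu> \<in> mod_hom K C G Z"
    using v by (cases v) (auto simp: Hom_iff)
  have "\<upsilon> = \<nu>"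
  proof (rule mod_hom_ext[OF u'(2) v'(2)])
    fix c y assume c: "c \<in> C" and y: "y \<in> carrier (PO G c)"
    obtain x where x: "x \<in> carrier (PO F c)" "y = \<eta> c x" using surj[OF c y] by blast
    have "(\<lambda>c\<in>C. \<lambda>x\<in>carrier (PO F c). \<upsilon> c (\<eta> c x)) = (\<lambda>c\<in>C. \<lambda>x\<in>carrier (PO F c). \<nu> c (\<eta> c x))"
      using eq by (simp add: u' v')
    from fun_cong[OF fun_cong[OF this, of c], of x] show "\<upsilon> c y = \<nu> c y" using c x by simp
  qed
  then show "u = v" by (simp add: u' v')
qed

end

lemma mod_arrow_of_ar:
  assumes "(F, G, \<eta>) \<in> Ar (ModCat \<alpha> K C)"
  shows "mod_arrow \<alpha> K C F G \<eta>"
  using assms by (simp add: mod_arrow_def mod_arrow_axioms_def)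

context sub_object
begin

definition incl :: "('o, 'm) presheaf_ar" where
  "incl = (subO, F, \<lambda>c\<in>C. \<lambda>x\<in>carrier (PO subO c). x)"

lemma incl_typed [simp]:
  "incl \<in> Ar (ModCat \<alpha> K C)" "Dom (ModCat \<alpha> K C) incl = subO" "Cod (ModCat \<alpha> K C) incl = F"
proof -
  have "(\<lambda>c\<in>C. \<lambda>x\<in>carrier (PO subO c). x) \<in> mod_hom K C subO F"
    by (rule mod_homI[OF mod_object_subO]) (auto intro!: homI dest: N_carrier)
  then show "incl \<in> Ar (ModCat \<alpha> K C)" "Dom (ModCat \<alpha> K C) incl = subO" "Cod (ModCat \<alpha> K C) incl = F"
    using mod_object_subO mod_object_axioms by (simp_all add: incl_def del: subO_simps)
qed

lemma mod_hom_subO: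
  assumes \<chi>: "\<chi> \<in> mod_hom K C A F" and N: "\<And>c x. \<lbrakk>c \<in> C; x \<in> carrier (PO A c)\<rbrakk> \<Longrightarrow> \<chi> c x \<in> N c"
  shows "\<chi> \<in> mod_hom K C A subO"
proof -
  have "\<chi> c \<in> hom (PO A c) (PO subO c)" if c: "c \<in> C" for c
    by (rule homI) (use N[OF c] hom_mult[OF mod_homD(1)[OF \<chi> c]] in simp_all)
  then show ?thesis using \<chi> by (simp add: mod_hom_def)
qed

lemma incl_comp:
  assumes \<chi>: "\<chi> \<in> mod_hom K C A subO"
  shows "incl \<cdot>\<^bsub>ModCat \<alpha> K C\<^esub> (A, subO, \<chi>) = (A, F, \<chi>)"
proof -
  let ?i = "\<lambda>c\<in>C. \<lambda>x\<in>carrier (PO subO c). x"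
  have "(\<lambda>c\<in>C. \<lambda>x\<in>carrier (PO A c). ?i c (\<chi> c x)) = \<chi>"
  proof (rule extensionalityI[of _ C])
    fix c assume c: "c \<in> C"
    show "(\<lambda>c\<in>C. \<lambda>x\<in>carrier (PO A c). ?i c (\<chi> c x)) c = \<chi> c"
      by (rule extensionalityI[of _ "carrier (PO A c)"])
        (use \<chi> c mod_homD(3)[OF \<chi> c] in \<open>auto simp: mod_hom_def simp del: subO_simps\<close>)
  qed (use \<chi> in \<open>auto simp: mod_hom_def\<close>)
  then show ?thesis by (simp add: incl_def del: subO_simps)
qed

end

text \<open>The inclusion of the pointwise kernel factors through \<open>k\<close>, and \<open>e\<close> is pointwise surjective.\<close>

lemma exact_at_pointwise:
  assumes K: "category K" and C: "C \<subseteq> Ob K"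
    and f: "(F, G, \<eta>) \<in> Ar (ModCat \<alpha> K C)" and g: "(G, H, \<theta>) \<in> Ar (ModCat \<alpha> K C)"
    and exact: "exact_at (ModCat \<alpha> K C) (F, G, \<eta>) (G, H, \<theta>)"
    and c: "c \<in> C" and y: "y \<in> carrier (PO G c)" "\<theta> c y = \<one>\<^bsub>PO H c\<^esub>"
  shows "y \<in> \<eta> c ` carrier (PO F c)"
proof -
  interpret g: mod_arrow \<alpha> K C G H \<theta> using g by (rule mod_arrow_of_ar)
  obtain k e where kernel: "is_kernel (ModCat \<alpha> K C) k (G, H, \<theta>)"
    and epi: "is_epi (ModCat \<alpha> K C) e" and cod: "Cod (ModCat \<alpha> K C) e = Dom (ModCat \<alpha> K C) k"
    and fke: "(F, G, \<eta>) = k \<cdot>\<^bsub>ModCat \<alpha> K C\<^esub> e"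
    using exact unfolding exact_at_def by blast
  obtain L G' \<kappa> where k: "k = (L, G', \<kappa>)" by (cases k)
  obtain F' L' \<epsilon> where e: "e = (F', L', \<epsilon>)" by (cases e)
  have L': "L' = L" using cod by (simp add: k e)
  have F': "F' = F" and \<eta>: "\<eta> = (\<lambda>c\<in>C. \<lambda>x\<in>carrier (PO F' c). \<kappa> c (\<epsilon> c x))"
    using fke by (simp_all add: k e)
  have "e \<in> Ar (ModCat \<alpha> K C)" using epi by (simp add: is_epi_def)
  then have "(F, L, \<epsilon>) \<in> Ar (ModCat \<alpha> K C)" unfolding e F' L' .
  then interpret e: mod_arrow \<alpha> K C F L \<epsilon> by (rule mod_arrow_of_ar)
  interpret N: sub_object \<alpha> K C G "\<lambda>c. {x \<in> carrier (PO G c). \<theta> c x = \<one>\<^bsub>PO H c\<^esub>}"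
    by (rule g.kernel_sub_object)
  let ?h = "N.incl"
  have gh: "Cod (ModCat \<alpha> K C) ?h = Dom (ModCat \<alpha> K C) (G, H, \<theta>) \<and>
      (G, H, \<theta>) \<cdot>\<^bsub>ModCat \<alpha> K C\<^esub> ?h =
        Zero (ModCat \<alpha> K C) (Dom (ModCat \<alpha> K C) ?h) (Cod (ModCat \<alpha> K C) (G, H, \<theta>))"
    unfolding N.incl_typed by (auto simp: N.incl_def intro!: restrict_ext)
  have "\<forall>h\<in>Ar (ModCat \<alpha> K C). Cod (ModCat \<alpha> K C) h = Dom (ModCat \<alpha> K C) (G, H, \<theta>) \<and>
      (G, H, \<theta>) \<cdot>\<^bsub>ModCat \<alpha> K C\<^esub> h =
        Zero (ModCat \<alpha> K C) (Dom (ModCat \<alpha> K C) h) (Cod (ModCat \<alpha> K C) (G, H, \<theta>)) \<longrightarrow>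
      (\<exists>!u. u \<in> Hom (ModCat \<alpha> K C) (Dom (ModCat \<alpha> K C) h) (Dom (ModCat \<alpha> K C) k) \<and>
        k \<cdot>\<^bsub>ModCat \<alpha> K C\<^esub> u = h)"
    using kernel unfolding is_kernel_def by (elim conjE)
  from ex1_implies_ex[OF mp[OF bspec[OF this N.incl_typed(1)] gh]]
  have "\<exists>u. u \<in> Hom (ModCat \<alpha> K C) N.subO L \<and> k \<cdot>\<^bsub>ModCat \<alpha> K C\<^esub> u = ?h"
    unfolding k by (simp only: ModCat_simps(3) N.incl_typed)
  then obtain u where u: "u \<in> Hom (ModCat \<alpha> K C) N.subO L" "k \<cdot>\<^bsub>ModCat \<alpha> K C\<^esub> u = ?h" by blast
  obtain \<upsilon> where \<upsilon>: "u = (N.subO, L, \<upsilon>)" "\<upsilon> \<in> mod_hom K C N.subO L"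
    using u(1) by (cases u) (auto simp: Hom_iff)
  have eq: "(\<lambda>c\<in>C. \<lambda>x\<in>carrier (PO N.subO c). \<kappa> c (\<upsilon> c x)) = (\<lambda>c\<in>C. \<lambda>x\<in>carrier (PO N.subO c). x)"
    using u(2) by (simp add: \<upsilon>(1) k N.incl_def del: N.subO_simps)
  have yN: "y \<in> carrier (PO N.subO c)" using y by simp
  have \<kappa>y: "\<kappa> c (\<upsilon> c y) = y"
    using fun_cong[OF fun_cong[OF eq, of c], of y] c yN by (simp del: N.subO_simps)
  have "\<upsilon> c y \<in> carrier (PO L c)" by (rule mod_homD(3)[OF \<upsilon>(2) c yN])
  then have "\<upsilon> c y \<in> \<epsilon> c ` carrier (PO F c)"
    using epi by (intro e.epi_surj[OF K C _ c]) (simp_all add: e F' L')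
  then obtain x where x: "x \<in> carrier (PO F c)" "\<upsilon> c y = \<epsilon> c x" by blast
  have "\<eta> c x = y" using \<kappa>y x c by (simp add: \<eta> F')
  then show ?thesis using x(1) by blast
qed

lemma exact_atI:
  assumes f: "(F, G, \<eta>) \<in> Ar (ModCat \<alpha> K C)" and g: "(G, H, \<theta>) \<in> Ar (ModCat \<alpha> K C)"
    and zero: "\<And>c x. \<lbrakk>c \<in> C; x \<in> carrier (PO F c)\<rbrakk> \<Longrightarrow> \<theta> c (\<eta> c x) = \<one>\<^bsub>PO H c\<^esub>"
    and exact: "\<And>c y. \<lbrakk>c \<in> C; y \<in> carrier (PO G c); \<theta> c y = \<one>\<^bsub>PO H c\<^esub>\<rbrakk> \<Longrightarrow> y \<in> \<eta> c ` carrier (PO F c)"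
  shows "exact_at (ModCat \<alpha> K C) (F, G, \<eta>) (G, H, \<theta>)"
proof -
  interpret f: mod_arrow \<alpha> K C F G \<eta> using f by (rule mod_arrow_of_ar)
  interpret g: mod_arrow \<alpha> K C G H \<theta> using g by (rule mod_arrow_of_ar)
  interpret N: sub_object \<alpha> K C G "\<lambda>c. {x \<in> carrier (PO G c). \<theta> c x = \<one>\<^bsub>PO H c\<^esub>}"
    by (rule g.kernel_sub_object)
  have \<eta>N: "\<eta> \<in> mod_hom K C F N.subO"
    by (rule N.mod_hom_subO[OF f.\<eta>]) (use zero mod_homD(3)[OF f.\<eta>] in simp)
  then have e: "(F, N.subO, \<eta>) \<in> Ar (ModCat \<alpha> K C)"
    using N.mod_object_subO f by simp
  interpret e: mod_arrow \<alpha> K C F N.subO \<eta> using e by (rule mod_arrow_of_ar)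
  have "is_epi (ModCat \<alpha> K C) (F, N.subO, \<eta>)" by (rule e.surj_epi) (use exact in simp)
  moreover have "is_kernel (ModCat \<alpha> K C) N.incl (G, H, \<theta>)"
    unfolding is_kernel_def N.incl_typed
  proof (intro conjI ballI impI)
    show "(G, H, \<theta>) \<cdot>\<^bsub>ModCat \<alpha> K C\<^esub> N.incl =
        Zero (ModCat \<alpha> K C) N.subO (Cod (ModCat \<alpha> K C) (G, H, \<theta>))"
      by (auto simp: N.incl_def intro!: restrict_ext)
    fix h assume h: "h \<in> Ar (ModCat \<alpha> K C)"
      and h0: "Cod (ModCat \<alpha> K C) h = Dom (ModCat \<alpha> K C) (G, H, \<theta>) \<and>
        (G, H, \<theta>) \<cdot>\<^bsub>ModCat \<alpha> K C\<^esub> h =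
          Zero (ModCat \<alpha> K C) (Dom (ModCat \<alpha> K C) h) (Cod (ModCat \<alpha> K C) (G, H, \<theta>))"
    obtain A G' \<chi> where h': "h = (A, G', \<chi>)" by (cases h)
    have G': "G' = G" using h0 by (simp add: h')
    have A: "mod_object \<alpha> K C A" and \<chi>: "\<chi> \<in> mod_hom K C A G" using h by (simp_all add: h' G')
    have eq: "(\<lambda>c\<in>C. \<lambda>x\<in>carrier (PO A c). \<theta> c (\<chi> c x)) = (\<lambda>c\<in>C. \<lambda>x\<in>carrier (PO A c). \<one>\<^bsub>PO H c\<^esub>)"
      using h0 by (simp add: h' G')
    have "\<theta> c (\<chi> c x) = \<one>\<^bsub>PO H c\<^esub>" if "c \<in> C" "x \<in> carrier (PO A c)" for c x
      using fun_cong[OF fun_cong[OF eq, of c], of x] that by simp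
    then have \<chi>N: "\<chi> \<in> mod_hom K C A N.subO"
      by (intro N.mod_hom_subO[OF \<chi>]) (use mod_homD(3)[OF \<chi>] in simp)
    show "\<exists>!u. u \<in> Hom (ModCat \<alpha> K C) (Dom (ModCat \<alpha> K C) h) N.subO \<and>
        N.incl \<cdot>\<^bsub>ModCat \<alpha> K C\<^esub> u = h"
    proof (rule ex1I[of _ "(A, N.subO, \<chi>)"])
      show "(A, N.subO, \<chi>) \<in> Hom (ModCat \<alpha> K C) (Dom (ModCat \<alpha> K C) h) N.subO \<and>
          N.incl \<cdot>\<^bsub>ModCat \<alpha> K C\<^esub> (A, N.subO, \<chi>) = h"
        using N.incl_comp[OF \<chi>N] A \<chi>N N.mod_object_subO by (simp add: Hom_iff h' G')
      fix u assume u: "u \<in> Hom (ModCat \<alpha> K C) (Dom (ModCat \<alpha> K C) h) N.subO \<and>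
          N.incl \<cdot>\<^bsub>ModCat \<alpha> K C\<^esub> u = h"
      then obtain \<upsilon> where "u = (A, N.subO, \<upsilon>)" "\<upsilon> \<in> mod_hom K C A N.subO"
        by (cases u) (auto simp: Hom_iff h')
      then show "u = (A, N.subO, \<chi>)" using N.incl_comp[of \<upsilon> A] u by (simp add: h' G')
    qed
  qed (use g in simp_all)
  ultimately show ?thesis
    unfolding exact_at_def using N.incl_comp[OF \<eta>N]
    by (intro exI[of _ N.incl] exI[of _ "(F, N.subO, \<eta>)"]) simp
qed

section \<open>The restricted Yoneda functor\<close>

lemma full_sub_simps:
  "Ob (full_sub K C) = C" "(g \<cdot>\<^bsub>full_sub K C\<^esub> f) = (g \<cdot>\<^bsub>K\<^esub> f)"
  "f \<in> Hom (full_sub K C) X Y \<longleftrightarrow> f \<in> Hom K X Y \<and> X \<in> C \<and> Y \<in> C"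
  by (auto simp: full_sub_def Hom_iff)

lemma yonO_simps [simp]:
  "PO (yonO K X) c = hom_group K c X" "PA (yonO K X) u x = x \<cdot>\<^bsub>K\<^esub> u"
  by (simp_all add: yonO_def)

context additive
begin

text \<open>Some coproduct \<open>Q'\<close> in the ambient category lies in \<open>C\<close>.  The two universal properties make \<open>Q\<close> a
  retract of \<open>Q'\<close> compatibly with the injections, and this transfers the universal property to \<open>Q\<close>.\<close>

lemma full_sub_coproduct:
  fixes I :: "'k set" and \<alpha> :: "'k rel"
  assumes C: "C \<subseteq> Ob K" and closed: "closed_under_coproducts \<alpha> K C"
    and I: "|I| <o \<alpha>" and Q: "is_coproduct (full_sub K C) I X Q \<iota>"
  shows "is_coproduct K I X Q \<iota>"
proof -
  note typed = full_sub_coproduct_typed[OF Q]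
  have QOb: "Q \<in> Ob K" using C typed(1) by blast
  obtain Q' \<iota>' where Q'C: "Q' \<in> C" and Q': "is_coproduct K I X Q' \<iota>'"
    using closed[unfolded closed_under_coproducts_def, rule_format, of I X] I typed(2) by blast
  have "\<exists>!h. h \<in> Hom (full_sub K C) Q Q' \<and> (\<forall>i\<in>I. h \<cdot>\<^bsub>full_sub K C\<^esub> \<iota> i = \<iota>' i)"
    by (rule coproduct_univ[OF Q]) (use Q'C typed(2) coproduct_inj[OF Q'] in \<open>simp_all add: full_sub_simps\<close>)
  from ex1_implies_ex[OF this] obtain a where a: "a \<in> Hom K Q Q'" and a\<iota>: "\<And>i. i \<in> I \<Longrightarrow> a \<cdot> \<iota> i = \<iota>' i"
    unfolding full_sub_simps by (elim exE conjE) simp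
  obtain b where b: "b \<in> Hom K Q' Q" and b\<iota>: "\<And>i. i \<in> I \<Longrightarrow> b \<cdot> \<iota>' i = \<iota> i"
    using coproduct_desc[OF Q' QOb typed(3)] by blast
  note [simp] = hom_typed[OF a] hom_typed[OF b]
  have \<iota> [simp]: "\<iota> i \<in> Ar K" "Dom K (\<iota> i) = X i" "Cod K (\<iota> i) = Q" if "i \<in> I" for i
    using typed(3)[OF that] by (simp_all add: Hom_iff)
  have "\<exists>!h. h \<in> Hom (full_sub K C) Q Q \<and> (\<forall>i\<in>I. h \<cdot>\<^bsub>full_sub K C\<^esub> \<iota> i = \<iota> i)"
    by (rule coproduct_univ[OF Q]) (use typed in \<open>simp_all add: full_sub_simps\<close>)
  then have ex1: "\<exists>!h. h \<in> Hom K Q Q \<and> (\<forall>i\<in>I. h \<cdot> \<iota> i = \<iota> i)"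
    using typed(1) by (simp add: full_sub_simps)
  have e1: "b \<cdot> a \<in> Hom K Q Q \<and> (\<forall>i\<in>I. (b \<cdot> a) \<cdot> \<iota> i = \<iota> i)"
    by (simp add: Hom_iff a\<iota> b\<iota>)
  have e2: "Idn K Q \<in> Hom K Q Q \<and> (\<forall>i\<in>I. Idn K Q \<cdot> \<iota> i = \<iota> i)"
    using QOb by (simp add: Hom_iff)
  from ex1 have ba: "b \<cdot> a = Idn K Q"
  proof (rule ex1E)
    fix k assume "\<forall>h. h \<in> Hom K Q Q \<and> (\<forall>i\<in>I. h \<cdot> \<iota> i = \<iota> i) \<longrightarrow> h = k"
    from this[THEN spec, THEN mp, OF e1] this[THEN spec, THEN mp, OF e2] show ?thesis by simp
  qed
  show ?thesis
    unfolding is_coproduct_def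
  proof (intro conjI ballI allI impI)
    show "Q \<in> Ob K" by (rule QOb)
    show "\<iota> i \<in> Hom K (X i) Q" if "i \<in> I" for i by (rule typed(3)[OF that])
    fix Y g assume Y: "Y \<in> Ob K" and g: "\<forall>i\<in>I. g i \<in> Hom K (X i) Y"
    obtain h where h: "h \<in> Hom K Q' Y" and h\<iota>: "\<And>i. i \<in> I \<Longrightarrow> h \<cdot> \<iota>' i = g i"
      using coproduct_desc[OF Q' Y, of g] g by blast
    note [simp] = hom_typed[OF h]
    show "\<exists>!h. h \<in> Hom K Q Y \<and> (\<forall>i\<in>I. h \<cdot> \<iota> i = g i)"
    proof (rule ex1I[of _ "h \<cdot> a"])
      show "h \<cdot> a \<in> Hom K Q Y \<and> (\<forall>i\<in>I. (h \<cdot> a) \<cdot> \<iota> i = g i)"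
        by (simp add: Hom_iff a\<iota> h\<iota>)
      fix h' assume h': "h' \<in> Hom K Q Y \<and> (\<forall>i\<in>I. h' \<cdot> \<iota> i = g i)"
      then have [simp]: "h' \<in> Ar K" "Dom K h' = Q" "Cod K h' = Y" by (simp_all add: Hom_iff)
      have "h' \<cdot> b = h"
      proof (rule coproduct_ext[OF Q', of _ Y])
        fix i assume i: "i \<in> I"
        have "\<iota>' i \<in> Ar K" "Cod K (\<iota>' i) = Q'" using coproduct_inj[OF Q' i] by (simp_all add: Hom_iff)
        then show "(h' \<cdot> b) \<cdot> \<iota>' i = h \<cdot> \<iota>' i" using h' i by (simp add: b\<iota> h\<iota>)
      qed (simp_all add: Hom_iff)
      then have "(h' \<cdot> b) \<cdot> a = h \<cdot> a" by simp
      then show "h' = h \<cdot> a" by (simp add: ba)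
    qed
  qed
qed

context
  fixes \<alpha> :: "'k rel" and C :: "'o set"
  assumes C: "C \<subseteq> Ob K" and closed: "closed_under_coproducts \<alpha> K C"
begin

lemma yonO_mod_object:
  assumes X: "X \<in> Ob K"
  shows "mod_object \<alpha> K C (yonO K X)"
proof (rule mod_objectI)
  show "comm_group (PO (yonO K X) c)" if "c \<in> C" for c
    using hom_comm_group C that X by auto
  show "PA (yonO K X) u \<in> hom (PO (yonO K X) d) (PO (yonO K X) c)" if "u \<in> Hom K c d" for c d u
    by (rule homI) (use that in \<open>simp_all add: Hom_iff\<close>)
  show "PA (yonO K X) (Idn K c) x = x" if "x \<in> carrier (PO (yonO K X) c)" for c x
    using that by (simp add: Hom_iff)
  show "PA (yonO K X) (v \<cdot> u) x = PA (yonO K X) u (PA (yonO K X) v x)"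
    if "u \<in> Hom K b c" "v \<in> Hom K c d" "x \<in> carrier (PO (yonO K X) d)" for b c d u v x
    using that by (simp add: Hom_iff)
next
  fix I :: "'k set" and X' Q \<iota> x y
  assume I: "|I| <o \<alpha>" and Q: "is_coproduct (full_sub K C) I X' Q \<iota>"
    and "x \<in> carrier (PO (yonO K X) Q)" "y \<in> carrier (PO (yonO K X) Q)"
    "\<And>i. i \<in> I \<Longrightarrow> PA (yonO K X) (\<iota> i) x = PA (yonO K X) (\<iota> i) y"
  then show "x = y"
    by (intro coproduct_ext[OF full_sub_coproduct[OF C closed I Q], of x X y]) simp_all
next
  fix I :: "'k set" and X' Q \<iota> r
  assume I: "|I| <o \<alpha>" and Q: "is_coproduct (full_sub K C) I X' Q \<iota>"
    and r: "\<And>i. i \<in> I \<Longrightarrow> r i \<in> carrier (PO (yonO K X) (X' i))"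
  have r': "r i \<in> Hom K (X' i) X" if "i \<in> I" for i using r[OF that] by simp
  obtain h where "h \<in> Hom K Q X" "\<And>i. i \<in> I \<Longrightarrow> h \<cdot> \<iota> i = r i"
    using coproduct_desc[OF full_sub_coproduct[OF C closed I Q] X r'] by blast
  then show "\<exists>x\<in>carrier (PO (yonO K X) Q). \<forall>i\<in>I. PA (yonO K X) (\<iota> i) x = r i" by auto
qed

lemma yonA_ar:
  assumes f: "f \<in> Ar K"
  shows "yonA K C f \<in> Ar (ModCat \<alpha> K C)"
proof -
  have "(\<lambda>c\<in>C. \<lambda>x\<in>carrier (PO (yonO K (Dom K f)) c). f \<cdot> x) \<in> mod_hom K C (yonO K (Dom K f)) (yonO K (Cod K f))"
  proof (rule mod_homI[OF yonO_mod_object])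
    show "(\<cdot>) f \<in> hom (PO (yonO K (Dom K f)) c) (PO (yonO K (Cod K f)) c)" for c
      by (rule homI) (use f in \<open>simp_all add: Hom_iff\<close>)
    show "f \<cdot> PA (yonO K (Dom K f)) u x = PA (yonO K (Cod K f)) u (f \<cdot> x)"
      if "u \<in> Hom K c d" "x \<in> carrier (PO (yonO K (Dom K f)) d)" for c d u x
      using that f by (simp add: Hom_iff)
  qed (use f in simp)
  then show ?thesis using yonO_mod_object f by (simp add: yonA_def)
qed

lemma yonA_epi_iff:
  assumes f: "f \<in> Ar K"
  shows "is_epi (ModCat \<alpha> K C) (yonA K C f) \<longleftrightarrow> (\<forall>S\<in>C. hom_surj K S f)"
proof -
  let ?\<eta> = "\<lambda>c\<in>C. \<lambda>x\<in>Hom K c (Dom K f). f \<cdot> x"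
  interpret mod_arrow \<alpha> K C "yonO K (Dom K f)" "yonO K (Cod K f)" ?\<eta>
    by (rule mod_arrow_of_ar) (use yonA_ar[OF f] in \<open>simp add: yonA_def\<close>)
  have into: "f \<cdot> x \<in> Hom K S (Cod K f)" if "x \<in> Hom K S (Dom K f)" for x S
    using that f by (simp add: Hom_iff)
  show ?thesis
  proof
    assume epi: "is_epi (ModCat \<alpha> K C) (yonA K C f)"
    show "\<forall>S\<in>C. hom_surj K S f"
    proof
      fix S assume S: "S \<in> C"
      have "y \<in> (\<lambda>s. f \<cdot> s) ` Hom K S (Dom K f)" if "y \<in> Hom K S (Cod K f)" for y
        using epi_surj[OF category_axioms C epi[unfolded yonA_def] S, of y] that S by simp
      then show "hom_surj K S f" using into unfolding hom_surj_def by blast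
    qed
  next
    assume surj: "\<forall>S\<in>C. hom_surj K S f"
    show "is_epi (ModCat \<alpha> K C) (yonA K C f)"
      unfolding yonA_def
    proof (rule surj_epi)
      fix c y assume c: "c \<in> C" and y: "y \<in> carrier (PO (yonO K (Cod K f)) c)"
      then have "y \<in> (\<lambda>s. f \<cdot> s) ` Hom K c (Dom K f)" using surj by (simp add: hom_surj_def)
      then show "y \<in> ?\<eta> c ` carrier (PO (yonO K (Dom K f)) c)" using c by simp
    qed
  qed
qed

lemma yonA_exactD:
  assumes f: "f \<in> Ar K" and g: "g \<in> Ar K" and fg: "Cod K f = Dom K g"
    and exact: "exact_at (ModCat \<alpha> K C) (yonA K C f) (yonA K C g)"
    and S: "S \<in> C" and y: "y \<in> Hom K S (Dom K g)" "g \<cdot> y = Zero K S (Cod K g)"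
  obtains x where "x \<in> Hom K S (Dom K f)" "f \<cdot> x = y"
proof -
  let ?f = "\<lambda>c\<in>C. \<lambda>x\<in>Hom K c (Dom K f). f \<cdot> x" and ?g = "\<lambda>c\<in>C. \<lambda>x\<in>Hom K c (Dom K g). g \<cdot> x"
  have "y \<in> ?f S ` carrier (PO (yonO K (Dom K f)) S)"
    by (rule exact_at_pointwise[OF category_axioms C _ _ exact[unfolded yonA_def fg] S])
      (use yonA_ar[OF f] yonA_ar[OF g] y S in \<open>simp_all add: yonA_def fg\<close>)
  then show thesis using that S by auto
qed

lemma yonA_exactI:
  assumes f: "f \<in> Ar K" and g: "g \<in> Ar K" and fg: "Cod K f = Dom K g"
    and zero: "g \<cdot> f = Zero K (Dom K f) (Cod K g)"
    and exact: "\<And>S y. \<lbrakk>S \<in> C; y \<in> Hom K S (Dom K g); g \<cdot> y = Zero K S (Cod K g)\<rbrakk>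
      \<Longrightarrow> \<exists>x \<in> Hom K S (Dom K f). f \<cdot> x = y"
  shows "exact_at (ModCat \<alpha> K C) (yonA K C f) (yonA K C g)"
  unfolding yonA_def fg
proof (rule exact_atI)
  show "(yonO K (Dom K f), yonO K (Dom K g), \<lambda>c\<in>C. \<lambda>x\<in>Hom K c (Dom K f). f \<cdot> x) \<in> Ar (ModCat \<alpha> K C)"
    using yonA_ar[OF f] by (simp add: yonA_def fg)
  show "(yonO K (Dom K g), yonO K (Cod K g), \<lambda>c\<in>C. \<lambda>x\<in>Hom K c (Dom K g). g \<cdot> x) \<in> Ar (ModCat \<alpha> K C)"
    using yonA_ar[OF g] by (simp add: yonA_def)
next
  fix c x assume c: "c \<in> C" and "x \<in> carrier (PO (yonO K (Dom K f)) c)"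
  then have x: "x \<in> Ar K" "Dom K x = c" "Cod K x = Dom K f" by (simp_all add: Hom_iff)
  have "g \<cdot> (f \<cdot> x) = Zero K c (Cod K g)"
    using comp_reduce[OF zero g f fg x(1,3)] x f g by simp
  then show "(\<lambda>c\<in>C. \<lambda>x\<in>Hom K c (Dom K g). g \<cdot> x) c ((\<lambda>c\<in>C. \<lambda>x\<in>Hom K c (Dom K f). f \<cdot> x) c x)
      = \<one>\<^bsub>PO (yonO K (Cod K g)) c\<^esub>"
    using c x f fg by (simp add: Hom_iff)
next
  fix c y assume c: "c \<in> C" and y: "y \<in> carrier (PO (yonO K (Dom K g)) c)"
    and "(\<lambda>c\<in>C. \<lambda>x\<in>Hom K c (Dom K g). g \<cdot> x) c y = \<one>\<^bsub>PO (yonO K (Cod K g)) c\<^esub>"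
  then have "g \<cdot> y = Zero K c (Cod K g)" by simp
  with y obtain x where "x \<in> Hom K c (Dom K f)" "f \<cdot> x = y" using exact[OF c, of y] by auto
  then show "y \<in> (\<lambda>c\<in>C. \<lambda>x\<in>Hom K c (Dom K f). f \<cdot> x) c ` carrier (PO (yonO K (Dom K f)) c)"
    using c by auto
qed

end

end

section \<open>The categories of Postnikov systems and resolutions\<close>

lemma prevA_simps [simp]: "prevA K \<psi> 0 = Idn K (zero_ob K)" "prevA K \<psi> (Suc n) = \<psi> n"
  by (simp_all add: prevA_def)

lemma forgetO_simps [simp]:
  "tX (forgetO A) = tX A" "tP (forgetO A) = tP A" "tf (forgetO A) = tf A"
  "ti (forgetO A) = ti A" "tq (forgetO A) = tq A"
  by (simp_all add: forgetO_def)

lemma prevO_forgetO [simp]: "prevO K (forgetO A) = prevO K A"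
proof
  show "prevO K (forgetO A) n = prevO K A n" for n by (cases n) (simp_all add: prevO_def)
qed

lemma forgetO_postnikov [simp]:
  "differential K (forgetO A) = differential K A"
  "postnikov_tower \<kappa> T C (forgetO A) = postnikov_tower \<kappa> T C A"
  "post_hom T (forgetO A) (forgetO B) = post_hom T A B"
  by (simp_all add: fun_eq_iff differential_def postnikov_tower_def post_hom_def)

locale postnikov_setting = perfectly_generated T \<kappa> C
  for T :: "('o, 'm, 'z) tricat_scheme" (structure) and \<kappa> :: "'k rel" and C :: "'o set" +
  fixes \<alpha> :: "'k rel"
  assumes coproduct_closed: "closed_under_coproducts \<alpha> T C"
begin

abbreviation "is_tower \<equiv> postnikov_tower \<kappa> T C"
abbreviation "is_system \<equiv> postnikov_system \<kappa> \<alpha> T C"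
abbreviation "is_resolution \<equiv> postnikov_resolution \<kappa> \<alpha> T C"
abbreviation "ModC \<equiv> ModCat \<alpha> T C"
abbreviation "Sys \<equiv> Post \<kappa> \<alpha> T C"
abbreviation "Res \<equiv> Pres \<kappa> \<alpha> T C"
abbreviation "sys_homotopy \<equiv> post_homotopy \<kappa> \<alpha> T C"
abbreviation "res_homotopy \<equiv> pres_homotopy \<kappa> \<alpha> T C"
abbreviation "hSys \<equiv> hPost \<kappa> \<alpha> T C"
abbreviation "hRes \<equiv> hPres \<kappa> \<alpha> T C"

lemma C_Ob: "C \<subseteq> Ob T"
  by auto

lemma resolutionD:
  assumes "is_resolution A"
  shows "is_tower A" "rX A \<in> Ob T" "rp A n \<in> Hom T (tX A n) (SigO T (rX A))"
    "rp A n = rp A (Suc n) \<cdot> ti A (Suc n)"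
    "projective ModC (yonO T (tP A n))"
    "is_epi ModC (yonA T C (augmentation T A))"
    "exact_at ModC (yonA T C (differential T A 0)) (yonA T C (augmentation T A))"
    "exact_at ModC
      (yonA T C (differential T A (Suc n))) (yonA T C (SigA T (differential T A n)))"
proof -
  note * = assms[unfolded postnikov_resolution_def]
  show "is_tower A"
    by (rule *[THEN conjunct1])
  show "rX A \<in> Ob T"
    by (rule *[THEN conjunct2, THEN conjunct1])
  show "rp A n \<in> Hom T (tX A n) (SigO T (rX A))"
    by (rule *[THEN conjunct2, THEN conjunct2, THEN conjunct1, THEN spec])
  show "rp A n = rp A (Suc n) \<cdot> ti A (Suc n)"
    by (rule *[THEN conjunct2, THEN conjunct2, THEN conjunct2, THEN conjunct1, THEN spec])
  show "projective ModC (yonO T (tP A n))"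
    by (rule *[THEN conjunct2, THEN conjunct2, THEN conjunct2, THEN conjunct2, THEN conjunct1, THEN spec])
  show "is_epi ModC (yonA T C (augmentation T A))"
    by (rule *[THEN conjunct2, THEN conjunct2, THEN conjunct2, THEN conjunct2, THEN conjunct2, THEN conjunct1])
  show "exact_at ModC (yonA T C (differential T A 0)) (yonA T C (augmentation T A))"
    by (rule *[THEN conjunct2, THEN conjunct2, THEN conjunct2, THEN conjunct2, THEN conjunct2, THEN conjunct2, THEN conjunct1])
  show "exact_at ModC
      (yonA T C (differential T A (Suc n))) (yonA T C (SigA T (differential T A n)))"
    by (rule *[THEN conjunct2, THEN conjunct2, THEN conjunct2, THEN conjunct2, THEN conjunct2, THEN conjunct2, THEN conjunct2, THEN spec])
qed

lemmas resolution_tower = resolutionD(1)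

lemma resolution_typed:
  assumes "is_resolution A"
  shows "rp A n \<in> Ar T" "Dom T (rp A n) = tX A n" "Cod T (rp A n) = SigO T (rX A)" "rX A \<in> Ob T"
  using resolutionD(2,3)[OF assms] by (simp_all add: Hom_iff)

lemma post_hom_typed:
  assumes "(\<psi>, \<phi>) \<in> post_hom T A B"
  shows "\<psi> n \<in> Ar T" "Dom T (\<psi> n) = tX A n" "Cod T (\<psi> n) = tX B n"
    "\<phi> n \<in> Ar T" "Dom T (\<phi> n) = tP A n" "Cod T (\<phi> n) = tP B n"
    "prevA T \<psi> n \<in> Ar T" "Dom T (prevA T \<psi> n) = prevO T A n" "Cod T (prevA T \<psi> n) = prevO T B n"
proof -
  show *: "\<psi> n \<in> Ar T" "Dom T (\<psi> n) = tX A n" "Cod T (\<psi> n) = tX B n"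
    "\<phi> n \<in> Ar T" "Dom T (\<phi> n) = tP A n" "Cod T (\<phi> n) = tP B n" for n
    using assms by (simp_all add: post_hom_def Hom_iff)
  show "prevA T \<psi> n \<in> Ar T" "Dom T (prevA T \<psi> n) = prevO T A n" "Cod T (prevA T \<psi> n) = prevO T B n"
    using * by (cases n; simp add: prevO_def)+
qed

lemma post_hom_squares:
  assumes "(\<psi>, \<phi>) \<in> post_hom T A B"
  shows "tf B n \<cdot> \<phi> n = prevA T \<psi> n \<cdot> tf A n" "ti B n \<cdot> prevA T \<psi> n = \<psi> n \<cdot> ti A n"
    "tq B n \<cdot> \<psi> n = SigA T (\<phi> n) \<cdot> tq A n"
  using assms by (simp_all add: post_hom_def)

lemma post_hom_idn:
  assumes A: "is_tower A"
  shows "(\<lambda>n. Idn T (tX A n), \<lambda>n. Idn T (tP A n)) \<in> post_hom T A A"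
proof -
  note [simp] = postnikov_tower_typed[OF A]
  have [simp]: "tX A n \<in> Ob T" "tP A n \<in> Ob T" for n
    using dom_ob[of "tq A n"] dom_ob[of "tf A n"] by simp_all
  have [simp]: "prevA T (\<lambda>n. Idn T (tX A n)) n = Idn T (prevO T A n)" for n
    by (cases n) (simp_all add: prevO_def)
  show ?thesis by (simp add: post_hom_def Hom_iff)
qed

lemma post_hom_comp:
  assumes A: "is_tower A" and B: "is_tower B" and D: "is_tower D"
    and f: "(\<psi>, \<phi>) \<in> post_hom T A B" and g: "(\<psi>', \<phi>') \<in> post_hom T B D"
  shows "(\<lambda>n. \<psi>' n \<cdot> \<psi> n, \<lambda>n. \<phi>' n \<cdot> \<phi> n) \<in> post_hom T A D"
proof -
  note [simp] = postnikov_tower_typed[OF A] postnikov_tower_typed[OF B] postnikov_tower_typed[OF D]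
    post_hom_typed[OF f] post_hom_typed[OF g]
  note f_sq = post_hom_squares[OF f] and g_sq = post_hom_squares[OF g]
  have prev: "prevA T (\<lambda>n. \<psi>' n \<cdot> \<psi> n) n = prevA T \<psi>' n \<cdot> prevA T \<psi> n" for n
    by (cases n) simp_all
  have "tf D n \<cdot> (\<phi>' n \<cdot> \<phi> n) = prevA T (\<lambda>n. \<psi>' n \<cdot> \<psi> n) n \<cdot> tf A n" for n
    by (simp add: prev comp_reduce[OF g_sq(1)] f_sq(1))
  moreover have "ti D n \<cdot> prevA T (\<lambda>n. \<psi>' n \<cdot> \<psi> n) n = (\<psi>' n \<cdot> \<psi> n) \<cdot> ti A n" for n
    by (simp add: prev comp_reduce[OF g_sq(2)] f_sq(2))
  moreover have "tq D n \<cdot> (\<psi>' n \<cdot> \<psi> n) = SigA T (\<phi>' n \<cdot> \<phi> n) \<cdot> tq A n" for n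
    by (simp add: comp_reduce[OF g_sq(3)] f_sq(3))
  ultimately show ?thesis by (simp add: post_hom_def Hom_iff del: comp_assoc_typed sus_comp)
qed

lemma res_hom_comp:
  assumes A: "is_resolution A" and B: "is_resolution B"
    and D: "is_resolution D"
    and f: "(h, \<psi>, \<phi>) \<in> res_hom T A B" and g: "(h', \<psi>', \<phi>') \<in> res_hom T B D"
  shows "(h' \<cdot> h, \<lambda>n. \<psi>' n \<cdot> \<psi> n, \<lambda>n. \<phi>' n \<cdot> \<phi> n) \<in> res_hom T A D"
proof -
  have f': "(\<psi>, \<phi>) \<in> post_hom T A B" and g': "(\<psi>', \<phi>') \<in> post_hom T B D"
    using f g by (simp_all add: res_hom_def)
  have p: "(\<lambda>n. \<psi>' n \<cdot> \<psi> n, \<lambda>n. \<phi>' n \<cdot> \<phi> n) \<in> post_hom T A D"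
    by (rule post_hom_comp[OF resolution_tower[OF A] resolution_tower[OF B] resolution_tower[OF D] f' g'])
  have h [simp]: "h \<in> Ar T" "Dom T h = rX A" "Cod T h = rX B" "h' \<in> Ar T" "Dom T h' = rX B" "Cod T h' = rX D"
    using f g by (simp_all add: res_hom_def Hom_iff)
  note [simp] = resolution_typed[OF A] resolution_typed[OF B] resolution_typed[OF D]
  have sq: "rp B n \<cdot> \<psi> n = SigA T h \<cdot> rp A n" "rp D n \<cdot> \<psi>' n = SigA T h' \<cdot> rp B n" for n
    using f g by (simp_all add: res_hom_def)
  note [simp] = post_hom_typed[OF f'] post_hom_typed[OF g']
  have "rp D n \<cdot> (\<psi>' n \<cdot> \<psi> n) = SigA T (h' \<cdot> h) \<cdot> rp A n" for n
    by (simp add: sq comp_reduce[OF sq(2)])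
  then show ?thesis using p by (simp add: res_hom_def Hom_iff del: sus_comp comp_assoc_typed)
qed

lemma Post_simps [simp]:
  "Ob Sys = {A. is_system A}"
  "(A, B, m) \<in> Ar Sys \<longleftrightarrow>
    is_system A \<and> is_system B \<and> m \<in> post_hom T A B"
  "Dom Sys (A, B, m) = A" "Cod Sys (A, B, m) = B"
  "Idn Sys A = (A, A, \<lambda>n. Idn T (tX A n), \<lambda>n. Idn T (tP A n))"
  "(B', D, \<psi>', \<phi>') \<cdot>\<^bsub>Sys\<^esub> (A, B, \<psi>, \<phi>) = (A, D, \<lambda>n. \<psi>' n \<cdot> \<psi> n, \<lambda>n. \<phi>' n \<cdot> \<phi> n)"
  by (cases m, auto simp: Post_def)+

lemma Pres_simps [simp]:
  "Ob Res = {A. is_resolution A}"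
  "(A, B, m) \<in> Ar Res \<longleftrightarrow>
    is_resolution A \<and> is_resolution B \<and> m \<in> res_hom T A B"
  "Dom Res (A, B, m) = A" "Cod Res (A, B, m) = B"
  "Idn Res A = (A, A, Idn T (rX A), \<lambda>n. Idn T (tX A n), \<lambda>n. Idn T (tP A n))"
  "(B', D, h', \<psi>', \<phi>') \<cdot>\<^bsub>Res\<^esub> (A, B, h, \<psi>, \<phi>) =
    (A, D, h' \<cdot> h, \<lambda>n. \<psi>' n \<cdot> \<psi> n, \<lambda>n. \<phi>' n \<cdot> \<phi> n)"
  by (cases m, auto simp: Pres_def)+

lemma post_hom_Sys:
  "f \<in> Hom Sys A B \<longleftrightarrow> (\<exists>\<psi> \<phi>. f = (A, B, \<psi>, \<phi>) \<and> is_system A \<and>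
    is_system B \<and> (\<psi>, \<phi>) \<in> post_hom T A B)"
  by (cases f) (auto simp: Hom_iff)

lemma pres_hom_Res:
  "f \<in> Hom Res A B \<longleftrightarrow> (\<exists>h \<psi> \<phi>. f = (A, B, h, \<psi>, \<phi>) \<and> is_resolution A \<and>
    is_resolution B \<and> (h, \<psi>, \<phi>) \<in> res_hom T A B)"
  by (cases f) (auto simp: Hom_iff)

lemma system_tower: "is_system A \<Longrightarrow> is_tower A"
  by (simp add: postnikov_system_def)

lemma category_Sys: "category Sys"
proof
  show "Dom Sys f \<in> Ob Sys" "Cod Sys f \<in> Ob Sys" if "f \<in> Ar Sys" for f
    using that by (cases f; simp)+
  show "Idn Sys A \<in> Hom Sys A A" if "A \<in> Ob Sys" for A
    using that post_hom_idn[OF system_tower] by (simp add: Hom_iff)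
  show "g \<cdot>\<^bsub>Sys\<^esub> f \<in> Hom Sys A D" if prems: "f \<in> Hom Sys A B" "g \<in> Hom Sys B D" for f g A B D
  proof -
    obtain \<psi> \<phi> \<psi>' \<phi>' where *: "f = (A, B, \<psi>, \<phi>)" "g = (B, D, \<psi>', \<phi>')"
      "is_system A" "is_system B" "is_system D"
      "(\<psi>, \<phi>) \<in> post_hom T A B" "(\<psi>', \<phi>') \<in> post_hom T B D"
      using prems unfolding post_hom_Sys by blast
    show ?thesis
      using post_hom_comp[OF system_tower[OF *(3)] system_tower[OF *(4)] system_tower[OF *(5)] *(6,7)] *
      by (simp add: Hom_iff)
  qed
  show "(h \<cdot>\<^bsub>Sys\<^esub> g) \<cdot>\<^bsub>Sys\<^esub> f = h \<cdot>\<^bsub>Sys\<^esub> (g \<cdot>\<^bsub>Sys\<^esub> f)"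
    if prems: "f \<in> Hom Sys A B" "g \<in> Hom Sys B D" "h \<in> Hom Sys D E" for f g h A B D E
  proof -
    obtain \<psi> \<phi> \<psi>' \<phi>' \<psi>'' \<phi>'' where *: "f = (A, B, \<psi>, \<phi>)" "g = (B, D, \<psi>', \<phi>')" "h = (D, E, \<psi>'', \<phi>'')"
      "(\<psi>, \<phi>) \<in> post_hom T A B" "(\<psi>', \<phi>') \<in> post_hom T B D" "(\<psi>'', \<phi>'') \<in> post_hom T D E"
      using prems unfolding post_hom_Sys by blast
    show ?thesis
      using post_hom_typed[OF *(4)] post_hom_typed[OF *(5)] post_hom_typed[OF *(6)] *(1-3) by simp
  qed
  show "Idn Sys B \<cdot>\<^bsub>Sys\<^esub> f = f" "f \<cdot>\<^bsub>Sys\<^esub> Idn Sys A = f" if prems: "f \<in> Hom Sys A B" for f A B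
  proof -
    obtain \<psi> \<phi> where *: "f = (A, B, \<psi>, \<phi>)" "(\<psi>, \<phi>) \<in> post_hom T A B"
      using prems unfolding post_hom_Sys by blast
    show "Idn Sys B \<cdot>\<^bsub>Sys\<^esub> f = f" "f \<cdot>\<^bsub>Sys\<^esub> Idn Sys A = f"
      using post_hom_typed[OF *(2)] *(1) by simp_all
  qed
qed

lemma res_hom_typed:
  assumes "(h, \<psi>, \<phi>) \<in> res_hom T A B"
  shows "h \<in> Ar T" "Dom T h = rX A" "Cod T h = rX B" "(\<psi>, \<phi>) \<in> post_hom T A B"
  using assms by (simp_all add: res_hom_def Hom_iff)

lemma category_Res: "category Res"
proof
  show "Dom Res f \<in> Ob Res" "Cod Res f \<in> Ob Res" if "f \<in> Ar Res" for f
    using that by (cases f; simp)+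
  show "Idn Res A \<in> Hom Res A A" if A: "A \<in> Ob Res" for A
  proof -
    have A': "is_resolution A" using A by simp
    show ?thesis
      using A' resolution_typed[OF A'] post_hom_idn[OF resolution_tower[OF A']] by (simp add: Hom_iff res_hom_def)
  qed
  show "g \<cdot>\<^bsub>Res\<^esub> f \<in> Hom Res A D" if prems: "f \<in> Hom Res A B" "g \<in> Hom Res B D" for f g A B D
  proof -
    obtain h \<psi> \<phi> h' \<psi>' \<phi>' where *: "f = (A, B, h, \<psi>, \<phi>)" "g = (B, D, h', \<psi>', \<phi>')"
      "is_resolution A" "is_resolution B" "is_resolution D"
      "(h, \<psi>, \<phi>) \<in> res_hom T A B" "(h', \<psi>', \<phi>') \<in> res_hom T B D"
      using prems unfolding pres_hom_Res by blast
    show ?thesis using res_hom_comp[OF *(3-7)] * by (simp add: Hom_iff)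
  qed
  show "(h \<cdot>\<^bsub>Res\<^esub> g) \<cdot>\<^bsub>Res\<^esub> f = h \<cdot>\<^bsub>Res\<^esub> (g \<cdot>\<^bsub>Res\<^esub> f)"
    if prems: "f \<in> Hom Res A B" "g \<in> Hom Res B D" "h \<in> Hom Res D E" for f g h A B D E
  proof -
    obtain k \<psi> \<phi> k' \<psi>' \<phi>' k'' \<psi>'' \<phi>'' where *: "f = (A, B, k, \<psi>, \<phi>)" "g = (B, D, k', \<psi>', \<phi>')"
      "h = (D, E, k'', \<psi>'', \<phi>'')"
      "(k, \<psi>, \<phi>) \<in> res_hom T A B" "(k', \<psi>', \<phi>') \<in> res_hom T B D" "(k'', \<psi>'', \<phi>'') \<in> res_hom T D E"
      using prems unfolding pres_hom_Res by blast
    note 1 = res_hom_typed[OF *(4)] and 2 = res_hom_typed[OF *(5)] and 3 = res_hom_typed[OF *(6)]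
    show ?thesis
      using post_hom_typed[OF 1(4)] post_hom_typed[OF 2(4)] post_hom_typed[OF 3(4)] 1(1-3) 2(1-3) 3(1-3) *(1-3)
      by simp
  qed
  show "Idn Res B \<cdot>\<^bsub>Res\<^esub> f = f" "f \<cdot>\<^bsub>Res\<^esub> Idn Res A = f" if prems: "f \<in> Hom Res A B" for f A B
  proof -
    obtain h \<psi> \<phi> where *: "f = (A, B, h, \<psi>, \<phi>)" "(h, \<psi>, \<phi>) \<in> res_hom T A B"
      using prems unfolding pres_hom_Res by blast
    note 1 = res_hom_typed[OF *(2)]
    show "Idn Res B \<cdot>\<^bsub>Res\<^esub> f = f" "f \<cdot>\<^bsub>Res\<^esub> Idn Res A = f"
      using post_hom_typed[OF 1(4)] 1(1-3) *(1) by simp_all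
  qed
qed

lemma post_homotopy_iff [simp]:
  "((A, B, \<psi>, \<phi>), (A', B', \<psi>', \<phi>')) \<in> sys_homotopy \<longleftrightarrow>
    (A, B, \<psi>, \<phi>) \<in> Ar Sys \<and> (A', B', \<psi>', \<phi>') \<in> Ar Sys \<and> A = A' \<and> B = B' \<and>
    (\<forall>n > 0. \<psi> n \<cdot> ti A n = \<psi>' n \<cdot> ti A n)"
  by (auto simp: post_homotopy_def simp del: Post_simps)

lemma pres_homotopy_iff [simp]:
  "((A, B, h, \<psi>, \<phi>), (A', B', h', \<psi>', \<phi>')) \<in> res_homotopy \<longleftrightarrow>
    (A, B, h, \<psi>, \<phi>) \<in> Ar Res \<and> (A', B', h', \<psi>', \<phi>') \<in> Ar Res \<and> A = A' \<and> B = B' \<and>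
    (\<forall>n > 0. \<psi> n \<cdot> ti A n = \<psi>' n \<cdot> ti A n)"
  by (auto simp: pres_homotopy_def simp del: Pres_simps)

text \<open>A homotopy of the second factor is seen only after composition with \<open>ti B n\<close>.  The square for \<open>\<psi>'\<close>
  provides this composition, because \<open>\<psi>' n \<cdot> ti A n\<close> factors through \<open>ti B n\<close>.\<close>

lemma homotopy_comp:
  assumes A: "is_tower A" and B: "is_tower B"
    and f: "(\<psi>, \<phi>) \<in> post_hom T A B" "(\<psi>', \<phi>') \<in> post_hom T A B"
    and g: "(\<chi>, \<omega>) \<in> post_hom T B D" "(\<chi>', \<omega>') \<in> post_hom T B D"
    and ff': "\<forall>n > 0. \<psi> n \<cdot> ti A n = \<psi>' n \<cdot> ti A n" and gg': "\<forall>n > 0. \<chi> n \<cdot> ti B n = \<chi>' n \<cdot> ti B n"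
    and n: "n > 0"
  shows "(\<chi> n \<cdot> \<psi> n) \<cdot> ti A n = (\<chi>' n \<cdot> \<psi>' n) \<cdot> ti A n"
proof -
  note typed = postnikov_tower_typed[OF A] postnikov_tower_typed[OF B] post_hom_typed[OF f(1)]
    post_hom_typed[OF f(2)] post_hom_typed[OF g(1)] post_hom_typed[OF g(2)]
  have "(\<chi> n \<cdot> \<psi> n) \<cdot> ti A n = \<chi> n \<cdot> (\<psi>' n \<cdot> ti A n)" using ff' n typed by simp
  also have "\<dots> = (\<chi> n \<cdot> ti B n) \<cdot> prevA T \<psi>' n"
    using typed by (simp add: post_hom_squares(2)[OF f(2)])
  also have "\<dots> = (\<chi>' n \<cdot> ti B n) \<cdot> prevA T \<psi>' n" using gg' n by simp
  also have "\<dots> = (\<chi>' n \<cdot> \<psi>' n) \<cdot> ti A n"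
    using typed by (simp add: post_hom_squares(2)[OF f(2)])
  finally show ?thesis .
qed

lemma congruence_Sys: "congruence Sys sys_homotopy"
proof (intro congruence.intro congruence_axioms.intro)
  show "category Sys" by (rule category_Sys)
  show "equiv (Ar Sys) sys_homotopy"
    unfolding equiv_def refl_on_def sym_def trans_def by (simp add: split_paired_all) auto
  show "Dom Sys f = Dom Sys f' \<and> Cod Sys f = Cod Sys f'" if "(f, f') \<in> sys_homotopy" for f f'
    using that by (cases f; cases f') simp
  show "(g \<cdot>\<^bsub>Sys\<^esub> f, g' \<cdot>\<^bsub>Sys\<^esub> f') \<in> sys_homotopy"
    if ff': "(f, f') \<in> sys_homotopy" and gg': "(g, g') \<in> sys_homotopy"
      and fg: "Cod Sys f = Dom Sys g" for f f' g g'
  proof -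
    obtain A B \<psi> \<phi> where f: "f = (A, B, \<psi>, \<phi>)" by (cases f)
    obtain \<psi>' \<phi>' where f': "f' = (A, B, \<psi>', \<phi>')" using ff' by (cases f') (simp add: f)
    obtain D \<chi> \<omega> where g: "g = (B, D, \<chi>, \<omega>)" using fg by (cases g) (simp add: f)
    obtain \<chi>' \<omega>' where g': "g' = (B, D, \<chi>', \<omega>')" using gg' by (cases g') (simp add: g)
    have sys: "is_system A" "is_system B" "is_system D"
      using ff' gg' by (simp_all add: f f' g g')
    note towers = system_tower[OF sys(1)] system_tower[OF sys(2)] system_tower[OF sys(3)]
    have m: "(\<psi>, \<phi>) \<in> post_hom T A B" "(\<psi>', \<phi>') \<in> post_hom T A B"
      "(\<chi>, \<omega>) \<in> post_hom T B D" "(\<chi>', \<omega>') \<in> post_hom T B D"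
      and h: "\<forall>n > 0. \<psi> n \<cdot> ti A n = \<psi>' n \<cdot> ti A n" "\<forall>n > 0. \<chi> n \<cdot> ti B n = \<chi>' n \<cdot> ti B n"
      using ff' gg' by (simp_all add: f f' g g')
    show ?thesis
      using homotopy_comp[OF towers(1,2) m h] post_hom_comp[OF towers m(1,3)] post_hom_comp[OF towers m(2,4)] sys
      by (simp add: f f' g g' del: comp_assoc_typed)
  qed
qed

lemma congruence_Res: "congruence Res res_homotopy"
proof (intro congruence.intro congruence_axioms.intro)
  show "category Res"by (rule category_Res)
  show "equiv (Ar Res) res_homotopy"
    unfolding equiv_def refl_on_def sym_def trans_def by (simp add: split_paired_all) auto
  show "Dom Res f = Dom Res f' \<and> Cod Res f = Cod Res f'" if "(f, f') \<in> res_homotopy" for f f'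
    using that by (cases f; cases f') simp
  show "(g \<cdot>\<^bsub>Res\<^esub> f, g' \<cdot>\<^bsub>Res\<^esub> f') \<in> res_homotopy"
    if ff': "(f, f') \<in> res_homotopy" and gg': "(g, g') \<in> res_homotopy"
      and fg: "Cod Res f = Dom Res g" for f f' g g'
  proof -
    obtain A B k \<psi> \<phi> where f: "f = (A, B, k, \<psi>, \<phi>)" by (cases f)
    obtain k' \<psi>' \<phi>' where f': "f' = (A, B, k', \<psi>', \<phi>')" using ff' by (cases f') (simp add: f)
    obtain D l \<chi> \<omega> where g: "g = (B, D, l, \<chi>, \<omega>)" using fg by (cases g) (simp add: f)
    obtain l' \<chi>' \<omega>' where g': "g' = (B, D, l', \<chi>', \<omega>')" using gg' by (cases g') (simp add: g)
    have res: "is_resolution A" "is_resolution B"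
      "is_resolution D"
      using ff' gg' by (simp_all add: f f' g g')
    have m: "(k, \<psi>, \<phi>) \<in> res_hom T A B" "(k', \<psi>', \<phi>') \<in> res_hom T A B"
      "(l, \<chi>, \<omega>) \<in> res_hom T B D" "(l', \<chi>', \<omega>') \<in> res_hom T B D"
      and h: "\<forall>n > 0. \<psi> n \<cdot> ti A n = \<psi>' n \<cdot> ti A n" "\<forall>n > 0. \<chi> n \<cdot> ti B n = \<chi>' n \<cdot> ti B n"
      using ff' gg' by (simp_all add: f f' g g')
    note m' = m[THEN res_hom_typed(4)]
    show ?thesis
      using homotopy_comp[OF resolution_tower[OF res(1)] resolution_tower[OF res(2)] m' h]
        res_hom_comp[OF res m(1,3)] res_hom_comp[OF res m(2,4)] res
      by (simp add: f f' g g' del: comp_assoc_typed)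
  qed
qed

section \<open>The forgetful functor\<close>

lemma differential_typed:
  assumes "is_tower A"
  shows "differential T A n \<in> Ar T" "Dom T (differential T A n) = tP A (Suc n)"
    "Cod T (differential T A n) = SigO T (tP A n)"
  using postnikov_tower_typed[OF assms] by (simp_all add: differential_def prevO_def)

lemma exact_tower:
  assumes A: "is_tower A"
    and exact: "\<And>n. exact_at ModC
        (yonA T C (differential T A (Suc n))) (yonA T C (SigA T (differential T A n)))"
  shows "exact_tower T \<kappa> C A"
proof (intro exact_tower.intro exact_tower_axioms.intro)
  show "perfectly_generated T \<kappa> C" by (rule perfectly_generated_axioms)
  show "is_tower A" by (rule A)
  note [simp] = differential_typed[OF A]
  fix S z n assume S: "S \<in> C" and z: "z \<in> Hom T S (SigO T (tP A (Suc n)))"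
    and zero: "SigA T (differential T A n) \<cdot> z = Zero T S (SigO T (SigO T (tP A n)))"
  show "\<exists>y\<in>Hom T S (tP A (Suc (Suc n))). differential T A (Suc n) \<cdot> y = z"
  proof (rule yonA_exactD[OF C_Ob coproduct_closed _ _ _ exact[of n] S, of z])
    fix y assume "y \<in> Hom T S (Dom T (differential T A (Suc n)))" "differential T A (Suc n) \<cdot> y = z"
    then show ?thesis by auto
  qed (use z zero in simp_all)
qed

lemma system_exact_tower: "is_system A \<Longrightarrow> exact_tower T \<kappa> C A"
  by (rule exact_tower) (simp_all add: postnikov_system_def)

lemma resolution_exact_tower: "is_resolution A \<Longrightarrow> exact_tower T \<kappa> C A"
  by (rule exact_tower[OF resolutionD(1,8)])

lemma system_of_resolution:
  assumes "is_resolution A"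
  shows "is_system (forgetO A)"
  using resolutionD(1,5,8)[OF assms] by (simp add: postnikov_system_def)

lemma augmentation_typed:
  assumes A: "exact_tower T \<kappa> C A" and p: "rp A 0 \<in> Hom T (tX A 0) (SigO T (rX A))"
  shows "augmentation T A \<in> Ar T" "Dom T (augmentation T A) = SigO T (tP A 0)"
    "Cod T (augmentation T A) = SigO T (rX A)" "augmentation T A \<cdot> tq A 0 = rp A 0"
proof -
  interpret A: exact_tower T \<kappa> C A by (rule A)
  have q: "inv_ar T (tq A 0) \<in> Ar T" "Dom T (inv_ar T (tq A 0)) = SigO T (tP A 0)"
    "Cod T (inv_ar T (tq A 0)) = tX A 0" "inv_ar T (tq A 0) \<cdot> tq A 0 = Idn T (tX A 0)"
    using A.tq_0_iso by (simp_all add: inverse_ars_def Hom_iff)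
  then show "augmentation T A \<in> Ar T" "Dom T (augmentation T A) = SigO T (tP A 0)"
    "Cod T (augmentation T A) = SigO T (rX A)" "augmentation T A \<cdot> tq A 0 = rp A 0"
    using p by (simp_all add: augmentation_def Hom_iff)
qed

text \<open>Augmentation and \<open>rp A 0\<close> differ by the isomorphism \<open>tq A 0\<close>, under which the differential
  \<open>tq A 0 \<cdot> tf A 1\<close> corresponds to \<open>tf A 1\<close>, whose image is the kernel of \<open>ti A 1\<close>.\<close>

lemma resolution_augmentation:
  assumes A: "is_resolution A" and S: "S \<in> C"
  shows "hom_surj T S (rp A 0)"
    "\<lbrakk>x \<in> Hom T S (tX A 0); rp A 0 \<cdot> x = Zero T S (SigO T (rX A))\<rbrakk>
      \<Longrightarrow> ti A (Suc 0) \<cdot> x = Zero T S (tX A (Suc 0))"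
proof -
  interpret A: exact_tower T \<kappa> C A by (rule resolution_exact_tower[OF A])
  note a [simp] = augmentation_typed[OF A.exact_tower_axioms resolutionD(3)[OF A]]
  note [simp] = resolution_typed[OF A] A.tower_typed differential_typed[OF A.tower]
  have q: "inv_ar T (tq A 0) \<in> Ar T" "Dom T (inv_ar T (tq A 0)) = SigO T (tP A 0)"
    "Cod T (inv_ar T (tq A 0)) = tX A 0" "inv_ar T (tq A 0) \<cdot> tq A 0 = Idn T (tX A 0)"
    using A.tq_0_iso by (simp_all add: inverse_ars_def Hom_iff)
  note [simp] = q(1-3)
  have surj: "hom_surj T S (augmentation T A)"
    using yonA_epi_iff[OF C_Ob coproduct_closed a(1)] resolutionD(6)[OF A] S by simp
  show "hom_surj T S (rp A 0)"
  proof (rule hom_surjI)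
    fix y assume "y \<in> Hom T S (Cod T (rp A 0))"
    then obtain z where z: "z \<in> Hom T S (SigO T (tP A 0))" "augmentation T A \<cdot> z = y"
      using hom_surjE[OF surj, of y] by auto
    then show "\<exists>x\<in>Hom T S (Dom T (rp A 0)). rp A 0 \<cdot> x = y"
      by (intro bexI[of _ "inv_ar T (tq A 0) \<cdot> z"]) (simp_all add: Hom_iff augmentation_def)
  qed simp
  assume x: "x \<in> Hom T S (tX A 0)" and zero: "rp A 0 \<cdot> x = Zero T S (SigO T (rX A))"
  note [simp] = hom_typed[OF x]
  have "augmentation T A \<cdot> (tq A 0 \<cdot> x) = Zero T S (SigO T (rX A))"
    using zero by (simp add: comp_reduce[OF a(4)])
  then obtain y where y: "y \<in> Hom T S (tP A (Suc 0))" "differential T A 0 \<cdot> y = tq A 0 \<cdot> x"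
    using yonA_exactD[OF C_Ob coproduct_closed _ _ _ resolutionD(7)[OF A] S, of "tq A 0 \<cdot> x"]
    by (auto simp: Hom_iff)
  note [simp] = hom_typed[OF y(1)]
  have "inv_ar T (tq A 0) \<cdot> (tq A 0 \<cdot> (tf A (Suc 0) \<cdot> y)) = inv_ar T (tq A 0) \<cdot> (tq A 0 \<cdot> x)"
    using y(2) by (simp add: differential_def)
  then have "tf A (Suc 0) \<cdot> y = x" by (simp add: comp_reduce[OF q(4)])
  then show "ti A (Suc 0) \<cdot> x = Zero T S (tX A (Suc 0))"
    using comp_reduce[OF A.ti_tf[of 0], of y] S by simp
qed

text \<open>Up to isomorphism, the homotopy colimit is a suspension \<open>\<Sigma>Y\<close>, and \<open>Y\<close> is the object to be resolved.\<close>

lemma resolution_exists: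
  assumes A: "is_system A"
  obtains A' where "is_resolution A'" "forgetO A' = A"
proof -
  interpret A: exact_tower T \<kappa> C A by (rule system_exact_tower[OF A])
  note [simp] = A.tower_typed differential_typed[OF A.tower]
  show thesis
  proof (rule A.homotopy_colimit)
    fix H j
    assume H [simp]: "H \<in> Ob T" and j: "\<And>n. j n \<in> Hom T (tX A n) H"
      and j_i: "\<And>n. j (Suc n) \<cdot> ti A (Suc n) = j n"
      and surj: "\<And>S. S \<in> C \<Longrightarrow> hom_surj T S (j 0)"
      and ker: "\<forall>S\<in>C. \<forall>x\<in>Hom T S (tX A 0). j 0 \<cdot> x = Zero T S H \<longrightarrow> ti A (Suc 0) \<cdot> x = Zero T S (tX A 1)"
    note [simp] = hom_typed[OF j]
    obtain Y k k' where Y [simp]: "Y \<in> Ob T" and k: "k \<in> Hom T (SigO T Y) H" "inverse_ars T k k'"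
      using sus_ess_surj[OF H] by (auto simp: isomorphic_def is_iso_def)
    have [simp]: "k \<in> Ar T" "Dom T k = SigO T Y" "Cod T k = H" "k' \<in> Ar T" "Dom T k' = H" "Cod T k' = SigO T Y"
      and kk': "k \<cdot> k' = Idn T H" and k'k: "k' \<cdot> k = Idn T (SigO T Y)"
      using k by (auto simp: Hom_iff inverse_ars_def)
    \<comment> \<open>The tower of \<open>A\<close> with the morphisms to the homotopy colimit, seen as \<open>\<Sigma>Y\<close>.\<close>
    define A' where "A' = \<lparr>tX = tX A, tP = tP A, tf = tf A, ti = ti A, tq = tq A, rX = Y, rp = (\<lambda>n. k' \<cdot> j n)\<rparr>"
    have forget: "forgetO A' = A" by (simp add: A'_def forgetO_def)
    have fields [simp]: "tX A' = tX A" "tP A' = tP A" "tf A' = tf A" "ti A' = ti A" "tq A' = tq A"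
      "rX A' = Y" "rp A' n = k' \<cdot> j n" "prevO T A' = prevO T A" "differential T A' = differential T A" for n
      using prevO_forgetO[of T A', unfolded forget] forgetO_postnikov(1)[of T A', unfolded forget]
      by (simp_all add: A'_def)
    have tower: "is_tower A'" using A.tower by (simp add: postnikov_tower_def)
    have "is_system A'" using A tower by (simp add: postnikov_system_def)
    then have ex: "exact_tower T \<kappa> C A'" by (rule system_exact_tower)
    note a = augmentation_typed[OF ex, unfolded fields]
    have a_typed [simp]: "augmentation T A' \<in> Ar T" "Dom T (augmentation T A') = SigO T (tP A 0)"
      "Cod T (augmentation T A') = SigO T Y" and aq: "augmentation T A' \<cdot> tq A 0 = k' \<cdot> j 0"
      using a by (simp_all add: Hom_iff)
    have q: "inv_ar T (tq A 0) \<in> Ar T" "Dom T (inv_ar T (tq A 0)) = SigO T (tP A 0)"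
      "Cod T (inv_ar T (tq A 0)) = tX A 0" "tq A 0 \<cdot> inv_ar T (tq A 0) = Idn T (SigO T (tP A 0))"
      using A.tq_0_iso by (simp_all add: inverse_ars_def Hom_iff)
    note [simp] = q(1-3)
    have epi: "is_epi ModC (yonA T C (augmentation T A'))"
      unfolding yonA_epi_iff[OF C_Ob coproduct_closed a_typed(1)]
    proof
      fix S assume S: "S \<in> C"
      show "hom_surj T S (augmentation T A')"
      proof (rule hom_surjI)
        fix y assume y: "y \<in> Hom T S (Cod T (augmentation T A'))"
        note [simp] = hom_typed[OF y]
        obtain x where x: "x \<in> Hom T S (tX A 0)" "j 0 \<cdot> x = k \<cdot> y"
          using hom_surjE[OF surj[OF S], of "k \<cdot> y"] by (auto simp: Hom_iff)
        note [simp] = hom_typed[OF x(1)]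
        have "augmentation T A' \<cdot> (tq A 0 \<cdot> x) = y"
          by (simp add: comp_reduce[OF aq] x(2) comp_reduce[OF k'k])
        then show "\<exists>x\<in>Hom T S (Dom T (augmentation T A')). augmentation T A' \<cdot> x = y"
          by (intro bexI[of _ "tq A 0 \<cdot> x"]) (simp_all add: Hom_iff)
      qed simp
    qed
    have exact: "exact_at ModC (yonA T C (differential T A 0)) (yonA T C (augmentation T A'))"
    proof (rule yonA_exactI[OF C_Ob coproduct_closed])
      have "j 0 \<cdot> tf A (Suc 0) = Zero T (tP A (Suc 0)) H"
        using comp_reduce[OF j_i[of 0], of "tf A (Suc 0)"] A.ti_tf[of 0] by simp
      then show "augmentation T A' \<cdot> differential T A 0 =
          Zero T (Dom T (differential T A 0)) (Cod T (augmentation T A'))"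
        by (simp add: differential_def comp_reduce[OF aq])
      fix S z assume S: "S \<in> C" and z: "z \<in> Hom T S (Dom T (augmentation T A'))"
        and zero: "augmentation T A' \<cdot> z = Zero T S (Cod T (augmentation T A'))"
      note [simp] = hom_typed[OF z]
      define x where "x = inv_ar T (tq A 0) \<cdot> z"
      have [simp]: "x \<in> Ar T" "Dom T x = S" "Cod T x = tX A 0" by (simp_all add: x_def)
      have qx: "tq A 0 \<cdot> x = z" by (simp add: x_def comp_reduce[OF q(4)])
      have "k' \<cdot> (j 0 \<cdot> x) = Zero T S (SigO T Y)"
        using zero comp_reduce[OF aq, of x] by (simp add: qx)
      then have "k \<cdot> (k' \<cdot> (j 0 \<cdot> x)) = Zero T S H" by simp
      then have "j 0 \<cdot> x = Zero T S H" by (simp add: comp_reduce[OF kk'])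
      then have "ti A (Suc 0) \<cdot> x = Zero T S (tX A (Suc 0))"
        using ker[rule_format, OF S, of x] by (simp add: Hom_iff)
      then obtain y where y: "y \<in> Hom T S (tP A (Suc 0))" "tf A (Suc 0) \<cdot> y = x"
        using hom_exact[OF A.triangle[of "Suc 0"], of x S] by (auto simp: Hom_iff)
      have "differential T A 0 \<cdot> y = z"
        using y by (simp add: Hom_iff differential_def qx)
      then show "\<exists>y\<in>Hom T S (Dom T (differential T A 0)). differential T A 0 \<cdot> y = z"
        using y(1) by (intro bexI[of _ y]) simp_all
    qed simp_all
    have p_i: "rp A' n = rp A' (Suc n) \<cdot> ti A' (Suc n)" for n
      by (simp add: j_i)
    have "is_resolution A'"
      unfolding postnikov_resolution_def
    proof (intro conjI allI)
      show "rp A' n = rp A' (Suc n) \<cdot> ti A' (Suc n)" for n by (rule p_i)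
      show "rp A' n \<in> Hom T (tX A' n) (SigO T (rX A'))" for n by (simp add: Hom_iff)
      show "projective ModC (yonO T (tP A' n))" for n
        using A by (simp add: postnikov_system_def)
      show "exact_at ModC (yonA T C (differential T A' (Suc n)))
          (yonA T C (SigA T (differential T A' n)))" for n
        using A by (simp add: postnikov_system_def)
    qed (simp_all add: tower epi exact)
    then show thesis using that forget by blast
  qed
qed

text \<open>The composites \<open>rp B n \<cdot> \<psi> n\<close> are a cocone on the tower of \<open>A\<close>.  It extends along \<open>rp A\<close>, and the
  suspension is full.\<close>

lemma forget_full:
  assumes A: "is_resolution A" and B: "is_resolution B"
    and m: "(\<psi>, \<phi>) \<in> post_hom T A B"
  obtains h where "(h, \<psi>, \<phi>) \<in> res_hom T A B"
proof -
  interpret A: exact_tower T \<kappa> C A by (rule resolution_exact_tower[OF A])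
  note [simp] = resolution_typed[OF A] resolution_typed[OF B] post_hom_typed[OF m] A.tower_typed
    postnikov_tower_typed[OF resolution_tower[OF B]]
  have prevB: "prevO T B (Suc n) = tX B n" for n by (simp add: prevO_def)
  have u_i: "(rp B (Suc n) \<cdot> \<psi> (Suc n)) \<cdot> ti A (Suc n) = rp B n \<cdot> \<psi> n" for n
  proof -
    have "(rp B (Suc n) \<cdot> \<psi> (Suc n)) \<cdot> ti A (Suc n) = rp B (Suc n) \<cdot> (ti B (Suc n) \<cdot> \<psi> n)"
      using post_hom_squares(2)[OF m, of "Suc n"] by simp
    also have "\<dots> = rp B n \<cdot> \<psi> n"
      by (simp add: comp_reduce[OF resolutionD(4)[OF B, of n, symmetric]] prevB)
    finally show ?thesis .
  qed
  have "\<exists>k \<in> Hom T (SigO T (rX A)) (SigO T (rX B)). \<forall>n. k \<cdot> rp A n = rp B n \<cdot> \<psi> n"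
  proof (rule A.extend_cocone[of "rp A" "SigO T (rX A)" "\<lambda>n. rp B n \<cdot> \<psi> n" "SigO T (rX B)"])
    show "rp A n \<in> Hom T (tX A n) (SigO T (rX A))" for n by (rule resolutionD(3)[OF A])
    show "rp A (Suc n) \<cdot> ti A (Suc n) = rp A n" for n by (rule resolutionD(4)[OF A, symmetric])
    show "hom_surj T S (rp A 0)" if "S \<in> C" for S by (rule resolution_augmentation(1)[OF A that])
    show "ti A (Suc 0) \<cdot> x = Zero T S (tX A 1)"
      if "S \<in> C" "x \<in> Hom T S (tX A 0)" "rp A 0 \<cdot> x = Zero T S (SigO T (rX A))" for S x
      using resolution_augmentation(2)[OF A that] by simp
    show "rp B n \<cdot> \<psi> n \<in> Hom T (tX A n) (SigO T (rX B))" for n by (simp add: Hom_iff)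
    show "(rp B (Suc n) \<cdot> \<psi> (Suc n)) \<cdot> ti A (Suc n) = rp B n \<cdot> \<psi> n" for n by (rule u_i)
  next
    fix k assume "k \<in> Hom T (SigO T (rX A)) (SigO T (rX B))" "\<And>n. k \<cdot> rp A n = rp B n \<cdot> \<psi> n"
    then show ?thesis by (intro bexI[of _ k]) simp_all
  qed
  then obtain k where k: "k \<in> Hom T (SigO T (rX A)) (SigO T (rX B))" "\<And>n. k \<cdot> rp A n = rp B n \<cdot> \<psi> n"
    by (elim bexE) simp
  obtain h where h: "h \<in> Hom T (rX A) (rX B)" "SigA T h = k"
    using sus_full[OF k(1)] by auto
  have "(h, \<psi>, \<phi>) \<in> res_hom T A B" using h k(2) m by (simp add: res_hom_def)
  then show thesis by (rule that)
qed

definition forget_ar :: "('o, 'm) pres_ar \<Rightarrow> ('o, 'm) post_ar" where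
  "forget_ar = (\<lambda>(A, B, h, \<psi>, \<phi>). (forgetO A, forgetO B, \<psi>, \<phi>))"

lemma forget_ar_simp [simp]: "forget_ar (A, B, h, \<psi>, \<phi>) = (forgetO A, forgetO B, \<psi>, \<phi>)"
  by (simp add: forget_ar_def)

lemma forget_functor: "cat_functor Res Sys forgetO forget_ar"
proof (intro cat_functor.intro cat_functor_axioms.intro)
  show "category Res""category Sys" by (rule category_Res category_Sys)+
  show "forgetO A \<in> Ob Sys" if "A \<in> Ob Res" for A using system_of_resolution that by simp
  show "forget_ar f \<in> Hom Sys (forgetO A) (forgetO B)" if "f \<in> Hom Res A B" for f A B
    using that system_of_resolution by (cases f) (auto simp: Hom_iff dest: res_hom_typed(4))
  show "forget_ar (Idn Res A) = Idn Sys (forgetO A)" for A by simp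
  show "forget_ar (g \<cdot>\<^bsub>Res\<^esub> f) = forget_ar g \<cdot>\<^bsub>Sys\<^esub> forget_ar f" for f g
    by (cases f; cases g) simp
qed

lemma forget_congruence_functor:
  "congruence_functor Res res_homotopy Sys sys_homotopy forgetO forget_ar"
proof (intro congruence_functor.intro congruence_functor_axioms.intro)
  show "(forget_ar f, forget_ar f') \<in> sys_homotopy"
    if "(f, f') \<in> res_homotopy" for f f'
    using that system_of_resolution by (cases f; cases f') (auto dest: res_hom_typed(4))
qed (rule congruence_Res congruence_Sys forget_functor)+

lemma forget_surjective: "forgetO ` Ob hRes = Ob hSys"
proof (intro equalityI subsetI)
  fix A assume "A \<in> forgetO ` Ob hRes"
  then show "A \<in> Ob hSys"
    using system_of_resolution by (auto simp: hPres_def hPost_def quotient_cat_def)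
next
  fix A assume "A \<in> Ob hSys"
  then have "is_system A" by (simp add: hPost_def quotient_cat_def)
  then obtain A' where "is_resolution A'" "forgetO A' = A" by (rule resolution_exists)
  then show "A \<in> forgetO ` Ob hRes"
    by (intro image_eqI[of _ _ A']) (simp_all add: hPres_def quotient_cat_def)
qed

text \<open>Arrows are identified by homotopy, which does not involve the component \<open>h\<close>; so faithfulness is
  immediate and fullness is \<open>forget_full\<close>.\<close>

lemma forget_equivalence:
  "is_equivalence hRes hSys forgetO (forgetA \<kappa> \<alpha> T C)"
proof -
  interpret F: congruence_functor Res "res_homotopy" Sys "sys_homotopy" forgetO forget_ar
    by (rule forget_congruence_functor)
  have induced: "forgetA \<kappa> \<alpha> T C = F.induced"
    by (rule ext) (unfold F.induced_def, simp only: forgetA_def forget_ar_def)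
  show ?thesis
    unfolding induced
  proof (rule equivalence_of_surjective)
    show "cat_functor hRes hSys forgetO F.induced"
      unfolding hPres_def hPost_def by (rule F.induced_functor)
    show "forgetO ` Ob hRes = Ob hSys" by (rule forget_surjective)
    fix A B assume "A \<in> Ob hRes" "B \<in> Ob hRes"
    then have A: "is_resolution A" and B: "is_resolution B"
      by (simp_all add: hPres_def quotient_cat_def)
    show "bij_betw F.induced (Hom hRes A B) (Hom hSys (forgetO A) (forgetO B))"
      unfolding hPres_def hPost_def
    proof (rule F.induced_bij)
      fix g assume "g \<in> Hom Sys (forgetO A) (forgetO B)"
      then obtain \<psi> \<phi> where g: "g = (forgetO A, forgetO B, \<psi>, \<phi>)" "(\<psi>, \<phi>) \<in> post_hom T A B"
        unfolding post_hom_Sys by auto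
      obtain h where "(h, \<psi>, \<phi>) \<in> res_hom T A B" by (rule forget_full[OF A B g(2)])
      then show "\<exists>f\<in>Hom Res A B. forget_ar f = g"
        using A B g(1) by (intro bexI[of _ "(A, B, h, \<psi>, \<phi>)"]) (simp_all add: Hom_iff)
    next
      fix f f' assume "f \<in> Hom Res A B" "f' \<in> Hom Res A B"
        "(forget_ar f, forget_ar f') \<in> sys_homotopy"
      then show "(f, f') \<in> res_homotopy"
        by (cases f; cases f') (auto simp: Hom_iff)
    qed
  qed
qed

end

theorem theorem6p5p2:
  fixes T :: "('o, 'm) tricat" and C :: "'o set" and \<kappa> \<alpha> :: "'k rel"
  assumes "regular_cardinal \<kappa>" and "uncountable_cardinal \<kappa>"
    and "regular_cardinal \<alpha>" and "\<alpha> <o \<kappa>"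
    and "triangulated T" and "has_coproducts \<kappa> T" and "well_generated \<kappa> T"
    and "\<exists>X \<in> Ob T. \<not> is_zero_ob T X"
    and "C \<subseteq> compact_obs \<kappa> \<alpha> T" and "ess_small \<kappa> T C"
    and "\<exists>X \<in> C. \<not> is_zero_ob T X"
    and "closed_under_suspension T C" and "closed_under_desuspension T C"
    and "closed_under_coproducts \<alpha> T C"
    and "generates T C" and "perfect \<kappa> T C"
  shows "is_equivalence (hPres \<kappa> \<alpha> T C) (hPost \<kappa> \<alpha> T C) forgetO (forgetA \<kappa> \<alpha> T C) \<and>
         forgetO ` Ob (hPres \<kappa> \<alpha> T C) = Ob (hPost \<kappa> \<alpha> T C)"
proof -
  interpret postnikov_setting T \<kappa> C \<alpha>
    using assms by (simp add: postnikov_setting_def postnikov_setting_axioms_def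
      perfectly_generated_def perfectly_generated_axioms_def)
  show ?thesis using forget_equivalence forget_surjective by blast
qed

end
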